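(* Let $h\in\mathbb{Z}[x]$ be an intersective polynomial of degree $k\ge 2$ such that $h$ and $h'$ are positive and increasing on $[0,\infty)$, and let the auxiliary polynomials $h_d$ be as described in the context. There is a constant $\kappa_1 = \kappa_1(k) > 0$ depending on $k$ alone, and for every $\delta\in(0,1]$ a constant $C(h,\delta) > 0$ depending on $h$ and $\delta$ alone, such that the following holds whenever $N$ is sufficiently large in terms of $h$ and $\delta$: for every set $A \subset \{1, \ldots, N\}$ with $|A| = \delta N$ and every positive integer $W < N^{\kappa_1}$, $$R(A, h_W) \geq C(h,\delta)\,|A|^2 .$$
   Context: A polynomial $h \in \mathbb{Z}[x]$ is intersective if for every $d>0$ there is an integer $n$ with $d \mid h(n)$; equivalently $h$ has a root in the $p$-adic integers $\mathbb{Z}_p$ for every prime $p$. For each prime $p$ fix a root $z_p \in \mathbb{Z}_p$ of $h$; if $m$ is its multiplicity, set $\lambda(p) = p^m$, and extend $\lambda$ to a completely multiplicative function on the positive integers. For $d = p_1^{\alpha_1}\cdots p_s^{\alpha_s}$, let $r_d$ be the unique integer with $-d < r_d \le 0$ and $r_d \equiv z_{p_i} \pmod{p_i^{\alpha_i}\mathbb{Z}_{p_i}}$ for all $i$. Define $h_d(x) = h(r_d + dx)/\lambda(d)$; this is a polynomial of degree $k$ with integer coefficients. For a polynomial $g$, a finite set $A\subset\mathbb{Z}$ and an integer $n$, let $r(g,n,A)$ be the number of pairs $(a,a') \in A\times A$ with $a - a' = g(n)$, and define $R(A,g) = \sum_{n \ge 0} g'(n)\, r(g,n,A)$. *)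

theory Defs
  imports
    "HOL-Analysis.Analysis"
    "HOL-Algebra.Polynomial_Divisibility"
    "HOL-Computational_Algebra.Computational_Algebra"
begin

text \<open>
  Several names exist both in HOL-Algebra (for list polynomials and for ring records) and in
  HOL-Computational_Algebra; the latter are written here with their qualified names.
\<close>

section \<open>The ring of p-adic integers\<close>

text \<open>
  \<open>\<int>\<^sub>p\<close> is the inverse limit of the rings \<open>\<int>/p\<^sup>n\<close>: an element is a compatible sequence of
  residues, the \<open>n\<close>-th one being represented in \<open>{0..<p\<^sup>n}\<close>.
\<close>

definition Zp :: "nat \<Rightarrow> (nat \<Rightarrow> int) ring" where
  "Zp p = \<lparr>carrier = {x. \<forall>n. x n \<in> {0..<int p ^ n} \<and> x (Suc n) mod int p ^ n = x n},
           monoid.mult = (\<lambda>x y n. (x n * y n) mod int p ^ n),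
           one = (\<lambda>n. 1 mod int p ^ n),
           zero = (\<lambda>n. 0),
           add = (\<lambda>x y n. (x n + y n) mod int p ^ n)\<rparr>"

definition int_to_Zp :: "nat \<Rightarrow> int \<Rightarrow> nat \<Rightarrow> int" where
  "int_to_Zp p a = (\<lambda>n. a mod int p ^ n)"

text \<open>
  The constants \<^const>\<open>ring.is_root\<close> and \<^const>\<open>ring.alg_mult\<close> used below are specified only over
  rings, so we record that \<open>\<int>\<^sub>p\<close> is one, and in fact an integral domain.
\<close>

lemma Zp_cong:
  assumes "x \<in> carrier (Zp p)" "m \<le> n"
  shows "x n mod int p ^ m = x m"
  using assms(2)
proof (induction n rule: dec_induct)
  case base
  have "x m \<in> {0..<int p ^ m}" using assms(1) by (simp add: Zp_def)
  then show ?case by simp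
next
  case (step n)
  have "x (Suc n) mod int p ^ n = x n" using assms(1) by (simp add: Zp_def)
  then have "x n mod int p ^ m = x (Suc n) mod int p ^ m"
    using step.hyps by (metis le_imp_power_dvd mod_mod_cancel)
  then show ?case using step.IH by simp
qed

lemma Zp_closed:
  assumes "p > 0" and "\<And>n. f (Suc n) mod int p ^ n = f n mod int p ^ n"
  shows "(\<lambda>n. f n mod int p ^ n) \<in> carrier (Zp p)"
proof -
  have "f (Suc n) mod int p ^ Suc n mod int p ^ n = f n mod int p ^ n" for n
    using assms(2)[of n] by (simp add: mod_mod_cancel)
  then show ?thesis using assms(1) by (simp add: Zp_def)
qed

lemma cring_Zp:
  assumes "p > 0"
  shows "cring (Zp p)"
proof (rule cringI)
  have suc: "x (Suc n) mod int p ^ n = x n mod int p ^ n" if "x \<in> carrier (Zp p)" for x n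
    using that by (simp add: Zp_def)
  have self: "(\<lambda>n. x n mod int p ^ n) = x" if "x \<in> carrier (Zp p)" for x
    using that by (intro ext) (simp add: Zp_def)
  have at: "x n mod int p ^ n = x n" if "x \<in> carrier (Zp p)" for x n
    using that by (simp add: Zp_def)
  show "abelian_group (Zp p)"
  proof (rule abelian_groupI)
    fix x y assume *: "x \<in> carrier (Zp p)" "y \<in> carrier (Zp p)"
    show "x \<oplus>\<^bsub>Zp p\<^esub> y \<in> carrier (Zp p)"
      using Zp_closed[OF assms, of "\<lambda>n. x n + y n"] suc[OF *(1)] suc[OF *(2)]
      by (simp add: Zp_def) (metis mod_add_eq)
  next
    show "\<zero>\<^bsub>Zp p\<^esub> \<in> carrier (Zp p)" using assms by (simp add: Zp_def)
  next
    fix x y z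
    show "x \<oplus>\<^bsub>Zp p\<^esub> y \<oplus>\<^bsub>Zp p\<^esub> z = x \<oplus>\<^bsub>Zp p\<^esub> (y \<oplus>\<^bsub>Zp p\<^esub> z)" if "x \<in> carrier (Zp p)"
      by (simp add: Zp_def mod_simps add.assoc)
    show "x \<oplus>\<^bsub>Zp p\<^esub> y = y \<oplus>\<^bsub>Zp p\<^esub> x" by (simp add: Zp_def add.commute)
  next
    fix x assume *: "x \<in> carrier (Zp p)"
    show "\<zero>\<^bsub>Zp p\<^esub> \<oplus>\<^bsub>Zp p\<^esub> x = x" using self[OF *] by (simp add: Zp_def)
    have "(\<lambda>n. (- x n) mod int p ^ n) \<in> carrier (Zp p)"
      by (rule Zp_closed[OF assms]) (metis suc[OF *] mod_minus_eq)
    moreover have "(\<lambda>n. (- x n) mod int p ^ n) \<oplus>\<^bsub>Zp p\<^esub> x = \<zero>\<^bsub>Zp p\<^esub>"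
      by (simp add: Zp_def mod_simps)
    ultimately show "\<exists>y\<in>carrier (Zp p). y \<oplus>\<^bsub>Zp p\<^esub> x = \<zero>\<^bsub>Zp p\<^esub>" by blast
  qed
  show "comm_monoid (Zp p)"
  proof (rule comm_monoidI)
    fix x y assume *: "x \<in> carrier (Zp p)" "y \<in> carrier (Zp p)"
    show "x \<otimes>\<^bsub>Zp p\<^esub> y \<in> carrier (Zp p)"
      using Zp_closed[OF assms, of "\<lambda>n. x n * y n"] suc[OF *(1)] suc[OF *(2)]
      by (simp add: Zp_def) (metis mod_mult_eq)
  next
    show "\<one>\<^bsub>Zp p\<^esub> \<in> carrier (Zp p)"
      using Zp_closed[OF assms, of "\<lambda>_. 1"] by (simp add: Zp_def)
  next
    fix x y z
    show "x \<otimes>\<^bsub>Zp p\<^esub> y \<otimes>\<^bsub>Zp p\<^esub> z = x \<otimes>\<^bsub>Zp p\<^esub> (y \<otimes>\<^bsub>Zp p\<^esub> z)" if "x \<in> carrier (Zp p)"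
      by (simp add: Zp_def mod_simps mult.assoc)
    show "x \<otimes>\<^bsub>Zp p\<^esub> y = y \<otimes>\<^bsub>Zp p\<^esub> x" by (simp add: Zp_def mult.commute)
  next
    fix x assume *: "x \<in> carrier (Zp p)"
    show "\<one>\<^bsub>Zp p\<^esub> \<otimes>\<^bsub>Zp p\<^esub> x = x" using self[OF *] by (simp add: Zp_def mod_simps)
  qed
  fix x y z assume "x \<in> carrier (Zp p)" "y \<in> carrier (Zp p)" "z \<in> carrier (Zp p)"
  show "(x \<oplus>\<^bsub>Zp p\<^esub> y) \<otimes>\<^bsub>Zp p\<^esub> z = x \<otimes>\<^bsub>Zp p\<^esub> z \<oplus>\<^bsub>Zp p\<^esub> y \<otimes>\<^bsub>Zp p\<^esub> z"
    by (simp add: Zp_def mod_simps distrib_right)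
qed

lemma domain_Zp:
  assumes "Factorial_Ring.prime p"
  shows "domain (Zp p)"
proof (rule domainI)
  have p: "p > 1" using assms by (rule prime_gt_1_nat)
  then show "cring (Zp p)" by (intro cring_Zp) simp
  show "\<one>\<^bsub>Zp p\<^esub> \<noteq> \<zero>\<^bsub>Zp p\<^esub>"
  proof
    assume "\<one>\<^bsub>Zp p\<^esub> = \<zero>\<^bsub>Zp p\<^esub>"
    then have "\<one>\<^bsub>Zp p\<^esub> 1 = \<zero>\<^bsub>Zp p\<^esub> 1" by (rule fun_cong)
    then have "1 mod int p = 0" by (simp add: Zp_def)
    then show False using p by simp
  qed
next
  fix x y assume xy: "x \<otimes>\<^bsub>Zp p\<^esub> y = \<zero>\<^bsub>Zp p\<^esub>"
    and x: "x \<in> carrier (Zp p)" and y: "y \<in> carrier (Zp p)"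
  have pr: "Factorial_Ring.prime_elem (int p)" using assms by simp
  have prod: "int p ^ n dvd x n * y n" for n
    using xy by (simp add: Zp_def fun_eq_iff mod_eq_0_iff_dvd)
  show "x = \<zero>\<^bsub>Zp p\<^esub> \<or> y = \<zero>\<^bsub>Zp p\<^esub>"
  proof (rule disjCI)
    assume "y \<noteq> \<zero>\<^bsub>Zp p\<^esub>"
    then obtain m where m: "y m \<noteq> 0" by (auto simp: Zp_def)
    have "x n = 0" for n
    proof -
      have "\<not> int p ^ m dvd y (n + m)"
        using Zp_cong[OF y, of m "n + m"] m by (auto simp: mod_eq_0_iff_dvd)
      moreover from this have "m > 0" by (cases m) auto
      moreover have "int p ^ (n + m - 1) dvd x (n + m) * y (n + m)"
        using prod[of "n + m"] by (rule power_le_dvd) simp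
      ultimately have "int p ^ n dvd x (n + m)"
        using prime_elem_power_dvd_cases[OF _ _ pr, of "n + m - 1" "x (n + m)" "y (n + m)" n m]
        by simp
      then show ?thesis using Zp_cong[OF x, of n "n + m"] by auto
    qed
    then show "x = \<zero>\<^bsub>Zp p\<^esub>" by (auto simp: Zp_def)
  qed
qed

section \<open>Intersective polynomials and the auxiliary polynomials\<close>

definition intersective :: "int poly \<Rightarrow> bool" where
  "intersective h \<longleftrightarrow> (\<forall>d>0. \<exists>n. d dvd poly h n)"

text \<open>
  HOL-Algebra represents a polynomial by its coefficients in descending order, without leading
  zeros.
\<close>

definition Zp_poly :: "nat \<Rightarrow> int poly \<Rightarrow> (nat \<Rightarrow> int) list" where
  "Zp_poly p h = map (int_to_Zp p) (rev (coeffs h))"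

definition root_system :: "int poly \<Rightarrow> (nat \<Rightarrow> nat \<Rightarrow> int) \<Rightarrow> bool" where
  "root_system h z \<longleftrightarrow>
     (\<forall>p. Factorial_Ring.prime p \<longrightarrow> ring.is_root (Zp p) (Zp_poly p h) (z p))"

text \<open>
  The product runs over the prime factors of \<open>d\<close> counted with multiplicity, so this is the
  completely multiplicative function with value \<open>p\<^sup>m\<close> at each prime \<open>p\<close>.
\<close>

definition lam :: "int poly \<Rightarrow> (nat \<Rightarrow> nat \<Rightarrow> int) \<Rightarrow> nat \<Rightarrow> nat" where
  "lam h z d = (\<Prod>p\<in>#prime_factorization d. p ^ ring.alg_mult (Zp p) (Zp_poly p h) (z p))"

definition root_rep :: "(nat \<Rightarrow> nat \<Rightarrow> int) \<Rightarrow> nat \<Rightarrow> int" where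
  "root_rep z d = (THE r. - int d < r \<and> r \<le> 0 \<and>
     (\<forall>p\<in>prime_factors d.
        int_to_Zp p r \<ominus>\<^bsub>Zp p\<^esub> z p \<in> PIdl\<^bsub>Zp p\<^esub> (int_to_Zp p (int p ^ multiplicity p d))))"

text \<open>
  The quotient is taken over \<open>\<real>\<close>, so that the division by \<open>\<lambda>(d)\<close> is an exact one.
\<close>

definition aux_poly :: "int poly \<Rightarrow> (nat \<Rightarrow> nat \<Rightarrow> int) \<Rightarrow> nat \<Rightarrow> real poly" where
  "aux_poly h z d =
     Polynomial.smult (1 / real (lam h z d))
       (map_poly real_of_int (pcompose h [:root_rep z d, int d:]))"

section \<open>The weighted counting function\<close>

definition rep_count :: "real poly \<Rightarrow> nat \<Rightarrow> int set \<Rightarrow> nat" where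
  "rep_count g n A = card {(a, a') \<in> A \<times> A. real_of_int (a - a') = poly g (real n)}"

text \<open>
  For finite \<open>A\<close> and nonconstant \<open>g\<close> only finitely many terms of the series are nonzero.
\<close>

definition R_sum :: "int set \<Rightarrow> real poly \<Rightarrow> real" where
  "R_sum A g = (\<Sum>n. poly (pderiv g) (real n) * real (rep_count g n A))"

end

theory Submission
  imports Defs "HOL-Number_Theory.Cong"
begin

text \<open>
  Write \<open>e(t) = exp(2\<pi>it)\<close>. If \<open>W\<close> divides \<open>d\<close>, the values of \<open>h\<^sub>W\<close> along a suitable progression of
  step \<open>d/W\<close> are \<open>\<lambda>(d/W) h\<^sub>d(x)\<close>. Take \<open>d\<^sub>i = W B\<^sup>i\<close> for \<open>i < J\<close>, with \<open>B\<close> highly divisible, and let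
  \<open>x\<close> run over dyadic intervals \<open>[M\<^sub>i, 2 M\<^sub>i)\<close> for which the values at scale \<open>i\<close> are of size about
  \<open>\<rho>\<^sup>i\<^sup>k N\<close>. If the average of \<open>e(\<alpha> h\<^sub>W(n))\<close> at scale \<open>i\<close> exceeds \<open>\<epsilon>\<close> in modulus, Weyl's
  inequality shows that all coefficients of \<open>\<alpha> \<lambda>(B\<^sup>i) h\<^sub>d\<close> are close to rationals with a common bounded
  denominator. Since the nonconstant coefficients of \<open>h\<^sub>d\<close> have a bounded greatest common divisor, then
  \<open>\<alpha> \<lambda>(B\<^sup>i)\<close> itself is close to such a rational, and \<open>\<alpha> h\<^sub>W(n)\<close> is nearly an integer at all later scales. Hence
  for each \<open>\<alpha>\<close> at most one scale is bad, and the real part of the average over all \<open>J\<close> scales is at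
  least \<open>- \<epsilon> - 1/J\<close>. With \<open>\<epsilon>\<close> and \<open>1/J\<close> small compared to \<open>\<delta>\<close>, the zero frequency dominates in the
  Fourier expansion of the weighted number of differences in \<open>A\<close>, so some scale carries a positive
  proportion of the expected number of differences.
\<close>

section \<open>\<open>\<int>\<^sub>p\<close> through residues\<close>

text \<open>The difficulty is uniformity: the constants may depend on \<open>h\<close> and \<delta>,
  but neither on \<open>W\<close> nor on the roots \<open>z\<close>. A p-adic root of
  \<open>h\<close> is a root of some prime factor \<open>f\<close> of \<open>h\<close>, and its
  multiplicity m is the exponent of \<open>f\<close>. So modulo any power of p, \<open>h\<close>
  looks like (x - z_p)^m F(x); the substitution r_d + d x pulls out the p-part of \<lambda>(d), and
  the nonconstant coefficients that remain can share a power of p only if it divides F(z_p). Bezout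
  identities in Z[x] bound this for all p and all roots by one integer \<open>G\<close>.
  \<open>B\<close> is \<open>G * fact C\<close> because a bad frequency has an unknown denominator q
  G with q \<le> C, and each such number must divide the next step. The exponent of N comes from the
  demand that the intervals be longer than the coefficients of h_d, which are of size W^k: this
  costs W^(k+1) < N^(1/k) up to constants, and a further factor 2 makes room for these. The pairs a
  = a' enter the Fourier identity with weight \<epsilon> + 1/J. They contribute a multiple of |A|
  against a main term |A|^2 / (2 N), so \<epsilon> and 1/J are taken as fixed fractions of
  \<delta>.\<close>

lemma Zp_carrierD:
  assumes "x \<in> carrier (Zp p)"
  shows "0 \<le> x n" "x n < int p ^ n" "x n mod int p ^ n = x n"
  using assms by (auto simp: Zp_def)

lemma Zp_simps:
  "\<zero>\<^bsub>Zp p\<^esub> = (\<lambda>n. 0)"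
  "\<one>\<^bsub>Zp p\<^esub> = (\<lambda>n. 1 mod int p ^ n)"
  "x \<oplus>\<^bsub>Zp p\<^esub> y = (\<lambda>n. (x n + y n) mod int p ^ n)"
  "x \<otimes>\<^bsub>Zp p\<^esub> y = (\<lambda>n. (x n * y n) mod int p ^ n)"
  by (simp_all add: Zp_def)

lemma int_to_Zp_closed:
  assumes "p > 0"
  shows "int_to_Zp p a \<in> carrier (Zp p)"
  unfolding int_to_Zp_def by (rule Zp_closed[OF assms]) simp

lemma finsum_Zp:
  assumes p: "p > 0" and "finite I" and "f \<in> I \<rightarrow> carrier (Zp p)"
  shows "finsum (Zp p) f I n = (\<Sum>i\<in>I. f i n) mod int p ^ n"
proof -
  interpret R: cring "Zp p" using p by (rule cring_Zp)
  show ?thesis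
    using assms(2,3)
  proof (induction I rule: finite_induct)
    case empty
    show ?case by (simp add: Zp_simps)
  next
    case (insert i I)
    then have "finsum (Zp p) f (insert i I) = f i \<oplus>\<^bsub>Zp p\<^esub> finsum (Zp p) f I"
      by (intro R.finsum_insert) auto
    then have "finsum (Zp p) f (insert i I) n = (f i n + finsum (Zp p) f I n) mod int p ^ n"
      by (simp add: Zp_simps)
    then show ?case using insert by (simp add: mod_simps)
  qed
qed

lemma nat_pow_Zp:
  assumes "p > 0" "x \<in> carrier (Zp p)"
  shows "(x [^]\<^bsub>Zp p\<^esub> (k::nat)) n = x n ^ k mod int p ^ n"
proof (induction k)
  case 0
  show ?case by (simp add: Zp_def)
next
  case (Suc k)
  interpret R: cring "Zp p" using assms(1) by (rule cring_Zp)
  have "(x [^]\<^bsub>Zp p\<^esub> Suc k) n = ((x [^]\<^bsub>Zp p\<^esub> k) n * x n) mod int p ^ n"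
    by (simp add: Zp_def)
  then show ?case using Suc by (simp add: mod_simps mult.commute)
qed

text \<open>The image of a polynomial over \<open>\<int>\<^sub>p\<close> in \<open>(\<int>/p\<^sup>n)[x]\<close>, lifted to \<open>\<int>[x]\<close>.\<close>

definition Zp_level :: "nat \<Rightarrow> (nat \<Rightarrow> int) list \<Rightarrow> int poly" where
  "Zp_level n l = Poly (map (\<lambda>c. c n) (rev l))"

text \<open>Stated as divisibility by a constant polynomial so that compatibility with products,
  powers and substitutions is ring algebra. \<open>Zp_level\<close> respects products only up to
  this congruence, since coefficients are reduced one by one.\<close>

definition poly_cong :: "int \<Rightarrow> int poly \<Rightarrow> int poly \<Rightarrow> bool" where
  "poly_cong m P Q \<longleftrightarrow> [:m:] dvd P - Q"

lemma poly_cong_coeff: "poly_cong m P Q \<longleftrightarrow> (\<forall>i. m dvd Polynomial.coeff P i - Polynomial.coeff Q i)"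
  by (simp add: poly_cong_def const_poly_dvd_iff)

lemma poly_cong_refl [simp]: "poly_cong m P P"
  by (simp add: poly_cong_def)

lemma poly_cong_sym: "poly_cong m P Q \<Longrightarrow> poly_cong m Q P"
  unfolding poly_cong_def by (metis dvd_minus_iff minus_diff_eq)

lemma poly_cong_trans: "poly_cong m P Q \<Longrightarrow> poly_cong m Q S \<Longrightarrow> poly_cong m P S"
  unfolding poly_cong_def using dvd_add[of "[:m:]" "P - Q" "Q - S"] by simp

lemma poly_cong_mult:
  assumes "poly_cong m P Q" "poly_cong m P' Q'"
  shows "poly_cong m (P * P') (Q * Q')"
proof -
  have "P * P' - Q * Q' = (P - Q) * P' + Q * (P' - Q')" by (simp add: algebra_simps)
  then show ?thesis using assms unfolding poly_cong_def by simp
qed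

lemma poly_cong_power: "poly_cong m P Q \<Longrightarrow> poly_cong m (P ^ e) (Q ^ e)"
  by (induction e) (auto intro: poly_cong_mult)

lemma poly_cong_pcompose:
  assumes "poly_cong m P Q"
  shows "poly_cong m (pcompose P S) (pcompose Q S)"
proof -
  obtain T where "P - Q = [:m:] * T" using assms unfolding poly_cong_def by blast
  then have "pcompose P S - pcompose Q S = [:m:] * pcompose T S"
    by (metis pcompose_diff pcompose_mult pcompose_const)
  then show ?thesis unfolding poly_cong_def by (metis dvd_triv_left)
qed

lemma poly_cong_poly:
  assumes "poly_cong m P Q"
  shows "m dvd poly P a - poly Q a"
proof -
  obtain T where "P - Q = [:m:] * T" using assms unfolding poly_cong_def by blast
  then have "poly P a - poly Q a = m * poly T a"
    by (metis poly_diff poly_mult poly_pCons poly_0 mult_zero_right add_0_right)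
  then show ?thesis by simp
qed

lemma poly_cong_pcompose_right:
  assumes "poly_cong m S T"
  shows "poly_cong m (pcompose P S) (pcompose P T)"
proof (induction P)
  case (pCons a P)
  have "poly_cong m (S * pcompose P S) (T * pcompose P T)"
    by (intro poly_cong_mult assms pCons)
  then show ?case by (simp add: poly_cong_def pcompose_pCons)
qed simp

lemma pcompose_power: "pcompose (A ^ n) B = pcompose A B ^ n"
  for A B :: "int poly"
  by (induction n) (simp_all add: pcompose_mult pcompose_1)

text \<open>Substituting x + a turns the factor into x^e, and multiplication by that merely shifts
  coefficients. So the cancellation is valid for every modulus, although residues modulo
  \<open>m\<close> may have zero divisors.\<close>

lemma poly_cong_cancel_linear_power:
  assumes "poly_cong m ([:- a, 1:] ^ e * P) ([:- a, 1:] ^ e * Q)"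
  shows "poly_cong m P Q"
proof -
  define S where "S = pcompose (P - Q) [:a, 1:]"
  have "pcompose [:- a, 1:] [:a, 1:] = [:0, 1:]" by (simp add: pcompose_pCons)
  then have "pcompose ([:- a, 1:] ^ e * (P - Q)) [:a, 1:] = [:0, 1:] ^ e * S"
    unfolding S_def pcompose_mult pcompose_power by simp
  moreover have "poly_cong m ([:- a, 1:] ^ e * (P - Q)) 0"
    using assms unfolding poly_cong_def by (simp add: right_diff_distrib)
  ultimately have "poly_cong m ([:0, 1:] ^ e * S) 0"
    using poly_cong_pcompose[of m "[:- a, 1:] ^ e * (P - Q)" 0 "[:a, 1:]"] by simp
  then have "poly_cong m (Polynomial.monom 1 e * S) 0"
    by (simp add: monom_altdef)
  then have "m dvd Polynomial.coeff S i" for i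
    unfolding poly_cong_coeff by (drule_tac spec[of _ "e + i"]) (simp add: coeff_monom_mult)
  then have "poly_cong m S 0" unfolding poly_cong_coeff by simp
  then have "poly_cong m (pcompose S [:- a, 1:]) 0"
    using poly_cong_pcompose[of m S 0] by simp
  moreover have "pcompose S [:- a, 1:] = P - Q"
    unfolding S_def by (simp add: pcompose_assoc[symmetric] pcompose_pCons pcompose_idR)
  ultimately show ?thesis unfolding poly_cong_def by simp
qed

lemma coeff_Zp_level:
  assumes "p > 0"
  shows "ring.coeff (Zp p) l i n = Polynomial.coeff (Zp_level n l) i"
proof -
  interpret R: cring "Zp p" using assms by (rule cring_Zp)
  show ?thesis
  proof (induction l)
    case Nil
    show ?case by (simp add: Zp_simps Zp_level_def)
  next
    case (Cons c l)
    then show ?case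
      by (auto simp: Zp_level_def coeff_Poly_eq nth_default_append nth_default_def nth_append)
  qed
qed

lemma Zp_level_mult:
  assumes p: "p > 0" and l: "set l \<subseteq> carrier (Zp p)" "set l' \<subseteq> carrier (Zp p)"
  shows "Polynomial.coeff (Zp_level n (ring.poly_mult (Zp p) l l')) i =
    Polynomial.coeff (Zp_level n l * Zp_level n l') i mod int p ^ n"
proof -
  interpret R: cring "Zp p" using p by (rule cring_Zp)
  have c: "R.coeff l j \<in> carrier (Zp p)" "R.coeff l' j \<in> carrier (Zp p)" for j
    using l by simp_all
  have "Polynomial.coeff (Zp_level n (R.poly_mult l l')) i = R.coeff (R.poly_mult l l') i n"
    by (rule coeff_Zp_level[OF p, symmetric])
  also have "\<dots> = finsum (Zp p) (\<lambda>k. R.coeff l k \<otimes>\<^bsub>Zp p\<^esub> R.coeff l' (i - k)) {..i} n"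
    by (simp add: R.poly_mult_coeff[OF l])
  also have "\<dots> = (\<Sum>k\<le>i. (R.coeff l k \<otimes>\<^bsub>Zp p\<^esub> R.coeff l' (i - k)) n) mod int p ^ n"
    using c by (intro finsum_Zp[OF p]) auto
  also have "\<dots> = (\<Sum>k\<le>i. R.coeff l k n * R.coeff l' (i - k) n mod int p ^ n) mod int p ^ n"
    by (simp add: Zp_def)
  also have "\<dots> = Polynomial.coeff (Zp_level n l * Zp_level n l') i mod int p ^ n"
    by (simp add: mod_sum_eq coeff_mult coeff_Zp_level[OF p])
  finally show ?thesis .
qed

lemma poly_cong_Zp_level_mult:
  assumes "p > 0" "set l \<subseteq> carrier (Zp p)" "set l' \<subseteq> carrier (Zp p)"
  shows "poly_cong (int p ^ n) (Zp_level n (ring.poly_mult (Zp p) l l')) (Zp_level n l * Zp_level n l')"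
  unfolding poly_cong_coeff Zp_level_mult[OF assms]
  by (metis mod_eq_dvd_iff mod_mod_trivial)

lemma coeff_Zp_poly:
  assumes "p > 0"
  shows "ring.coeff (Zp p) (Zp_poly p h) i = int_to_Zp p (Polynomial.coeff h i)"
proof
  fix n
  have "Zp_level n (Zp_poly p h) = Poly (map (\<lambda>a. a mod int p ^ n) (coeffs h))"
    by (simp add: Zp_level_def Zp_poly_def int_to_Zp_def rev_map o_def)
  then show "ring.coeff (Zp p) (Zp_poly p h) i n = int_to_Zp p (Polynomial.coeff h i) n"
    unfolding coeff_Zp_level[OF assms]
    by (simp add: coeff_Poly_eq int_to_Zp_def nth_default_map_eq[of _ 0 0] nth_default_coeffs_eq)
qed

lemma poly_cong_Zp_level_Zp_poly:
  assumes "p > 0"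
  shows "poly_cong (int p ^ n) (Zp_level n (Zp_poly p h)) h"
  unfolding poly_cong_coeff coeff_Zp_level[OF assms, symmetric] coeff_Zp_poly[OF assms] int_to_Zp_def
  by (metis mod_eq_dvd_iff mod_mod_trivial)

lemma eq_0_of_all_powers_dvd:
  assumes "p > 1" "\<And>n. int p ^ n dvd a"
  shows "a = 0"
proof (rule ccontr)
  assume a: "a \<noteq> 0"
  have "nat \<bar>a\<bar> < 2 ^ nat \<bar>a\<bar>" by (rule less_exp)
  also have "\<dots> \<le> p ^ nat \<bar>a\<bar>" using assms(1) by (intro power_mono) auto
  finally have "\<bar>a\<bar> < int p ^ nat \<bar>a\<bar>" by (metis nat_less_iff abs_ge_zero of_nat_power)
  moreover have "int p ^ nat \<bar>a\<bar> \<le> \<bar>a\<bar>" using assms(2) a by (intro zdvd_imp_le) auto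
  ultimately show False by simp
qed

lemma Zp_poly_closed:
  assumes "p > 1"
  shows "Zp_poly p h \<in> carrier (poly_ring (Zp p))"
proof -
  have p: "p > 0" using assms by simp
  have "int_to_Zp p (Polynomial.lead_coeff h) \<noteq> \<zero>\<^bsub>Zp p\<^esub>" if "h \<noteq> 0"
  proof
    assume "int_to_Zp p (Polynomial.lead_coeff h) = \<zero>\<^bsub>Zp p\<^esub>"
    then have "Polynomial.lead_coeff h mod int p ^ n = 0" for n
      by (simp add: int_to_Zp_def Zp_def fun_eq_iff)
    then have "Polynomial.lead_coeff h = 0"
      using assms by (intro eq_0_of_all_powers_dvd) auto
    then show False using that by simp
  qed
  moreover have "hd (Zp_poly p h) = int_to_Zp p (Polynomial.lead_coeff h)" if "h \<noteq> 0"
    using that by (simp add: Zp_poly_def hd_map hd_rev last_coeffs_eq_coeff_degree)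
  ultimately have "polynomial\<^bsub>Zp p\<^esub> (carrier (Zp p)) (Zp_poly p h)"
    unfolding polynomial_def using int_to_Zp_closed[OF p] by (auto simp: Zp_poly_def)
  then show ?thesis by (simp add: univ_poly_carrier)
qed

lemma set_Zp_poly: "p > 0 \<Longrightarrow> set (Zp_poly p h) \<subseteq> carrier (Zp p)"
  using int_to_Zp_closed by (auto simp: Zp_poly_def)

lemma Zp_poly_mult:
  assumes "Factorial_Ring.prime p"
  shows "Zp_poly p (f * g) = Zp_poly p f \<otimes>\<^bsub>poly_ring (Zp p)\<^esub> Zp_poly p g"
proof -
  have p1: "p > 1" using assms by (rule prime_gt_1_nat)
  then have p: "p > 0" by simp
  interpret R: domain "Zp p" using assms by (rule domain_Zp)
  interpret UP: domain "poly_ring (Zp p)" using R.univ_poly_is_domain[OF R.carrier_is_subring] .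
  have "R.coeff (Zp_poly p (f * g)) = R.coeff (Zp_poly p f \<otimes>\<^bsub>poly_ring (Zp p)\<^esub> Zp_poly p g)"
  proof (intro ext)
    fix i n
    have "R.coeff (Zp_poly p f \<otimes>\<^bsub>poly_ring (Zp p)\<^esub> Zp_poly p g) i n =
       Polynomial.coeff (Zp_level n (Zp_poly p f) * Zp_level n (Zp_poly p g)) i mod int p ^ n"
      unfolding univ_poly_mult coeff_Zp_level[OF p] by (intro Zp_level_mult p set_Zp_poly)
    also have "\<dots> = Polynomial.coeff (f * g) i mod int p ^ n"
      using poly_cong_mult[OF poly_cong_Zp_level_Zp_poly[OF p, of n f] poly_cong_Zp_level_Zp_poly[OF p, of n g]]
      by (simp only: poly_cong_coeff mod_eq_dvd_iff)
    finally show "R.coeff (Zp_poly p (f * g)) i n = R.coeff (Zp_poly p f \<otimes>\<^bsub>poly_ring (Zp p)\<^esub> Zp_poly p g) i n"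
      by (simp add: coeff_Zp_poly[OF p] int_to_Zp_def)
  qed
  moreover have "polynomial\<^bsub>Zp p\<^esub> (carrier (Zp p)) (Zp_poly p (f * g))"
    "polynomial\<^bsub>Zp p\<^esub> (carrier (Zp p)) (Zp_poly p f \<otimes>\<^bsub>poly_ring (Zp p)\<^esub> Zp_poly p g)"
    unfolding univ_poly_carrier using Zp_poly_closed[OF p1] by auto
  ultimately show ?thesis by (simp add: R.coeff_iff_polynomial_cond)
qed

lemma Zp_level_Cons: "Zp_level n (c # l) = Zp_level n l + Polynomial.monom (c n) (length l)"
  by (intro poly_eqI)
    (auto simp: Zp_level_def coeff_Poly_eq nth_default_append nth_default_def nth_append)

lemma eval_Zp:
  assumes p: "p > 0" and "set l \<subseteq> carrier (Zp p)" "x \<in> carrier (Zp p)"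
  shows "ring.eval (Zp p) l x n = poly (Zp_level n l) (x n) mod int p ^ n"
proof -
  interpret R: cring "Zp p" using p by (rule cring_Zp)
  show ?thesis using assms(2)
  proof (induction l)
    case Nil
    show ?case by (simp add: Zp_simps Zp_level_def)
  next
    case (Cons c l)
    have "R.eval (c # l) x = c \<otimes>\<^bsub>Zp p\<^esub> x [^]\<^bsub>Zp p\<^esub> length l \<oplus>\<^bsub>Zp p\<^esub> R.eval l x" by simp
    then have "R.eval (c # l) x n = ((c n * (x [^]\<^bsub>Zp p\<^esub> length l) n) mod int p ^ n + R.eval l x n) mod int p ^ n"
      by (simp add: Zp_simps)
    also have "\<dots> = (c n * x n ^ length l + poly (Zp_level n l) (x n)) mod int p ^ n"
      using Cons nat_pow_Zp[OF p assms(3)] by (simp add: mod_simps)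
    finally show ?case by (simp add: Zp_level_Cons poly_monom add.commute)
  qed
qed

text \<open>An element of the inverse limit is zero exactly if all its residues are. The condition
  \<open>h \<noteq> 0\<close> is there because \<open>ring.is_root\<close> is false for the zero
  polynomial.\<close>

lemma is_root_Zp_poly_iff:
  assumes "p > 1" "x \<in> carrier (Zp p)" "h \<noteq> 0"
  shows "ring.is_root (Zp p) (Zp_poly p h) x \<longleftrightarrow> (\<forall>n. int p ^ n dvd poly h (x n))"
proof -
  have p: "p > 0" using assms by simp
  interpret R: cring "Zp p" using p by (rule cring_Zp)
  have "R.eval (Zp_poly p h) x n = poly h (x n) mod int p ^ n" for n
    using eval_Zp[OF p set_Zp_poly[OF p] assms(2), of h n]
      poly_cong_poly[OF poly_cong_Zp_level_Zp_poly[OF p, of n h], of "x n"]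
    by (simp add: mod_eq_dvd_iff)
  moreover have "Zp_poly p h \<noteq> []" using assms(3) by (simp add: Zp_poly_def)
  ultimately show ?thesis
    using assms(2) by (auto simp: R.is_root_def fun_eq_iff Zp_simps mod_eq_0_iff_dvd)
qed

section \<open>Multiplicities of roots and the content of \<open>h\<^sub>d\<close>\<close>

text \<open>Over the rationals this is coprimality of an irreducible polynomial and one it does not
  divide. Over Z, the gcd is replaced by a nonzero combination \<open>w\<close> of least degree, and
  Euclidean division by pseudo-division.\<close>

lemma bezout_constant_of_prime_poly:
  fixes f g :: "int poly"
  assumes f: "Factorial_Ring.prime_elem f" and deg: "Polynomial.degree f > 0" and ndvd: "\<not> f dvd g"
  obtains A B R where "A * f + B * g = [:R:]" "R \<noteq> 0"
proof -
  define I where "I = {w. w \<noteq> 0 \<and> (\<exists>A B. w = A * f + B * g)}"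
  have "f = 1 * f + 0 * g" by simp
  then have "f \<in> I" unfolding I_def using f unfolding prime_elem_def by blast
  then obtain w where w: "w \<in> I" "\<And>v. v \<in> I \<Longrightarrow> Polynomial.degree w \<le> Polynomial.degree v"
    using ex_has_least_nat[of "\<lambda>w. w \<in> I" f Polynomial.degree] by blast
  obtain A B where AB: "w = A * f + B * g" and w0: "w \<noteq> 0" using w(1) unfolding I_def by blast
  \<comment> \<open>The pseudo-remainder is again a combination of \<open>f\<close> and
    \<open>g\<close>, of smaller degree than \<open>w\<close>, hence zero by minimality.\<close>
  have multiple: "\<exists>c Q. c \<noteq> 0 \<and> [:c:] * u = w * Q" if u: "u = A' * f + B' * g" for u A' B'
  proof -
    obtain Q r where Qr: "pseudo_divmod u w = (Q, r)" by (cases "pseudo_divmod u w")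
    define c where "c = Polynomial.coeff w (Polynomial.degree w) ^ (Suc (Polynomial.degree u) - Polynomial.degree w)"
    have c: "Polynomial.smult c u = w * Q + r" "r = 0 \<or> Polynomial.degree r < Polynomial.degree w"
      using pseudo_divmod[OF w0 Qr] unfolding c_def by auto
    have "r = ([:c:] * A' - Q * A) * f + ([:c:] * B' - Q * B) * g"
      using c(1) u AB by (simp add: algebra_simps smult_add_right)
    then have "r \<noteq> 0 \<Longrightarrow> r \<in> I" unfolding I_def by blast
    then have "r = 0" using w(2) c(2) by fastforce
    then have "[:c:] * u = w * Q" using c(1) by simp
    moreover have "c \<noteq> 0" unfolding c_def using w0 by simp
    ultimately show ?thesis by blast
  qed
  \<comment> \<open>If \<open>w\<close> had positive degree, \<open>f\<close> would divide it,
    because \<open>w\<close> divides a constant multiple of \<open>f\<close> with a cofactor that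
    \<open>f\<close> cannot divide. As \<open>w\<close> also divides a constant multiple of
    \<open>g\<close>, the prime \<open>f\<close> would then divide \<open>g\<close>.\<close>
  have "Polynomial.degree w = 0"
  proof (rule ccontr)
    assume dw: "Polynomial.degree w \<noteq> 0"
    obtain c Q where cQ: "c \<noteq> 0" "[:c:] * f = w * Q" using multiple[of f 1 0] by auto
    have "f dvd w * Q" using cQ(2) by (metis dvd_triv_right)
    then have "f dvd w \<or> f dvd Q" using f by (simp add: prime_elem_dvd_mult_iff)
    moreover have "\<not> f dvd Q"
    proof
      assume "f dvd Q"
      then obtain T where "Q = f * T" by blast
      then have "f * [:c:] = f * (w * T)" using cQ(2) by (simp add: mult_ac)
      moreover have "f \<noteq> 0" using deg by auto
      ultimately have "[:c:] = w * T" by (metis mult_left_cancel)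
      moreover from this cQ(1) have "T \<noteq> 0" by auto
      ultimately have "Polynomial.degree [:c:] = Polynomial.degree w + Polynomial.degree T"
        using w0 by (simp add: degree_mult_eq)
      then show False using dw by simp
    qed
    ultimately have fw: "f dvd w" by blast
    obtain c' Q' where cQ': "c' \<noteq> 0" "[:c':] * g = w * Q'" using multiple[of g 0 1] by auto
    have "f dvd [:c':] * g" using fw cQ'(2) by simp
    then have "f dvd [:c':]" using f ndvd prime_elem_dvd_mult_iff by blast
    then have "Polynomial.degree f \<le> Polynomial.degree [:c':]" using cQ'(1) by (intro dvd_imp_degree_le) auto
    then show False using deg by simp
  qed
  then obtain R where "w = [:R:]" by (rule degree_eq_zeroE)
  then show thesis using that[of A B R] AB w0 by auto
qed

text \<open>The constant \<open>R ^ e\<close> controls, at every root of \<open>f\<close> and for all primes at once, the first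
  nonvanishing Taylor coefficient of \<open>h = f ^ e * q\<close>.\<close>

lemma prime_factor_constant:
  fixes f q :: "int poly"
  assumes f: "Factorial_Ring.prime_elem f" and deg: "Polynomial.degree f > 0" and ndvd: "\<not> f dvd q"
  obtains R where "R \<noteq> 0" "\<And>m v a. e > 0 \<Longrightarrow> v dvd m \<Longrightarrow> m dvd poly f a \<Longrightarrow>
     v dvd poly (synthetic_div f a ^ e * q) a \<Longrightarrow> v dvd R ^ e"
proof -
  \<comment> \<open>Separability of \<open>f\<close>: by degree it cannot divide its own
    derivative.\<close>
  have "\<not> f dvd q * pderiv f"
  proof
    assume "f dvd q * pderiv f"
    then have "f dvd pderiv f" using ndvd f prime_elem_dvd_mult_iff by blast
    moreover have "pderiv f \<noteq> 0" using deg by (simp add: pderiv_eq_0_iff)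
    ultimately have "Polynomial.degree f \<le> Polynomial.degree (pderiv f)" by (intro dvd_imp_degree_le)
    then show False using deg by (simp add: degree_pderiv)
  qed
  from bezout_constant_of_prime_poly[OF f deg this] obtain A B R
    where R: "A * f + B * (q * pderiv f) = [:R:]" "R \<noteq> 0" by blast
  show thesis
  proof (rule that[OF R(2)])
    fix m v a
    assume e: "e > 0" and v: "v dvd m" "m dvd poly f a" "v dvd poly (synthetic_div f a ^ e * q) a"
    define f1 where "f1 = synthetic_div f a"
    \<comment> \<open>Differentiating the division by x - a gives f'(a) = f1(a), so the Bezout
      identity at \<open>a\<close> reads R = B(a) q(a) f1(a) modulo \<open>v\<close>.\<close>
    have "f = [:- a, 1:] * f1 + [:poly f a:]"
      unfolding f1_def by (simp only: synthetic_div_correct')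
    then have "pderiv f = pderiv ([:- a, 1:] * f1 + [:poly f a:])" by simp
    then have "poly (pderiv f) a = poly f1 a"
      by (simp only: pderiv_add pderiv_mult) (simp add: pderiv_pCons)
    then have "R = poly A a * poly f a + poly B a * (poly q a * poly f1 a)"
      using arg_cong[OF R(1), of "\<lambda>P. poly P a"] by simp
    moreover have "v dvd poly f a" using v by (meson dvd_trans)
    ultimately have cong: "[R = poly B a * (poly q a * poly f1 a)] (mod v)"
      by (simp add: cong_iff_dvd_diff)
    have "[R ^ e = (poly B a * (poly q a * poly f1 a)) ^ e] (mod v)" by (rule cong_pow[OF cong])
    \<comment> \<open>The \<open>e\<close>-th power is taken because only f1^e q, not f1 q, is known
      to be divisible by \<open>v\<close>.\<close>
    moreover have "v dvd (poly B a * (poly q a * poly f1 a)) ^ e"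
    proof -
      obtain e' where e': "e = Suc e'" using e by (cases e) auto
      have "(poly B a * (poly q a * poly f1 a)) ^ e = poly (f1 ^ e * q) a * (poly B a ^ e * poly q a ^ e')"
        unfolding e' by (simp add: power_mult_distrib mult_ac)
      then show ?thesis using v(3) unfolding f1_def by simp
    qed
    ultimately show "v dvd R ^ e" by (simp add: cong_dvd_iff)
  qed
qed

definition Zp_root :: "nat \<Rightarrow> (nat \<Rightarrow> int) \<Rightarrow> int poly \<Rightarrow> bool" where
  "Zp_root p x f \<longleftrightarrow> (\<forall>n. int p ^ n dvd poly f (x n))"

text \<open>Polynomials respect congruences, so the values of \<open>f\<close> and \<open>g\<close>
  along \<open>x\<close> are elements of the integral domain Z_p, and their product is zero.\<close>

lemma Zp_root_mult:
  assumes "Factorial_Ring.prime p" "x \<in> carrier (Zp p)" "Zp_root p x (f * g)"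
  shows "Zp_root p x f \<or> Zp_root p x g"
proof -
  have p1: "p > 1" using assms(1) by (rule prime_gt_1_nat)
  interpret R: domain "Zp p" using assms(1) by (rule domain_Zp)
  have dvd: "int p ^ n dvd x (Suc n) - x n" for n
  proof -
    have "x (Suc n) mod int p ^ n = x n mod int p ^ n"
      using assms(2) Zp_carrierD(3)[OF assms(2)] by (simp add: Zp_def)
    then show ?thesis by (simp add: mod_eq_dvd_iff)
  qed
  have closed: "(\<lambda>n. poly f (x n) mod int p ^ n) \<in> carrier (Zp p)" for f :: "int poly"
  proof (rule Zp_closed)
    fix n
    have "x (Suc n) - x n dvd poly f (x (Suc n)) - poly f (x n)"
    proof -
      have "[poly f (x (Suc n)) = poly f (x n)] (mod (x (Suc n) - x n))"
      proof (induction f)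
        case (pCons c f)
        have "[x (Suc n) = x n] (mod (x (Suc n) - x n))" by (simp add: cong_iff_dvd_diff)
        from cong_add[OF cong_refl cong_mult[OF this pCons.IH]] show ?case by simp
      qed simp
      then show ?thesis by (simp add: cong_iff_dvd_diff)
    qed
    then show "poly f (x (Suc n)) mod int p ^ n = poly f (x n) mod int p ^ n"
      using dvd[of n] unfolding mod_eq_dvd_iff by (rule dvd_trans[rotated])
  qed (use p1 in simp)
  have "(\<lambda>n. poly f (x n) mod int p ^ n) \<otimes>\<^bsub>Zp p\<^esub> (\<lambda>n. poly g (x n) mod int p ^ n) = \<zero>\<^bsub>Zp p\<^esub>"
    using assms(3) by (simp add: Zp_simps Zp_root_def mod_mult_eq mod_eq_0_iff_dvd)
  then show ?thesis
    using R.integral[OF _ closed closed] by (simp add: Zp_simps Zp_root_def fun_eq_iff mod_eq_0_iff_dvd)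
qed

text \<open>Induction along the factorisation of \<open>h\<close>. Constants drop out because a
  nonzero integer is not divisible by all powers of p.\<close>

lemma Zp_root_prime_factor:
  assumes p: "Factorial_Ring.prime p" and x: "x \<in> carrier (Zp p)" and h: "h \<noteq> 0" "Zp_root p x h"
  obtains f where "f \<in> prime_factors h" "Zp_root p x f" "Polynomial.degree f > 0"
proof -
  have p1: "p > 1" using p by (rule prime_gt_1_nat)
  have const: "c = 0" if "Zp_root p x [:c:]" for c
    using that eq_0_of_all_powers_dvd[OF p1] by (simp add: Zp_root_def)
  have "\<exists>f. Factorial_Ring.prime f \<and> f dvd h \<and> Zp_root p x f"
    using h
  proof (induction h rule: prime_divisors_induct)
    case (unit u)
    then obtain c where "u = [:c:]" by (auto simp: is_unit_poly_iff)
    then show ?case using unit const[of c] by auto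
  next
    case (factor f u)
    show ?case
    proof (cases "Zp_root p x f")
      case True
      then show ?thesis using factor.hyps by (intro exI[of _ f]) auto
    next
      case False
      then have "Zp_root p x u" using Zp_root_mult[OF p x] factor.prems by blast
      then obtain g where "Factorial_Ring.prime g" "g dvd u" "Zp_root p x g" using factor by auto
      then show ?thesis by (intro exI[of _ g]) auto
    qed
  qed simp
  then obtain f where f: "Factorial_Ring.prime f" "f dvd h" "Zp_root p x f" by blast
  have "Polynomial.degree f > 0"
  proof (rule ccontr)
    assume "\<not> ?thesis"
    then obtain c where c: "f = [:c:]" by (auto elim: degree_eq_zeroE)
    then show False using const[of c] f by auto
  qed
  then show thesis using that[of f] f h(1) by (auto simp: prime_factors_dvd)
qed

text \<open>The remainder of \<open>f\<close> on division by x - a is the constant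
  \<open>poly f a\<close>, which vanishes modulo \<open>m\<close>.\<close>

lemma poly_cong_linear_factor:
  assumes "m dvd poly f a"
  shows "poly_cong m (f ^ e * q) ([:- a, 1:] ^ e * (synthetic_div f a ^ e * q))"
proof -
  have "f - [:- a, 1:] * synthetic_div f a = [:poly f a:]"
    using synthetic_div_correct'[of a f] by (metis add_diff_cancel_left')
  then have "poly_cong m f ([:- a, 1:] * synthetic_div f a)"
    using assms unfolding poly_cong_def by simp
  then have "poly_cong m (f ^ e * q) (([:- a, 1:] * synthetic_div f a) ^ e * q)"
    by (intro poly_cong_mult poly_cong_power) auto
  then show ?thesis by (simp only: power_mult_distrib mult.assoc)
qed

text \<open>Ties the multiplicity used in \<open>lam\<close> to the factorisation of
  \<open>h\<close> over Z: \<open>f\<close> has only simple roots and \<open>q\<close> shares none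
  of them, so the multiplicity is the exponent of \<open>f\<close>.\<close>

lemma alg_mult_Zp_poly:
  assumes p: "Factorial_Ring.prime p" and x: "x \<in> carrier (Zp p)"
    and f: "Factorial_Ring.prime_elem f" "Polynomial.degree f > 0" "\<not> f dvd q"
    and root: "Zp_root p x f" and e: "e > 0"
  shows "ring.alg_mult (Zp p) (Zp_poly p (f ^ e * q)) x = e"
proof -
  have p1: "p > 1" using p by (rule prime_gt_1_nat)
  then have p0: "p > 0" by simp
  interpret R: domain "Zp p" using p by (rule domain_Zp)
  interpret UP: domain "poly_ring (Zp p)" using R.univ_poly_is_domain[OF R.carrier_is_subring] .
  define L where "L = [\<one>\<^bsub>Zp p\<^esub>, \<ominus>\<^bsub>Zp p\<^esub> x]"
  let ?P = "poly_ring (Zp p)"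
  define h where "h = f ^ e * q"
  have f0: "f \<noteq> 0" "q \<noteq> 0" using f by auto
  have h0: "h \<noteq> 0" unfolding h_def using f0 by simp
  note closed = Zp_poly_closed[OF p1]
  have L: "L \<in> carrier ?P"
    unfolding L_def univ_poly_carrier[symmetric] polynomial_def using x by simp
  have ne: "Zp_poly p h \<noteq> []" using h0 by (simp add: Zp_poly_def)
  have pow: "Zp_poly p (f ^ n) = Zp_poly p f [^]\<^bsub>?P\<^esub> n" for n :: nat
  proof (induction n)
    case 0
    have "Zp_poly p 1 = [\<one>\<^bsub>Zp p\<^esub>]" by (simp add: Zp_poly_def int_to_Zp_def Zp_simps)
    then show ?case by (simp add: univ_poly_one)
  next
    case (Suc n)
    have "Zp_poly p (f ^ Suc n) = Zp_poly p (f ^ n * f)" by (simp add: mult.commute)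
    then show ?case using Suc by (simp only: Zp_poly_mult[OF p] UP.nat_pow_Suc)
  qed
  have "R.is_root (Zp_poly p f) x"
    using root f0 is_root_Zp_poly_iff[OF p1 x] unfolding Zp_root_def by simp
  then have "Polynomial_Divisibility.pdivides (Zp p) L (Zp_poly p f)"
    unfolding L_def by (intro R.is_root_imp_pdivides closed)
  then obtain G where G: "G \<in> carrier ?P" "Zp_poly p f = L \<otimes>\<^bsub>?P\<^esub> G"
    unfolding pdivides_def factor_def by blast
  have "Zp_poly p h = (L [^]\<^bsub>?P\<^esub> e) \<otimes>\<^bsub>?P\<^esub>
     ((G [^]\<^bsub>?P\<^esub> e) \<otimes>\<^bsub>?P\<^esub> Zp_poly p q)"
    unfolding h_def Zp_poly_mult[OF p] pow G(2) using L G closed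
    by (simp add: UP.nat_pow_distrib UP.m_assoc)
  then have "Polynomial_Divisibility.pdivides (Zp p) (L [^]\<^bsub>?P\<^esub> (e)) (Zp_poly p h)"
    unfolding pdivides_def factor_def using L G closed by blast
  then have ge: "e \<le> R.alg_mult (Zp_poly p h) x"
    unfolding L_def using R.alg_multE(2)[OF x closed ne] by blast
  \<comment> \<open>With one factor more than \<open>e\<close>, cancelling (x - a)^e modulo p^n and
    evaluating at \<open>a\<close> would make p^n divide the nonzero constant \<open>R0 ^ e\<close>
    for every n.\<close>
  have le: "R.alg_mult (Zp_poly p h) x \<le> e"
  proof (rule ccontr)
    assume "\<not> ?thesis"
    then have "Suc e \<le> R.alg_mult (Zp_poly p h) x" by simp
    then have "Polynomial_Divisibility.pdivides (Zp p) (L [^]\<^bsub>?P\<^esub> (Suc e)) (Zp_poly p h)"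
      unfolding L_def by (intro R.le_alg_mult_imp_pdivides x closed)
    then obtain Q where Q: "Q \<in> carrier ?P"
      "Zp_poly p h = (L [^]\<^bsub>?P\<^esub> Suc e) \<otimes>\<^bsub>?P\<^esub> Q"
      unfolding pdivides_def factor_def by blast
    have set: "set l \<subseteq> carrier (Zp p)" if "l \<in> carrier ?P" for l
      using that R.polynomial_in_carrier[OF R.carrier_is_subring] by (simp add: univ_poly_carrier)
    obtain R0 where R0: "R0 \<noteq> 0" "\<And>m v a. e > 0 \<Longrightarrow> v dvd m \<Longrightarrow> m dvd poly f a \<Longrightarrow>
       v dvd poly (synthetic_div f a ^ e * q) a \<Longrightarrow> v dvd R0 ^ e"
      using prime_factor_constant[OF f, where e = e] by blast
    have "int p ^ n dvd R0 ^ e" for n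
    proof -
      define m where "m = int p ^ n"
      define a where "a = x n"
      have mult: "poly_cong m (Zp_level n (l \<otimes>\<^bsub>?P\<^esub> l')) (Zp_level n l * Zp_level n l')"
        if "l \<in> carrier ?P" "l' \<in> carrier ?P" for l l'
        unfolding univ_poly_mult m_def using that by (intro poly_cong_Zp_level_mult[OF p0] set)
      have L1: "poly_cong m (Zp_level n L) [:- a, 1:]"
      proof -
        have "(\<ominus>\<^bsub>Zp p\<^esub> x) \<oplus>\<^bsub>Zp p\<^esub> x = \<zero>\<^bsub>Zp p\<^esub>" using x by (rule R.l_neg)
        then have "m dvd (\<ominus>\<^bsub>Zp p\<^esub> x) n - (- a)"
          unfolding m_def a_def by (simp add: Zp_simps fun_eq_iff mod_eq_0_iff_dvd)
        moreover have "m dvd 1 mod m - 1" by (metis mod_eq_dvd_iff mod_mod_trivial)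
        ultimately show ?thesis
          by (auto simp: poly_cong_coeff L_def Zp_level_def Zp_simps m_def coeff_pCons split: nat.splits)
      qed
      have Lpow: "poly_cong m (Zp_level n (L [^]\<^bsub>?P\<^esub> (j::nat))) ([:- a, 1:] ^ j)" for j
      proof (induction j)
        case 0
        have "m dvd 1 mod m - 1" by (metis mod_eq_dvd_iff mod_mod_trivial)
        then show ?case
          by (auto simp: poly_cong_coeff univ_poly_one Zp_level_def Zp_simps m_def coeff_pCons one_pCons split: nat.splits)
      next
        case (Suc j)
        have "poly_cong m (Zp_level n (L [^]\<^bsub>?P\<^esub> Suc j))
            (Zp_level n (L [^]\<^bsub>?P\<^esub> j) * Zp_level n L)"
          unfolding UP.nat_pow_Suc using L by (intro mult) auto
        also have "poly_cong m (Zp_level n (L [^]\<^bsub>?P\<^esub> j) * Zp_level n L) ([:- a, 1:] ^ Suc j)"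
          unfolding power_Suc2 by (intro poly_cong_mult Suc L1)
        finally (poly_cong_trans) show ?case .
      qed
      have "poly_cong m h (Zp_level n (Zp_poly p h))"
        unfolding m_def by (intro poly_cong_sym[OF poly_cong_Zp_level_Zp_poly] p0)
      also have "poly_cong m (Zp_level n (Zp_poly p h))
          (Zp_level n (L [^]\<^bsub>?P\<^esub> Suc e) * Zp_level n Q)"
        unfolding Q(2) using L Q(1) by (intro mult) auto
      also (poly_cong_trans) have "poly_cong m (Zp_level n (L [^]\<^bsub>?P\<^esub> Suc e) * Zp_level n Q)
          ([:- a, 1:] ^ Suc e * Zp_level n Q)"
        by (intro poly_cong_mult Lpow) auto
      finally (poly_cong_trans) have c1: "poly_cong m h ([:- a, 1:] ^ e * ([:- a, 1:] * Zp_level n Q))"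
        by (simp only: power_Suc2 mult.assoc)
      have fa: "m dvd poly f a" using root unfolding Zp_root_def m_def a_def by blast
      have "poly_cong m ([:- a, 1:] ^ e * (synthetic_div f a ^ e * q)) h"
        unfolding h_def by (rule poly_cong_sym[OF poly_cong_linear_factor[OF fa]])
      from poly_cong_cancel_linear_power[OF poly_cong_trans[OF this c1]]
      have "poly_cong m (synthetic_div f a ^ e * q) ([:- a, 1:] * Zp_level n Q)" .
      from poly_cong_poly[OF this, of a]
      have "m dvd poly (synthetic_div f a ^ e * q) a" by simp
      then show ?thesis using R0(2)[OF e dvd_refl fa] unfolding m_def by blast
    qed
    then have "R0 ^ e = 0" by (rule eq_0_of_all_powers_dvd[OF p1])
    then show False using R0(1) by simp
  qed
  show ?thesis using ge le unfolding h_def by simp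
qed

section \<open>The representatives r_d and the function \<lambda>\<close>

lemma mem_PIdl_Zp_iff:
  assumes p: "p > 0" and x: "x \<in> carrier (Zp p)"
  shows "int_to_Zp p r \<ominus>\<^bsub>Zp p\<^esub> x \<in> PIdl\<^bsub>Zp p\<^esub> (int_to_Zp p (int p ^ a)) \<longleftrightarrow> int p ^ a dvd r - x a"
proof -
  interpret R: cring "Zp p" using p by (rule cring_Zp)
  define y where "y = int_to_Zp p r \<ominus>\<^bsub>Zp p\<^esub> x"
  have y: "y \<in> carrier (Zp p)" unfolding y_def using x int_to_Zp_closed[OF p] by simp
  have neg: "int p ^ n dvd (\<ominus>\<^bsub>Zp p\<^esub> x) n + x n" for n
    using R.l_neg[OF x] by (simp add: Zp_simps fun_eq_iff mod_eq_0_iff_dvd)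
  have yn: "int p ^ n dvd y n - (r - x n)" for n
  proof -
    have "y n = (r mod int p ^ n + (\<ominus>\<^bsub>Zp p\<^esub> x) n) mod int p ^ n"
      unfolding y_def a_minus_def by (simp add: Zp_simps int_to_Zp_def)
    then have "[y n = r + (\<ominus>\<^bsub>Zp p\<^esub> x) n] (mod int p ^ n)" by (simp add: Cong.cong_def mod_simps)
    moreover have "[(\<ominus>\<^bsub>Zp p\<^esub> x) n = - x n] (mod int p ^ n)" using neg[of n] by (simp add: cong_iff_dvd_diff)
    ultimately have "[y n = r + - x n] (mod int p ^ n)" by (meson cong_add cong_refl cong_trans)
    then show ?thesis by (simp add: cong_iff_dvd_diff)
  qed
  have "y \<in> PIdl\<^bsub>Zp p\<^esub> (int_to_Zp p (int p ^ a)) \<longleftrightarrow> y a = 0"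
  proof
    assume "y \<in> PIdl\<^bsub>Zp p\<^esub> (int_to_Zp p (int p ^ a))"
    then obtain w where "y = w \<otimes>\<^bsub>Zp p\<^esub> int_to_Zp p (int p ^ a)" unfolding cgenideal_def by blast
    then show "y a = 0" by (simp add: Zp_simps int_to_Zp_def)
  next
    assume ya: "y a = 0"
    \<comment> \<open>The quotient by p^a is read off \<open>a\<close> levels higher, because the
      residue of \<open>y\<close> modulo p^(n+a) determines y / p^a only modulo p^n.\<close>
    define w where "w n = y (n + a) div int p ^ a" for n
    have dv: "int p ^ a dvd y (n + a)" for n
      using Zp_cong[OF y, of a "n + a"] ya by (simp add: mod_eq_0_iff_dvd)
    then have yw: "y (n + a) = int p ^ a * w n" for n unfolding w_def by simp
    have pa: "int p ^ a > 0" using p by simp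
    have "w \<in> carrier (Zp p)"
    proof -
      have "0 \<le> w n" for n
        unfolding w_def using Zp_carrierD(1)[OF y] pa by (simp add: pos_imp_zdiv_nonneg_iff)
      moreover have "w n < int p ^ n" for n
      proof -
        have "int p ^ a * w n < int p ^ a * int p ^ n"
          using Zp_carrierD(2)[OF y, of "n + a"] unfolding yw by (simp add: power_add mult.commute)
        then show ?thesis using pa by simp
      qed
      moreover have "w (Suc n) mod int p ^ n = w n" for n
      proof -
        have "(int p ^ a * w (Suc n)) mod (int p ^ a * int p ^ n) = int p ^ a * w n"
          using Zp_cong[OF y, of "n + a" "Suc n + a"] yw[of n] yw[of "Suc n"]
          by (simp add: power_add mult.commute)
        then have "int p ^ a * (w (Suc n) mod int p ^ n) = int p ^ a * w n"
          by (simp only: mult_mod_right)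
        then show ?thesis using p by simp
      qed
      ultimately show ?thesis by (simp add: Zp_def)
    qed
    moreover have "y = w \<otimes>\<^bsub>Zp p\<^esub> int_to_Zp p (int p ^ a)"
    proof
      fix n
      have "(w n * (int p ^ a mod int p ^ n)) mod int p ^ n = y (n + a) mod int p ^ n"
        unfolding yw by (simp add: mod_mult_right_eq mult.commute)
      also have "\<dots> = y n" by (rule Zp_cong[OF y]) simp
      finally show "y n = (w \<otimes>\<^bsub>Zp p\<^esub> int_to_Zp p (int p ^ a)) n"
        by (simp add: Zp_simps int_to_Zp_def)
    qed
    ultimately show "y \<in> PIdl\<^bsub>Zp p\<^esub> (int_to_Zp p (int p ^ a))" unfolding cgenideal_def by blast
  qed
  also have "\<dots> \<longleftrightarrow> int p ^ a dvd y a"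
    using Zp_carrierD(3)[OF y, of a] by (auto simp: mod_eq_0_iff_dvd[symmetric])
  also have "\<dots> \<longleftrightarrow> int p ^ a dvd r - x a"
    using yn[of a] by (metis dvd_diff_commute dvd_diff_right_iff diff_diff_eq2 add_diff_cancel_left' dvd_add_right_iff diff_add_cancel)
  finally show ?thesis unfolding y_def .
qed

lemma int_dvd_of_prime_powers:
  assumes "t > 0" "\<And>p v. Factorial_Ring.prime p \<Longrightarrow> p ^ v dvd t \<Longrightarrow> int p ^ v dvd c"
  shows "int t dvd c"
proof (cases "c = 0")
  case False
  have "t dvd nat \<bar>c\<bar>"
  proof (rule multiplicity_le_imp_dvd)
    fix p :: nat assume p: "Factorial_Ring.prime p"
    have "int p ^ multiplicity p t dvd c" using p by (intro assms(2)) (auto simp: multiplicity_dvd)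
    then have "p ^ multiplicity p t dvd nat \<bar>c\<bar>" by (simp add: dvd_nat_abs_iff)
    then have "multiplicity p t \<le> multiplicity p (nat \<bar>c\<bar>)"
      using p False by (intro multiplicity_geI) (auto simp: prime_gt_Suc_0_nat)
    then show "multiplicity p t \<le> multiplicity p (nat \<bar>c\<bar>)" .
  qed (use assms(1) in auto)
  then show ?thesis by (simp add: dvd_nat_abs_iff)
qed simp

lemma prime_power_decompose:
  assumes "Factorial_Ring.prime (p::nat)" "d > 0"
  obtains u where "d = p ^ multiplicity p d * u" "\<not> p dvd u" "u > 0"
proof -
  have "d \<noteq> 0" "\<not> is_unit p" using assms by (auto simp: prime_gt_Suc_0_nat)
  then obtain u where u: "d = p ^ multiplicity p d * u" "\<not> p dvd u" by (rule multiplicity_decompose')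
  have "u > 0" using u(2) by (cases "u = 0") auto
  then show thesis by (rule that[OF u])
qed

text \<open>Replaces the definite description by congruences, with existence from the Chinese
  remainder theorem. For primes not dividing \<open>d\<close> the last claim is a congruence modulo
  1.\<close>

lemma root_rep:
  assumes z: "\<And>p. Factorial_Ring.prime p \<Longrightarrow> z p \<in> carrier (Zp p)" and d: "d > 0"
  shows "- int d < root_rep z d" "root_rep z d \<le> 0"
    "\<And>p. Factorial_Ring.prime p \<Longrightarrow> int p ^ multiplicity p d dvd root_rep z d - z p (multiplicity p d)"
proof -
  define good where "good r \<longleftrightarrow> - int d < r \<and> r \<le> 0 \<and>
     (\<forall>p\<in>prime_factors d. int p ^ multiplicity p d dvd r - z p (multiplicity p d))" for r
  have "root_rep z d = (THE r. good r)"
    unfolding root_rep_def good_def using z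
    by (intro arg_cong[where f = The] ext conj_cong refl ball_cong mem_PIdl_Zp_iff)
       (auto intro: prime_gt_0_nat dest: in_prime_factors_imp_prime)
  moreover have "\<exists>!r. good r"
  proof (rule ex_ex1I)
    obtain y :: nat where y: "\<forall>p\<in>prime_factors d. [y = nat (z p (multiplicity p d))] (mod p ^ multiplicity p d)"
    proof -
      have "\<forall>i\<in>prime_factors d. \<forall>j\<in>prime_factors d. i \<noteq> j \<longrightarrow>
          coprime (i ^ multiplicity i d) (j ^ multiplicity j d)"
        by (auto intro!: primes_coprime)
      from chinese_remainder_nat[OF _ this, of "\<lambda>p. nat (z p (multiplicity p d))"]
      show thesis using that by auto
    qed
    \<comment> \<open>Negating the remainder of \<open>- y\<close> gives the representative in the
      range (-d, 0].\<close>
    define r where "r = - ((- int y) mod int d)"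
    have dr: "int d dvd r - int y"
    proof -
      have "int d dvd (- int y) - ((- int y) mod int d)" by (rule dvd_minus_mod)
      moreover have "r - int y = (- int y) - ((- int y) mod int d)" by (simp add: r_def)
      ultimately show ?thesis by (simp only:)
    qed
    have "int p ^ multiplicity p d dvd r - z p (multiplicity p d)" if p: "p \<in> prime_factors d" for p
    proof -
      have d1: "int p ^ multiplicity p d dvd r - int y"
        using dr by (rule dvd_trans[rotated]) (metis multiplicity_dvd of_nat_dvd_iff of_nat_power)
      have d2: "int p ^ multiplicity p d dvd int y - z p (multiplicity p d)"
      proof -
        have "z p \<in> carrier (Zp p)" using p z by auto
        then have "0 \<le> z p (multiplicity p d)" by (rule Zp_carrierD(1))
        moreover have "[int y = int (nat (z p (multiplicity p d)))] (mod int (p ^ multiplicity p d))"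
          using y p by (simp only: cong_int_iff) 
        ultimately show ?thesis by (simp add: cong_iff_dvd_diff)
      qed
      show ?thesis using dvd_add[OF d1 d2] by simp
    qed
    moreover have "- int d < r" "r \<le> 0"
      unfolding r_def using d by simp_all
    ultimately show "\<exists>r. good r" unfolding good_def by blast
  next
    fix r s assume rs: "good r" "good s"
    have "int d dvd r - s"
    proof (rule int_dvd_of_prime_powers[OF d])
      fix p v assume p: "Factorial_Ring.prime p" "p ^ v dvd d"
      show "int p ^ v dvd r - s"
      proof (cases "p \<in> prime_factors d")
        case True
        have "v \<le> multiplicity p d" using p d by (intro multiplicity_geI) (auto simp: prime_gt_Suc_0_nat)
        moreover have "int p ^ multiplicity p d dvd r - s"
        proof -
          have "int p ^ multiplicity p d dvd (r - z p (multiplicity p d)) - (s - z p (multiplicity p d))"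
            by (rule dvd_diff) (use rs True in \<open>auto simp: good_def\<close>)
          then show ?thesis by simp
        qed
        ultimately show ?thesis by (rule power_le_dvd[rotated])
      next
        case False
        then have "v = 0" using p d by (cases v) (auto simp: prime_factors_dvd)
        then show ?thesis by simp
      qed
    qed
    moreover have "\<bar>r - s\<bar> < int d" using rs unfolding good_def by auto
    ultimately show "r = s" using dvd_imp_le_int[of "r - s" "int d"] by fastforce
  qed
  ultimately have g: "good (root_rep z d)" by (simp add: theI')
  then show "- int d < root_rep z d" "root_rep z d \<le> 0" unfolding good_def by auto
  fix p :: nat assume p: "Factorial_Ring.prime p"
  show "int p ^ multiplicity p d dvd root_rep z d - z p (multiplicity p d)"
  proof (cases "p \<in> prime_factors d")
    case True
    then show ?thesis using g unfolding good_def by blast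
  next
    case False
    then have "multiplicity p d = 0" using p d by (auto simp: prime_factors_dvd not_dvd_imp_multiplicity_0)
    then show ?thesis by simp
  qed
qed

text \<open>Both representatives reduce to the same residue of z_p modulo each prime power dividing
  \<open>a\<close>. Hence r_{ab} + a b x runs inside the progression r_a + a y, which makes
  \<lambda>(b) h_{ab}(x) a value of h_a.\<close>

lemma root_rep_mult:
  assumes z: "\<And>p. Factorial_Ring.prime p \<Longrightarrow> z p \<in> carrier (Zp p)" and ab: "a > 0" "b > 0"
  shows "int a dvd root_rep z (a * b) - root_rep z a"
proof (rule int_dvd_of_prime_powers[OF ab(1)])
  fix p v assume p: "Factorial_Ring.prime p" "p ^ v dvd a"
  define m n where "m = multiplicity p a" and "n = multiplicity p (a * b)"
  have "v \<le> m" unfolding m_def using p ab by (intro multiplicity_geI) (auto simp: prime_gt_Suc_0_nat)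
  have mn: "m \<le> n" unfolding m_def n_def using p ab by (intro dvd_imp_multiplicity_le) auto
  have d1: "int p ^ m dvd root_rep z (a * b) - z p n"
    using root_rep(3)[OF z _ p(1), of "a * b"] ab mn unfolding n_def[symmetric]
    by (auto intro: power_le_dvd)
  have d2: "int p ^ m dvd z p n - z p m"
    using Zp_cong[OF z[OF p(1)] mn] by (metis dvd_minus_mod)
  have d3: "int p ^ m dvd root_rep z a - z p m"
    using root_rep(3)[OF z ab(1) p(1)] unfolding m_def .
  from dvd_diff[OF dvd_add[OF d1 d2] d3] have "int p ^ m dvd root_rep z (a * b) - root_rep z a" by simp
  then show "int p ^ v dvd root_rep z (a * b) - root_rep z a" using \<open>v \<le> m\<close> by (rule power_le_dvd)
qed

lemma lam_mult:
  assumes "a > 0" "b > 0"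
  shows "lam h z (a * b) = lam h z a * lam h z b"
  using assms by (simp add: lam_def prime_factorization_mult)

lemma lam_pos: "lam h z d > 0"
proof -
  have "lam h z d \<noteq> 0"
    unfolding lam_def by (auto simp: prod_mset_zero_iff dest: in_prime_factors_imp_prime)
  then show ?thesis by simp
qed

lemma lam_prime_part:
  assumes p: "Factorial_Ring.prime p" and d: "d > 0"
  obtains l where "lam h z d = p ^ (multiplicity p d * ring.alg_mult (Zp p) (Zp_poly p h) (z p)) * l"
    "\<not> p dvd l"
proof -
  obtain u where u: "d = p ^ multiplicity p d * u" "\<not> p dvd u" "u > 0"
    using prime_power_decompose[OF p d] .
  have "lam h z d = lam h z (p ^ multiplicity p d) * lam h z u"
    using u(3) p by (subst u(1), intro lam_mult) (auto simp: prime_gt_0_nat)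
  also have "lam h z (p ^ multiplicity p d) = p ^ (multiplicity p d * ring.alg_mult (Zp p) (Zp_poly p h) (z p))"
    using p by (simp add: lam_def prime_factorization_prime_power power_mult[symmetric] mult.commute)
  finally have "lam h z d = p ^ (multiplicity p d * ring.alg_mult (Zp p) (Zp_poly p h) (z p)) * lam h z u" .
  moreover have "\<not> p dvd lam h z u"
  proof
    assume "p dvd lam h z u"
    then obtain q where q: "q \<in> prime_factors u" "p dvd q ^ ring.alg_mult (Zp q) (Zp_poly q h) (z q)"
      using p unfolding lam_def by (auto simp: prime_dvd_prod_mset_iff)
    then have "p dvd q" using p by (auto dest: prime_dvd_power)
    then have "p = q" using p q(1) by (auto intro: primes_dvd_imp_eq)
    then show False using q(1) u(2) by auto
  qed
  ultimately show thesis by (rule that)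
qed

section \<open>Integrality and content of h_d, one prime at a time\<close>

lemma poly_cong_smult_cancel:
  assumes "poly_cong (k * m) (Polynomial.smult k P) (Polynomial.smult k Q)" "k \<noteq> 0"
  shows "poly_cong m P Q"
  using assms by (simp add: poly_cong_coeff right_diff_distrib[symmetric])

text \<open>The linear factor becomes p^a (t + u y), and its \<open>e\<close>-th power supplies p^(a
  e). This is the p-part of \<lambda>(d) when \<open>a\<close> is the multiplicity of p in
  \<open>d\<close> and \<open>e\<close> that of the root.\<close>

lemma poly_cong_shifted_linear_factor:
  fixes f q :: "int poly" and p a n e :: nat
  assumes fx: "int p ^ n dvd poly f x" and r: "r = x + int p ^ a * t" and d: "d = int p ^ a * u"
  shows "poly_cong (int p ^ n) (pcompose (f ^ e * q) [:r, d:])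
    (Polynomial.smult (int p ^ (a * e)) ([:t, u:] ^ e * pcompose (synthetic_div f x ^ e * q) [:r, d:]))"
proof -
  have lin: "pcompose [:- x, 1:] [:r, d:] = Polynomial.smult (int p ^ a) [:t, u:]"
    by (simp add: pcompose_pCons r d)
  have "pcompose ([:- x, 1:] ^ e * (synthetic_div f x ^ e * q)) [:r, d:] =
     Polynomial.smult (int p ^ (a * e)) ([:t, u:] ^ e * pcompose (synthetic_div f x ^ e * q) [:r, d:])"
    unfolding pcompose_mult[of "[:- x, 1:] ^ e"] pcompose_power[of "[:- x, 1:]"] lin smult_power
    by (simp only: power_mult mult_smult_left)
  then show ?thesis using poly_cong_pcompose[OF poly_cong_linear_factor[OF fx, of e q], of "[:r, d:]"] by simp
qed

text \<open>As \<open>u\<close> is invertible modulo p^v, an affine substitution turns t + u y into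
  y and r + d y into x + p^a y. The hypothesis then says that y^e F(x + p^a y) is constant, and its
  coefficient of y^e is F(x).\<close>

lemma prime_power_dvd_Taylor_coeff:
  fixes F :: "int poly" and p a v e :: nat
  assumes p: "Factorial_Ring.prime p" and u: "\<not> int p dvd u" and e: "e > 0"
    and r: "r = x + int p ^ a * t" and d: "d = int p ^ a * u"
    and const: "poly_cong (int p ^ v) ([:t, u:] ^ e * pcompose F [:r, d:]) [:c:]"
  shows "int p ^ v dvd poly F x"
proof -
  define m where "m = int p ^ v"
  have "coprime u m"
    unfolding m_def using u p by (metis coprime_commute coprime_power_right_iff prime_imp_coprime prime_nat_int_transfer)
  then obtain w where w: "[u * w = 1] (mod m)" using cong_solve_coprime_int by blast
  define S where "S = [:- (w * t), w:]"
  have "poly_cong m (pcompose ([:t, u:] ^ e * pcompose F [:r, d:]) S) [:c:]"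
    using poly_cong_pcompose[OF const, of S] unfolding m_def by simp
  then have c1: "poly_cong m (pcompose [:t, u:] S ^ e * pcompose F (pcompose [:r, d:] S)) [:c:]"
    by (simp only: pcompose_mult pcompose_power pcompose_assoc)
  have uw: "m dvd u * w - 1" using w by (simp add: cong_iff_dvd_diff)
  have "poly_cong m (pcompose [:t, u:] S) [:0, 1:]"
  proof -
    have "t - u * (w * t) = - (u * w - 1) * t" by (simp add: algebra_simps)
    then have "m dvd t - u * (w * t)" using uw by (metis dvd_minus_iff dvd_mult2)
    then show ?thesis using uw
      by (auto simp: poly_cong_coeff S_def pcompose_pCons coeff_pCons split: nat.splits)
  qed
  moreover have "poly_cong m (pcompose [:r, d:] S) [:x, int p ^ a:]"
  proof -
    have "r - d * (w * t) - x = - (u * w - 1) * (int p ^ a * t)" unfolding r d by (simp add: algebra_simps)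
    then have "m dvd r - d * (w * t) - x" using uw by (metis dvd_minus_iff dvd_mult2)
    moreover have "d * w - int p ^ a = (u * w - 1) * int p ^ a" unfolding d by (simp add: algebra_simps)
    then have "m dvd d * w - int p ^ a" using uw by (metis dvd_mult2)
    ultimately show ?thesis
      by (auto simp: poly_cong_coeff S_def pcompose_pCons coeff_pCons split: nat.splits)
  qed
  ultimately have "poly_cong m (pcompose [:t, u:] S ^ e * pcompose F (pcompose [:r, d:] S))
      ([:0, 1:] ^ e * pcompose F [:x, int p ^ a:])"
    by (intro poly_cong_mult poly_cong_power poly_cong_pcompose_right)
  from poly_cong_trans[OF poly_cong_sym[OF this] c1]
  have "poly_cong m (Polynomial.monom 1 e * pcompose F [:x, int p ^ a:]) [:c:]"
    by (simp add: monom_altdef)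
  then have "m dvd Polynomial.coeff (Polynomial.monom 1 e * pcompose F [:x, int p ^ a:]) e - Polynomial.coeff [:c:] e"
    unfolding poly_cong_coeff by blast
  moreover have "Polynomial.coeff [:c:] e = 0" using e by (cases e) auto
  moreover have "Polynomial.coeff (pcompose F [:x, int p ^ a:]) 0 = poly F x"
    by (simp add: poly_0_coeff_0[symmetric] poly_pcompose)
  ultimately show ?thesis unfolding m_def by (simp add: coeff_monom_mult)
qed

text \<open>The clause on \<open>t\<close> bounds the content of the nonconstant part of \<open>h\<^sub>d\<close>, uniformly in \<open>d\<close>.\<close>

definition arith_data :: "int poly \<Rightarrow> nat \<Rightarrow> (nat \<Rightarrow> nat) \<Rightarrow> (nat \<Rightarrow> int) \<Rightarrow> bool" where
  "arith_data h G l r \<longleftrightarrow>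
     (\<forall>d>0. l d > 0 \<and> d dvd l d \<and> - int d < r d \<and> r d \<le> 0 \<and>
        (\<exists>g. pcompose h [:r d, int d:] = Polynomial.smult (int (l d)) g \<and>
           (\<forall>t>0. (\<forall>j\<ge>1. int t dvd Polynomial.coeff g j) \<longrightarrow> t dvd G))) \<and>
     (\<forall>a>0. \<forall>b>0. l (a * b) = l a * l b \<and> int a dvd r (a * b) - r a)"

lemma ex_arith_data:
  assumes h0: "h \<noteq> 0"
  obtains G where "G > 0" "\<And>z. root_system h z \<Longrightarrow> arith_data h G (lam h z) (root_rep z)"
proof -
  define E where "E f = multiplicity f h" for f
  have "\<forall>f\<in>prime_factors h. \<exists>q. h = f ^ E f * q \<and> \<not> f dvd q"
  proof
    fix f assume "f \<in> prime_factors h"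
    then have "\<not> is_unit f" by (auto dest: in_prime_factors_imp_prime simp: not_prime_unit)
    then obtain q where "h = f ^ E f * q" "\<not> f dvd q"
      unfolding E_def using h0 multiplicity_decompose' by metis
    then show "\<exists>q. h = f ^ E f * q \<and> \<not> f dvd q" by blast
  qed
  then obtain q where q: "\<And>f. f \<in> prime_factors h \<Longrightarrow> h = f ^ E f * q f"
    "\<And>f. f \<in> prime_factors h \<Longrightarrow> \<not> f dvd q f" by metis
  define Rprop where "Rprop f R \<longleftrightarrow> R \<noteq> 0 \<and> (\<forall>m v a. E f > 0 \<longrightarrow> v dvd m \<longrightarrow> m dvd poly f a \<longrightarrow>
     v dvd poly (synthetic_div f a ^ E f * q f) a \<longrightarrow> v dvd R ^ E f)" for f and R :: int
  \<comment> \<open>Constant prime factors have no p-adic roots, so any nonzero value does for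
    them.\<close>
  have "\<forall>f\<in>prime_factors h. \<exists>R::int. R \<noteq> 0 \<and> (Polynomial.degree f > 0 \<longrightarrow> Rprop f R)"
  proof
    fix f assume f: "f \<in> prime_factors h"
    show "\<exists>R::int. R \<noteq> 0 \<and> (Polynomial.degree f > 0 \<longrightarrow> Rprop f R)"
    proof (cases "Polynomial.degree f > 0")
      case True
      have "Factorial_Ring.prime_elem f" using f by (simp add: in_prime_factors_imp_prime prime_imp_prime_elem)
      from prime_factor_constant[OF this True q(2)[OF f], where e = "E f"]
      obtain R where "Rprop f R" unfolding Rprop_def by metis
      then show ?thesis unfolding Rprop_def by blast
    qed (auto intro: exI[of _ 1])
  qed
  then obtain R where R: "\<And>f. f \<in> prime_factors h \<Longrightarrow> R f \<noteq> (0::int)"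
    "\<And>f. f \<in> prime_factors h \<Longrightarrow> Polynomial.degree f > 0 \<Longrightarrow> Rprop f (R f)" by metis
  \<comment> \<open>Which prime factor carries the chosen root depends on p and \<open>z\<close>;
    the product over all of them serves every choice.\<close>
  define G where "G = nat \<bar>\<Prod>f\<in>prime_factors h. R f ^ E f\<bar>"
  have "(\<Prod>f\<in>prime_factors h. R f ^ E f) \<noteq> 0" using R(1) by (simp add: prod_zero_iff)
  then have G0: "G > 0" unfolding G_def by simp
  show thesis
  proof (rule that[OF G0])
    fix z assume rs: "root_system h z"
    have z: "z p \<in> carrier (Zp p)" and root: "Zp_root p (z p) h" if p: "Factorial_Ring.prime p" for p
    proof -
      have p1: "p > 1" using p by (rule prime_gt_1_nat)
      interpret Z: cring "Zp p" using p1 by (intro cring_Zp) simp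
      have is_root: "Z.is_root (Zp_poly p h) (z p)" using rs p unfolding root_system_def by blast
      then show zp: "z p \<in> carrier (Zp p)" unfolding Z.is_root_def by blast
      show "Zp_root p (z p) h" using is_root is_root_Zp_poly_iff[OF p1 zp h0] unfolding Zp_root_def by blast
    qed
    define m where "m p = ring.alg_mult (Zp p) (Zp_poly p h) (z p)" for p
    have "\<exists>f. f \<in> prime_factors h \<and> Polynomial.degree f > 0 \<and> Zp_root p (z p) f \<and> m p = E f \<and> E f > 0"
      if p: "Factorial_Ring.prime p" for p
    proof -
      obtain f where f: "f \<in> prime_factors h" "Zp_root p (z p) f" "Polynomial.degree f > 0"
        using Zp_root_prime_factor[OF p z[OF p] h0 root[OF p]] .
      have "E f > 0" unfolding E_def using f(1) h0 by (auto simp: prime_factors_multiplicity)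
      moreover have "Factorial_Ring.prime_elem f" using f(1) by (simp add: in_prime_factors_imp_prime prime_imp_prime_elem)
      from alg_mult_Zp_poly[OF p z[OF p] this f(3) q(2)[OF f(1)] f(2) \<open>E f > 0\<close>]
      have "m p = E f" unfolding m_def q(1)[OF f(1), symmetric] .
      ultimately show ?thesis using f by blast
    qed
    then obtain F where F: "\<And>p. Factorial_Ring.prime p \<Longrightarrow> F p \<in> prime_factors h"
      "\<And>p. Factorial_Ring.prime p \<Longrightarrow> Polynomial.degree (F p) > 0"
      "\<And>p. Factorial_Ring.prime p \<Longrightarrow> Zp_root p (z p) (F p)"
      "\<And>p. Factorial_Ring.prime p \<Longrightarrow> m p = E (F p)" "\<And>p. Factorial_Ring.prime p \<Longrightarrow> m p > 0"
      by metis
    define l where "l = lam h z"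
    define r where "r = root_rep z"
    \<comment> \<open>\<open>n\<close> is a free precision: \<open>a * m p\<close> suffices for
      integrality of h_d, while the content needs \<open>v\<close> further digits after p^(a m) has
      been cancelled.\<close>
    have key: "\<exists>t u. r d = z p n + int p ^ a * t \<and> int d = int p ^ a * u \<and> \<not> int p dvd u \<and>
       poly_cong (int p ^ n) (pcompose h [:r d, int d:]) (Polynomial.smult (int p ^ (a * m p))
         ([:t, u:] ^ m p * pcompose (synthetic_div (F p) (z p n) ^ m p * q (F p)) [:r d, int d:]))"
      if p: "Factorial_Ring.prime p" and d: "d > 0" and a: "a = multiplicity p d" "a \<le> n" for p d a n
    proof -
      obtain u where u: "d = p ^ a * u" "\<not> p dvd u"
        using prime_power_decompose[OF p d] unfolding a(1) by metis
      have "int p ^ a dvd r d - z p a" unfolding r_def a(1) using root_rep(3)[OF z d p] .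
      moreover have "int p ^ a dvd z p n - z p a"
        using Zp_cong[OF z[OF p] a(2)] by (metis dvd_minus_mod)
      ultimately have "int p ^ a dvd (r d - z p a) - (z p n - z p a)" by (rule dvd_diff)
      then obtain t where "r d - z p n = int p ^ a * t" by auto
      then have t: "r d = z p n + int p ^ a * t" by simp
      have ud: "int d = int p ^ a * int u" unfolding u(1) by simp
      have "int p ^ n dvd poly (F p) (z p n)" using F(3)[OF p] unfolding Zp_root_def by blast
      from poly_cong_shifted_linear_factor[OF this t ud, of "m p" "q (F p)"]
      have "poly_cong (int p ^ n) (pcompose h [:r d, int d:]) (Polynomial.smult (int p ^ (a * m p))
         ([:t, int u:] ^ m p * pcompose (synthetic_div (F p) (z p n) ^ m p * q (F p)) [:r d, int d:]))"
        using q(1)[OF F(1)[OF p]] F(4)[OF p] by simp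
      moreover have "\<not> int p dvd int u" using u(2) by simp
      ultimately show ?thesis
        using t ud by - (rule exI[of _ t], rule exI[of _ "int u"], intro conjI)
    qed
    have lp: "\<exists>l'. l d = p ^ (multiplicity p d * m p) * l' \<and> \<not> p dvd l'"
      if "Factorial_Ring.prime p" "d > 0" for p d
      using lam_prime_part[OF that, of h z] unfolding l_def m_def by metis
    have lpos: "l d > 0" for d unfolding l_def by (rule lam_pos)
    have dvd_l: "d dvd l d" if d: "d > 0" for d
    proof -
      have "int d dvd int (l d)"
      proof (rule int_dvd_of_prime_powers[OF d])
        fix p v assume p: "Factorial_Ring.prime p" "p ^ v dvd d"
        have "v \<le> multiplicity p d" using p d by (intro multiplicity_geI) (auto simp: prime_gt_Suc_0_nat)
        \<comment> \<open>Each root has multiplicity at least 1, and therefore \<open>d\<close>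
          divides \<lambda>(d).\<close>
        also have "\<dots> \<le> multiplicity p d * m p" using F(5)[OF p(1)] by simp
        finally have "p ^ v dvd p ^ (multiplicity p d * m p)" by (rule le_imp_power_dvd)
        then have "p ^ v dvd l d" using lp[OF p(1) d] by (metis dvd_mult2)
        then show "int p ^ v dvd int (l d)" by (metis of_nat_dvd_iff of_nat_power)
      qed
      then show ?thesis by simp
    qed
    have integral: "\<exists>g. pcompose h [:r d, int d:] = Polynomial.smult (int (l d)) g" if d: "d > 0" for d
    proof -
      have "int (l d) dvd Polynomial.coeff (pcompose h [:r d, int d:]) i" for i
      proof (rule int_dvd_of_prime_powers[OF lpos])
        fix p v assume p: "Factorial_Ring.prime p" "p ^ v dvd l d"
        define a where "a = multiplicity p d"
        obtain l' where l': "l d = p ^ (a * m p) * l'" "\<not> p dvd l'" using lp[OF p(1) d] unfolding a_def by blast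
        have "coprime (p ^ v) l'" using l'(2) p(1) by (simp add: prime_imp_coprime coprime_power_left_iff)
        then have "p ^ v dvd p ^ (a * m p)" using p(2) unfolding l'(1) by (simp add: coprime_dvd_mult_left_iff)
        then have pv: "int p ^ v dvd int p ^ (a * m p)" by (metis of_nat_dvd_iff of_nat_power)
        have "a \<le> a * m p" using F(5)[OF p(1)] by simp
        from key[OF p(1) d a_def this] obtain H where
          "poly_cong (int p ^ (a * m p)) (pcompose h [:r d, int d:]) (Polynomial.smult (int p ^ (a * m p)) H)"
          by blast
        then have "int p ^ (a * m p) dvd Polynomial.coeff (pcompose h [:r d, int d:]) i - int p ^ (a * m p) * Polynomial.coeff H i"
          unfolding poly_cong_coeff by simp
        then have "int p ^ (a * m p) dvd Polynomial.coeff (pcompose h [:r d, int d:]) i"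
          by (simp add: dvd_diff_right_iff dvd_diff_left_iff)
        then show "int p ^ v dvd Polynomial.coeff (pcompose h [:r d, int d:]) i" using pv by (rule dvd_trans[rotated])
      qed
      then have "[:int (l d):] dvd pcompose h [:r d, int d:]" by (simp add: const_poly_dvd_iff)
      then obtain g where "pcompose h [:r d, int d:] = [:int (l d):] * g" ..
      then show ?thesis by auto
    qed
    have content: "t dvd G" if d: "d > 0" and g: "pcompose h [:r d, int d:] = Polynomial.smult (int (l d)) g"
      and t: "t > 0" "\<forall>j\<ge>1. int t dvd Polynomial.coeff g j" for d g t
    proof -
      have "int t dvd int G"
      proof (rule int_dvd_of_prime_powers[OF t(1)])
        fix p v assume p: "Factorial_Ring.prime p" "p ^ v dvd t"
        define a where "a = multiplicity p d"
        define n where "n = a * m p + v"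
        obtain l' where l': "l d = p ^ (a * m p) * l'" using lp[OF p(1) d] unfolding a_def by blast
        have "a \<le> a * m p" using F(5)[OF p(1)] by simp
        then have "a \<le> n" unfolding n_def by (rule trans_le_add1)
        define f where "f = F p"
        define H where "H = synthetic_div f (z p n) ^ m p * q f"
        obtain t' u where tu: "r d = z p n + int p ^ a * t'" "int d = int p ^ a * u" "\<not> int p dvd u"
          "poly_cong (int p ^ n) (pcompose h [:r d, int d:]) (Polynomial.smult (int p ^ (a * m p))
             ([:t', u:] ^ m p * pcompose H [:r d, int d:]))"
          using key[OF p(1) d a_def \<open>a \<le> n\<close>] unfolding f_def H_def by blast
        have "poly_cong (int p ^ (a * m p) * int p ^ v)
            (Polynomial.smult (int p ^ (a * m p)) (Polynomial.smult (int l') g))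
            (Polynomial.smult (int p ^ (a * m p)) ([:t', u:] ^ m p * pcompose H [:r d, int d:]))"
          using tu(4) unfolding g l' n_def by (simp add: power_add)
        then have "poly_cong (int p ^ v) (Polynomial.smult (int l') g) ([:t', u:] ^ m p * pcompose H [:r d, int d:])"
          by (rule poly_cong_smult_cancel) (use p(1) in \<open>auto simp: prime_gt_0_nat\<close>)
        moreover have "poly_cong (int p ^ v) (Polynomial.smult (int l') g) [:int l' * Polynomial.coeff g 0:]"
        proof -
          have "int p ^ v dvd Polynomial.coeff g (Suc j)" for j
          proof -
            have "int p ^ v dvd int t" using p(2) by (metis of_nat_dvd_iff of_nat_power)
            then show ?thesis using t(2)[rule_format, of "Suc j"] by (auto intro: dvd_trans)
          qed
          then show ?thesis by (auto simp: poly_cong_coeff coeff_pCons split: nat.splits)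
        qed
        ultimately have c: "poly_cong (int p ^ v) ([:t', u:] ^ m p * pcompose H [:r d, int d:]) [:int l' * Polynomial.coeff g 0:]"
          by (meson poly_cong_sym poly_cong_trans)
        have taylor: "int p ^ v dvd poly H (z p n)"
          by (rule prime_power_dvd_Taylor_coeff[OF p(1) tu(3) F(5)[OF p(1)] tu(1,2) c])
        have fh: "f \<in> prime_factors h" "Polynomial.degree f > 0" unfolding f_def using F p(1) by auto
        have "int p ^ n dvd poly f (z p n)" using F(3)[OF p(1)] unfolding Zp_root_def f_def by blast
        moreover have "int p ^ v dvd int p ^ n" unfolding n_def by (intro le_imp_power_dvd) simp
        moreover have "m p = E f" "E f > 0" unfolding f_def using F(4,5)[OF p(1)] by auto
        ultimately have "int p ^ v dvd R f ^ E f"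
          using R(2)[OF fh] taylor unfolding Rprop_def H_def by metis
        also have "R f ^ E f dvd (\<Prod>f\<in>prime_factors h. R f ^ E f)"
          using fh(1) by (intro dvd_prodI) auto
        finally show "int p ^ v dvd int G" unfolding G_def by simp
      qed
      then show ?thesis by simp
    qed
    show "arith_data h G (lam h z) (root_rep z)"
      unfolding arith_data_def l_def[symmetric] r_def[symmetric]
    proof (intro conjI allI impI)
      fix d :: nat assume d: "0 < d"
      show "l d > 0" by (rule lpos)
      show "d dvd l d" by (rule dvd_l[OF d])
      show "- int d < r d" "r d \<le> 0" unfolding r_def using root_rep(1,2)[OF z d] by auto
      obtain g where g: "pcompose h [:r d, int d:] = Polynomial.smult (int (l d)) g" using integral[OF d] by blast
      then show "\<exists>g. pcompose h [:r d, int d:] = Polynomial.smult (int (l d)) g \<and>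
           (\<forall>t>0. (\<forall>j\<ge>1. int t dvd Polynomial.coeff g j) \<longrightarrow> t dvd G)"
        using content[OF d g] by blast
    next
      fix a b :: nat assume "0 < a" "0 < b"
      then show "l (a * b) = l a * l b" "int a dvd r (a * b) - r a"
        unfolding l_def r_def using lam_mult root_rep_mult[OF z] by auto
    qed
  qed
qed

section \<open>Weyl's inequality\<close>

definition near :: "real \<Rightarrow> real \<Rightarrow> bool" where
  "near s t \<longleftrightarrow> (\<exists>n::int. \<bar>t - of_int n\<bar> \<le> s)"

lemma near_mono: "near s t \<Longrightarrow> s \<le> s' \<Longrightarrow> near s' t"
  unfolding near_def by (meson order_trans)

lemma near_one: "1 \<le> s \<Longrightarrow> near s t"
  unfolding near_def by (intro exI[of _ "\<lfloor>t\<rfloor>"]) linarith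

lemma near_add: "near s t \<Longrightarrow> near s' t' \<Longrightarrow> near (s + s') (t + t')"
proof -
  assume "near s t" "near s' t'"
  then obtain m n :: int where "\<bar>t - m\<bar> \<le> s" "\<bar>t' - n\<bar> \<le> s'" unfolding near_def by blast
  then have "\<bar>t + t' - of_int (m + n)\<bar> \<le> s + s'" by simp
  then show ?thesis unfolding near_def by blast
qed

lemma near_minus: "near s t \<Longrightarrow> near s (- t)"
proof -
  assume "near s t"
  then obtain m :: int where "\<bar>t - m\<bar> \<le> s" unfolding near_def by blast
  then have "\<bar>- t - of_int (- m)\<bar> \<le> s" by simp
  then show ?thesis unfolding near_def by blast
qed

lemma near_diff: "near s t \<Longrightarrow> near s' t' \<Longrightarrow> near (s + s') (t - t')"
  using near_add[OF _ near_minus] by simp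

lemma near_mult:
  fixes m :: int and s t :: real
  assumes "near s t"
  shows "near (of_int \<bar>m\<bar> * s) (of_int m * t)"
proof -
  obtain n :: int where n: "\<bar>t - n\<bar> \<le> s" using assms unfolding near_def by blast
  have "of_int m * t - of_int (m * n) = of_int m * (t - n)" by (simp add: algebra_simps)
  then have "\<bar>of_int m * t - of_int (m * n)\<bar> = of_int \<bar>m\<bar> * \<bar>t - n\<bar>" by (simp add: abs_mult)
  also have "\<dots> \<le> of_int \<bar>m\<bar> * s" using n by (intro mult_left_mono) auto
  finally show ?thesis unfolding near_def by blast
qed

lemma near_mult_nat: "near s t \<Longrightarrow> near (real m * s) (real m * t)"
  using near_mult[of s t "int m"] by simp

lemma near_sum:
  "finite I \<Longrightarrow> (\<And>i. i \<in> I \<Longrightarrow> near (s i) (t i)) \<Longrightarrow> near (sum s I) (sum t I)"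
proof (induction I rule: finite_induct)
  case empty
  show ?case unfolding near_def by (intro exI[of _ 0]) simp
next
  case (insert i I)
  then show ?case by (simp add: near_add)
qed

lemma card_diam_le:
  fixes F :: "nat set"
  assumes "D \<ge> 0" "\<And>x y. x \<in> F \<Longrightarrow> y \<in> F \<Longrightarrow> real x - real y \<le> D"
  shows "real (card F) \<le> D + 1"
proof (cases "F = {}")
  case False
  define m where "m = (LEAST x. x \<in> F)"
  have m: "m \<in> F" "\<And>x. x \<in> F \<Longrightarrow> m \<le> x"
    using False LeastI_ex[of "\<lambda>x. x \<in> F"] Least_le[of "\<lambda>x. x \<in> F"] unfolding m_def by auto
  have "F \<subseteq> {m..m + nat \<lfloor>D\<rfloor>}"
  proof
    fix x assume x: "x \<in> F"
    have "real x - real m \<le> D" using assms(2) x m by blast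
    then have "int x - int m \<le> \<lfloor>D\<rfloor>" by (simp add: le_floor_iff)
    then show "x \<in> {m..m + nat \<lfloor>D\<rfloor>}" using m(2)[OF x] by auto
  qed
  then have "card F \<le> card {m..m + nat \<lfloor>D\<rfloor>}" by (intro card_mono) auto
  then have "card F \<le> Suc (nat \<lfloor>D\<rfloor>)" by simp
  then have "real (card F) \<le> real (nat \<lfloor>D\<rfloor>) + 1" by linarith
  then show ?thesis using assms(1) by linarith
qed (use assms in auto)

text \<open>Two elements of \<open>H\<close> at bounded distance q give q \<beta> = n + \<tau> with
  |\<tau>| \<le> 2 s. As \<tau> h sweeps over a length |\<tau>| M, it cannot stay near integers for
  so many h unless |\<tau>| is O(s / M). This gain of 1/M over the trivial bound is the
  point.\<close>

lemma dense_near_multiples: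
  fixes c :: real
  assumes "c > 0"
  obtains K :: nat where "K \<ge> 1"
    "\<And>\<beta> s M H. H \<subseteq> {..<M} \<Longrightarrow> c * real M \<le> real (card H) \<Longrightarrow> 0 \<le> s \<Longrightarrow>
       (\<And>h. h \<in> H \<Longrightarrow> near s (\<beta> * real h)) \<Longrightarrow> real K * s \<le> 1 \<Longrightarrow> K \<le> M \<Longrightarrow>
       \<exists>q\<in>{1..K}. near (real K * s / real M) (real q * \<beta>)"
proof -
  \<comment> \<open>There are fewer blocks of \<open>t\<close> consecutive integers below
    \<open>M\<close> than elements of \<open>H\<close>, so two of these share a block.\<close>
  define t where "t = nat \<lceil>2 / c\<rceil>"
  have t: "2 / c \<le> real t" unfolding t_def by linarith
  have t0: "t > 0" using assms unfolding t_def by simp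
  \<comment> \<open>In this order, the summands serve \<open>c * M \<ge> 12\<close>, the smallness
    of \<open>s\<close> against c / t, the final bound on |\<tau>|, the bound q \<le> K, and
    strictness.\<close>
  define K where "K = nat \<lceil>12 / c\<rceil> + nat \<lceil>16 * (t + 1) / c\<rceil> + nat \<lceil>12 * t / c\<rceil> + t + 1"
  have K: "12 / c \<le> K" "16 * (t + 1) / c \<le> K" "12 * t / c \<le> K" "real t \<le> K" "1 \<le> real K" "2 / c < K"
    using t real_nat_ceiling_ge[of "12 / c"] real_nat_ceiling_ge[of "16 * (t + 1) / c"]
      real_nat_ceiling_ge[of "12 * t / c"] unfolding K_def of_nat_add of_nat_1 by linarith+
  show thesis
  proof (rule that[of K])
    show "K \<ge> 1" using K(5) by simp
    fix \<beta> s :: real and M :: nat and H :: "nat set"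
    assume H: "H \<subseteq> {..<M}" "c * real M \<le> real (card H)" and s: "0 \<le> s"
      and nr: "\<And>h. h \<in> H \<Longrightarrow> near s (\<beta> * real h)" and Ks: "real K * s \<le> 1" and KM: "K \<le> M"
    have finH: "finite H" using H(1) finite_subset by blast
    have M0: "real M > 0" using KM K(5) by linarith
    have cM: "c * M > 2" "c * M \<ge> 12"
    proof -
      have "c * (2 / c) < c * M" using K(6) KM assms by (intro mult_strict_left_mono) auto
      then show "c * M > 2" using assms by simp
      have "c * (12 / c) \<le> c * M" using K(1) KM assms by (intro mult_left_mono) auto
      then show "c * M \<ge> 12" using assms by simp
    qed
    have "\<not> inj_on (\<lambda>h. h div t) H"
    proof
      assume "inj_on (\<lambda>h. h div t) H"
      then have "card H = card ((\<lambda>h. h div t) ` H)" by (simp add: card_image)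
      also have "\<dots> \<le> card {..M div t}"
      proof (intro card_mono)
        have "h div t \<le> M div t" if "h \<in> H" for h
          using that H(1) by (intro div_le_mono) auto
        then show "(\<lambda>h. h div t) ` H \<subseteq> {..M div t}" by auto
      qed simp
      also have "\<dots> = M div t + 1" by simp
      finally have "real (card H) \<le> real (M div t) + 1" by linarith
      also have "real (M div t) \<le> real M / t" by (rule of_nat_div_le_of_nat)
      also have "real M / t \<le> M * (c / 2)"
      proof -
        have "1 / t \<le> c / 2" using t t0 assms by (simp add: field_simps)
        then have "M * (1 / t) \<le> M * (c / 2)" by (intro mult_left_mono) auto
        then show ?thesis by simp
      qed
      finally show False using H(2) cM(1) by (simp add: algebra_simps)
    qed
    then obtain x y where xy: "x \<in> H" "y \<in> H" "x div t = y div t" "x < y"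
      unfolding inj_on_def by (metis linorder_neqE_nat)
    define q where "q = y - x"
    have q: "1 \<le> q" "q \<le> t"
    proof -
      show "1 \<le> q" using xy(4) by (simp add: q_def)
      have "y = t * (y div t) + y mod t" "x = t * (x div t) + x mod t" by simp_all
      moreover have "y mod t < t" using t0 by simp
      ultimately have "y - x \<le> t" using xy(3) by (metis add_diff_cancel_left diff_le_self less_imp_le order_trans)
      then show "q \<le> t" by (simp add: q_def)
    qed
    have "near (s + s) (\<beta> * y - \<beta> * x)" using nr xy by (intro near_diff) auto
    moreover have "\<beta> * y - \<beta> * x = q * \<beta>" using xy(4) by (simp add: q_def of_nat_diff algebra_simps)
    ultimately obtain n :: int where n: "\<bar>q * \<beta> - n\<bar> \<le> 2 * s" unfolding near_def by auto
    define \<tau> where "\<tau> = q * \<beta> - n"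
    have \<tau>: "\<bar>\<tau>\<bar> \<le> 2 * s" using n by (simp add: \<tau>_def)
    have "\<bar>\<tau>\<bar> \<le> K * s / M"
    proof (cases "\<tau> = 0")
      case True
      then show ?thesis using s by simp
    next
      case False
      have "near (t * s) (\<tau> * h)" if "h \<in> H" for h
      proof -
        have "near (q * s) (q * (\<beta> * h))" using nr[OF that] by (rule near_mult_nat)
        then obtain m :: int where m: "\<bar>q * (\<beta> * h) - m\<bar> \<le> q * s" unfolding near_def by auto
        have "\<tau> * h - of_int (m - n * int h) = q * (\<beta> * h) - m"
          by (simp add: \<tau>_def algebra_simps)
        then have "\<bar>\<tau> * h - of_int (m - n * int h)\<bar> \<le> q * s" using m by simp
        then have "near (q * s) (\<tau> * h)" unfolding near_def by blast
        then show ?thesis using q s by (elim near_mono) (auto intro: mult_right_mono)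
      qed
      then have "\<forall>h\<in>H. \<exists>m::int. \<bar>\<tau> * h - m\<bar> \<le> t * s" unfolding near_def by blast
      then obtain m :: "nat \<Rightarrow> int" where m: "\<And>h. h \<in> H \<Longrightarrow> \<bar>\<tau> * h - m h\<bar> \<le> t * s" by metis
      have "real K * s \<ge> real t * s" using K(4) s by (intro mult_right_mono) auto
      then have ts: "t * s \<le> 1" using Ks by linarith
      \<comment> \<open>At most \<open>2 * L + 1\<close> integers occur as approximants
        \<open>m h\<close>, and each serves only h within an interval of length 2 t s /
        |\<tau>|.\<close>
      define L where "L = nat \<lfloor>\<bar>\<tau>\<bar> * M + 1\<rfloor>"
      have L: "real L \<le> \<bar>\<tau>\<bar> * M + 1" unfolding L_def by simp
      have mL: "m ` H \<subseteq> {- int L..int L}"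
      proof
        fix v assume "v \<in> m ` H"
        then obtain h where h: "h \<in> H" "v = m h" by blast
        have "\<bar>\<tau>\<bar> * h \<le> \<bar>\<tau>\<bar> * M" using h(1) H(1) by (intro mult_left_mono) auto
        then have "\<bar>\<tau> * h\<bar> \<le> \<bar>\<tau>\<bar> * M" by (simp add: abs_mult)
        then have "\<bar>real_of_int (m h)\<bar> \<le> \<bar>\<tau>\<bar> * M + 1" using m[OF h(1)] ts by linarith
        then have "\<bar>m h\<bar> \<le> \<lfloor>\<bar>\<tau>\<bar> * M + 1\<rfloor>" by (simp only: le_floor_iff of_int_abs)
        then have "\<bar>m h\<bar> \<le> int L" unfolding L_def by simp
        then show "v \<in> {- int L..int L}" using h(2) by auto
      qed
      have fib: "real (card {h\<in>H. m h = v}) \<le> 2 * t * s / \<bar>\<tau>\<bar> + 1" for v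
      proof (rule card_diam_le)
        show "0 \<le> 2 * t * s / \<bar>\<tau>\<bar>" using s by simp
        fix a b assume ab: "a \<in> {h\<in>H. m h = v}" "b \<in> {h\<in>H. m h = v}"
        have "\<bar>\<tau> * a - \<tau> * b\<bar> \<le> 2 * (t * s)" using m[of a] m[of b] ab by auto
        then have "\<bar>\<tau>\<bar> * \<bar>real a - real b\<bar> \<le> 2 * (t * s)"
          by (simp add: abs_mult[symmetric] algebra_simps)
        then have "\<bar>real a - real b\<bar> \<le> 2 * (t * s) / \<bar>\<tau>\<bar>" using False by (simp add: field_simps)
        then show "real a - real b \<le> 2 * t * s / \<bar>\<tau>\<bar>" by (simp add: mult.assoc)
      qed
      have "H = (\<Union>v\<in>m ` H. {h\<in>H. m h = v})" by auto
      then have "card H \<le> (\<Sum>v\<in>m ` H. card {h\<in>H. m h = v})"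
        using card_UN_le[of "m ` H" "\<lambda>v. {h\<in>H. m h = v}"] finH by auto
      then have "real (card H) \<le> (\<Sum>v\<in>m ` H. real (card {h\<in>H. m h = v}))"
        by (metis of_nat_le_iff of_nat_sum)
      also have "\<dots> \<le> (\<Sum>v\<in>m ` H. 2 * t * s / \<bar>\<tau>\<bar> + 1)" by (intro sum_mono fib)
      also have "\<dots> = card (m ` H) * (2 * t * s / \<bar>\<tau>\<bar> + 1)" by simp
      also have "\<dots> \<le> (2 * \<bar>\<tau>\<bar> * M + 3) * (2 * t * s / \<bar>\<tau>\<bar> + 1)"
      proof (rule mult_right_mono)
        have "card (m ` H) \<le> card {- int L..int L}" using mL by (intro card_mono) auto
        then have "card (m ` H) \<le> 2 * L + 1" by simp
        then show "real (card (m ` H)) \<le> 2 * \<bar>\<tau>\<bar> * M + 3" using L by linarith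
      qed (use s in auto)
      also have "\<dots> = 4 * (t * s) * M + 2 * \<bar>\<tau>\<bar> * M + 6 * t * s / \<bar>\<tau>\<bar> + 3"
        using False by (simp add: field_simps)
      also have "\<dots> \<le> 4 * (t + 1) * s * M + 6 * t * s / \<bar>\<tau>\<bar> + 3"
      proof -
        have "\<bar>\<tau>\<bar> * M \<le> 2 * s * M" using \<tau> by (intro mult_right_mono) auto
        then show ?thesis by (simp add: algebra_simps)
      qed
      also have "4 * (t + 1) * s * M \<le> c / 4 * M"
      proof (intro mult_right_mono)
        have "16 * (t + 1) / c * s \<le> K * s" using K(2) s by (intro mult_right_mono) auto
        then have "16 * (t + 1) / c * s \<le> 1" using Ks by linarith
        then show "4 * (t + 1) * s \<le> c / 4" using assms by (simp add: field_simps)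
      qed auto
      finally have "c * M \<le> c / 4 * M + 6 * t * s / \<bar>\<tau>\<bar> + 3" using H(2) by simp
      then have "c * M / 2 \<le> 6 * t * s / \<bar>\<tau>\<bar>" using cM(2) by simp
      then have "\<bar>\<tau>\<bar> * (c * M) \<le> 12 * t * s" using False by (simp add: field_simps)
      then have "\<bar>\<tau>\<bar> \<le> 12 * t / c * s / M" using assms M0 by (simp add: field_simps)
      also have "\<dots> \<le> K * s / M" using K(3) s M0 by (intro divide_right_mono mult_right_mono) auto
      finally show ?thesis .
    qed
    then have "near (K * s / M) (q * \<beta>)" unfolding near_def \<tau>_def by blast
    moreover have "q \<in> {1..K}" using q K(4) by auto
    ultimately show "\<exists>q\<in>{1..K}. near (real K * s / real M) (real q * \<beta>)" by blast
  qed
qed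

text \<open>Weyl differencing as an exact identity: off the diagonal, the pairs with differences h
  and -h are conjugate. The induction adds the pairs containing the index \<open>M\<close>.\<close>

lemma norm_sum_power2_correlations:
  fixes f :: "nat \<Rightarrow> complex"
  shows "(norm (\<Sum>x<M. f x))\<^sup>2 = (\<Sum>x<M. (norm (f x))\<^sup>2) +
           2 * Re (\<Sum>h\<in>{1..<M}. \<Sum>x<M - h. f (x + h) * cnj (f x))"
proof (induction M)
  case (Suc M)
  have eq: "(\<Sum>h\<in>{1..<Suc M}. \<Sum>x<Suc M - h. f (x + h) * cnj (f x)) =
        (\<Sum>h\<in>{1..<M}. \<Sum>x<M - h. f (x + h) * cnj (f x)) + f M * cnj (\<Sum>x<M. f x)"
  proof -
    have "(\<Sum>h\<in>{1..<Suc M}. \<Sum>x<Suc M - h. f (x + h) * cnj (f x)) =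
      (\<Sum>h\<in>{1..<Suc M}. (\<Sum>x<M - h. f (x + h) * cnj (f x)) + f M * cnj (f (M - h)))"
      by (intro sum.cong refl) (auto simp: Suc_diff_le)
    also have "\<dots> = (\<Sum>h\<in>{1..<Suc M}. (\<Sum>x<M - h. f (x + h) * cnj (f x)))
         + f M * (\<Sum>h\<in>{1..<Suc M}. cnj (f (M - h)))"
      unfolding sum.distrib sum_distrib_left ..
    also have "(\<Sum>h\<in>{1..<Suc M}. cnj (f (M - h))) = (\<Sum>x<M. cnj (f x))"
      by (rule sum.reindex_bij_witness[of _ "\<lambda>x. M - x" "\<lambda>h. M - h"]) auto
    also have "(\<Sum>h\<in>{1..<Suc M}. (\<Sum>x<M - h. f (x + h) * cnj (f x))) =
       (\<Sum>h\<in>{1..<M}. (\<Sum>x<M - h. f (x + h) * cnj (f x)))"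
      by (intro sum.mono_neutral_right) auto
    finally show ?thesis by simp
  qed
  have "(norm (\<Sum>x<Suc M. f x))\<^sup>2 =
      (norm (\<Sum>x<M. f x))\<^sup>2 + (norm (f M))\<^sup>2 + 2 * Re (f M * cnj (\<Sum>x<M. f x))"
    unfolding cmod_power2 by (simp add: power2_eq_square algebra_simps sum_negf)
  then show ?case unfolding Suc.IH eq by simp
qed simp

section \<open>Additive characters\<close>

definition unit_exp :: "real \<Rightarrow> complex" where "unit_exp t = cis (2 * pi * t)"

lemma norm_unit_exp [simp]: "norm (unit_exp t) = 1"
  by (simp add: unit_exp_def)

lemma unit_exp_0 [simp]: "unit_exp 0 = 1"
  by (simp add: unit_exp_def)

lemma unit_exp_add: "unit_exp (s + t) = unit_exp s * unit_exp t"
  by (simp add: unit_exp_def cis_mult distrib_left)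

lemma unit_exp_minus: "unit_exp (- t) = cnj (unit_exp t)"
  by (simp add: unit_exp_def cis_cnj)

lemma unit_exp_of_int [simp]: "unit_exp (of_int n) = 1"
  by (simp add: unit_exp_def)

lemma unit_exp_power: "unit_exp t ^ n = unit_exp (real n * t)"
  unfolding unit_exp_def Complex.DeMoivre by (simp add: mult_ac)

lemma norm_unit_exp_minus_one: "norm (unit_exp t - 1) = 2 * \<bar>sin (pi * t)\<bar>"
proof -
  have "(norm (unit_exp t - 1))\<^sup>2 = (cos (2 * pi * t) - 1)\<^sup>2 + (sin (2 * pi * t))\<^sup>2"
    by (simp add: unit_exp_def cmod_power2)
  also have "\<dots> = 2 - 2 * cos (2 * pi * t)"
    using sin_cos_squared_add[of "2 * pi * t"] by (simp add: power2_eq_square algebra_simps)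
  also have "\<dots> = (2 * \<bar>sin (pi * t)\<bar>)\<^sup>2"
    using cos_double_sin[of "pi * t"] by (simp add: power2_eq_square algebra_simps)
  finally show ?thesis by (rule power2_eq_imp_eq) auto
qed

lemma norm_unit_exp_minus_one_le:
  assumes "near s t"
  shows "norm (unit_exp t - 1) \<le> 2 * pi * s"
proof -
  obtain n :: int where n: "\<bar>t - n\<bar> \<le> s" using assms unfolding near_def by blast
  have "unit_exp t = unit_exp (t - n)" using unit_exp_add[of "t - n" n] by simp
  then have "norm (unit_exp t - 1) \<le> 2 * \<bar>pi * (t - n)\<bar>"
    using norm_unit_exp_minus_one[of "t - n"] abs_sin_x_le_abs_x[of "pi * (t - n)"] by simp
  also have "\<dots> = 2 * pi * \<bar>t - n\<bar>" by (simp add: abs_mult)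
  also have "\<dots> \<le> 2 * pi * s" using n by (intro mult_left_mono) auto
  finally show ?thesis .
qed

text \<open>After reduction to |u| \<le> 1/2 the angle y = pi |u| is at most 2, where the cubic
  Taylor bound gives sin y \<ge> y / 3. Together with pi \<ge> 2 this yields the constant 1.\<close>

lemma near_norm_unit_exp_minus_one: "near (norm (unit_exp t - 1)) t"
proof -
  define u where "u = t - round t"
  have u: "\<bar>u\<bar> \<le> 1 / 2" unfolding u_def using of_int_round_abs_le[of t] by (simp add: abs_minus_commute)
  have "unit_exp t = unit_exp u" using unit_exp_add[of u "round t"] by (simp add: u_def)
  then have eq: "norm (unit_exp t - 1) = 2 * \<bar>sin (pi * u)\<bar>" by (simp add: norm_unit_exp_minus_one)
  define y where "y = pi * \<bar>u\<bar>"
  have y: "0 \<le> y" "y \<le> 2"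
  proof -
    have "y \<le> pi * (1 / 2)" unfolding y_def using u by (intro mult_left_mono) auto
    then show "y \<le> 2" using pi_less_4 by linarith
  qed (simp add: y_def)
  have "\<bar>sin y - (\<Sum>m<3. sin_coeff m * y ^ m)\<bar> \<le> inverse (fact 3) * \<bar>y\<bar> ^ 3"
    by (rule Maclaurin_sin_bound)
  moreover have "(\<Sum>m<3. sin_coeff m * y ^ m) = y"
    by (simp add: eval_nat_numeral sin_coeff_def)
  ultimately have "\<bar>sin y - y\<bar> \<le> y ^ 3 / 6" using y(1) by (simp add: fact_numeral)
  then have "y - sin y \<le> y ^ 3 / 6" by linarith
  moreover have "y ^ 3 \<le> 4 * y"
  proof -
    have "y * y \<le> 2 * 2" using y by (intro mult_mono) auto
    then have "y * (y * y) \<le> y * 4" using y by (intro mult_left_mono) auto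
    then show ?thesis by (simp add: power3_eq_cube mult_ac)
  qed
  ultimately have "y / 3 \<le> sin y" by simp
  moreover have "\<bar>sin (pi * u)\<bar> \<ge> sin y"
    unfolding y_def by (cases "u \<ge> 0") (auto simp: abs_if)
  moreover have "y \<ge> 2 * \<bar>u\<bar>" unfolding y_def using pi_ge_two by (intro mult_right_mono) auto
  ultimately have "\<bar>u\<bar> \<le> 2 * \<bar>sin (pi * u)\<bar>" by linarith
  then show ?thesis unfolding eq near_def u_def by blast
qed

section \<open>Polynomial phases and their differences\<close>

definition phase :: "nat \<Rightarrow> (nat \<Rightarrow> real) \<Rightarrow> nat \<Rightarrow> real" where
  "phase k c x = (\<Sum>i\<le>k. c i * real x ^ i)"

text \<open>The coefficient of x^j in the binomial expansion of the phase at x + h minus the phase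
  at x. For j = k - 1 it is k c_k h, linear in h.\<close>

definition diff_coeff :: "nat \<Rightarrow> (nat \<Rightarrow> real) \<Rightarrow> nat \<Rightarrow> nat \<Rightarrow> real" where
  "diff_coeff k c h j = (\<Sum>i\<in>{j<..k}. c i * real (i choose j) * real h ^ (i - j))"

lemma phase_diff: "phase (Suc k) c (x + h) - phase (Suc k) c x = phase k (diff_coeff (Suc k) c h) x"
proof -
  have "c i * real (x + h) ^ i - c i * real x ^ i =
     (\<Sum>j\<le>k. if j < i then c i * real (i choose j) * real h ^ (i - j) * real x ^ j else 0)"
    if i: "i \<le> Suc k" for i
  proof -
    have "real (x + h) ^ i = (\<Sum>j\<le>i. real (i choose j) * real x ^ j * real h ^ (i - j))"
      by (simp add: binomial_ring)
    also have "\<dots> = (\<Sum>j<i. real (i choose j) * real x ^ j * real h ^ (i - j)) + real x ^ i"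
      by (simp add: lessThan_Suc_atMost[symmetric])
    finally have "c i * real (x + h) ^ i - c i * real x ^ i =
       (\<Sum>j<i. c i * real (i choose j) * real h ^ (i - j) * real x ^ j)"
      by (simp add: algebra_simps sum_distrib_left)
    also have "\<dots> = (\<Sum>j\<in>{..k} \<inter> {j. j < i}. c i * real (i choose j) * real h ^ (i - j) * real x ^ j)"
      using i by (intro sum.cong) auto
    finally show ?thesis by (simp add: sum.inter_restrict)
  qed
  then have "phase (Suc k) c (x + h) - phase (Suc k) c x =
     (\<Sum>i\<le>Suc k. \<Sum>j\<le>k. if j < i then c i * real (i choose j) * real h ^ (i - j) * real x ^ j else 0)"
    unfolding phase_def sum_subtractf[symmetric] by (intro sum.cong) auto
  also have "\<dots> = (\<Sum>j\<le>k. \<Sum>i\<le>Suc k. if j < i then c i * real (i choose j) * real h ^ (i - j) * real x ^ j else 0)"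
    by (rule sum.swap)
  also have "\<dots> = (\<Sum>j\<le>k. \<Sum>i\<in>{j<..Suc k}. c i * real (i choose j) * real h ^ (i - j) * real x ^ j)"
  proof (rule sum.cong[OF refl])
    fix j
    have "{j<..Suc k} = {..Suc k} \<inter> {i. j < i}" by auto
    then show "(\<Sum>i\<le>Suc k. if j < i then c i * real (i choose j) * real h ^ (i - j) * real x ^ j else 0) =
      (\<Sum>i\<in>{j<..Suc k}. c i * real (i choose j) * real h ^ (i - j) * real x ^ j)"
      by (simp add: sum.inter_restrict)
  qed
  also have "\<dots> = phase k (diff_coeff (Suc k) c h) x"
    unfolding phase_def diff_coeff_def by (simp add: sum_distrib_right)
  finally show ?thesis .
qed

text \<open>With fewer such shifts, the identity for the squared sum would fall short of (\<epsilon>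
  M)^2: the diagonal contributes only M, at most a quarter of it by
  \<open>4 \<le> \<epsilon>\<^sup>2 * M\<close>.\<close>

lemma many_large_correlations:
  fixes f :: "nat \<Rightarrow> complex"
  assumes f: "\<And>x. norm (f x) = 1" and \<epsilon>: "0 < \<epsilon>" "\<epsilon> \<le> 1"
    and M: "4 / \<epsilon>\<^sup>2 \<le> real M" and large: "\<epsilon> * real M \<le> norm (\<Sum>x<M. f x)"
  shows "\<epsilon>\<^sup>2 / 8 * real M \<le>
     real (card {h\<in>{1..<M}. \<epsilon>\<^sup>2 / 8 * real M \<le> norm (\<Sum>x<M - h. f (x + h) * cnj (f x))})"
proof -
  define T where "T h = (\<Sum>x<M - h. f (x + h) * cnj (f x))" for h
  define H where "H = {h\<in>{1..<M}. \<epsilon>\<^sup>2 / 8 * real M \<le> norm (T h)}"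
  have M4: "4 \<le> \<epsilon>\<^sup>2 * M" using M \<epsilon> by (simp add: field_simps)
  then have M0: "real M > 0" using \<epsilon> by (metis mult_zero_right not_numeral_le_zero of_nat_0 of_nat_0_less_iff gr0I)
  have T: "norm (T h) \<le> M" for h
  proof -
    have "norm (T h) \<le> (\<Sum>x<M - h. norm (f (x + h) * cnj (f x)))" unfolding T_def by (rule norm_sum)
    then show ?thesis by (simp add: norm_mult f)
  qed
  have "(\<epsilon> * M)\<^sup>2 \<le> (norm (\<Sum>x<M. f x))\<^sup>2" using large \<epsilon> by (intro power_mono) auto
  also have "\<dots> = M + 2 * Re (\<Sum>h\<in>{1..<M}. T h)"
    unfolding norm_sum_power2_correlations T_def by (simp add: f)
  also have "Re (\<Sum>h\<in>{1..<M}. T h) \<le> (\<Sum>h\<in>{1..<M}. norm (T h))"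
    by (rule order_trans[OF complex_Re_le_cmod norm_sum])
  also have "(\<Sum>h\<in>{1..<M}. norm (T h)) \<le> (\<Sum>h\<in>{1..<M}. (if h \<in> H then real M else 0) + \<epsilon>\<^sup>2 / 8 * M)"
  proof (rule sum_mono)
    fix h assume h: "h \<in> {1..<M}"
    have pos: "\<epsilon>\<^sup>2 / 8 * M \<ge> 0" by simp
    show "norm (T h) \<le> (if h \<in> H then real M else 0) + \<epsilon>\<^sup>2 / 8 * M"
    proof (cases "h \<in> H")
      case True
      then have "(if h \<in> H then real M else 0) = real M" by simp
      then show ?thesis using T[of h] pos by linarith
    qed (use h in \<open>auto simp: H_def\<close>)
  qed
  also have "\<dots> = real (card H) * M + real (M - 1) * (\<epsilon>\<^sup>2 / 8 * M)"
  proof -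
    have "{1..<M} \<inter> H = H" unfolding H_def by auto
    then show ?thesis by (simp add: sum.distrib sum.If_cases)
  qed
  also have "real (M - 1) * (\<epsilon>\<^sup>2 / 8 * M) \<le> M * (\<epsilon>\<^sup>2 / 8 * M)"
    by (intro mult_right_mono) auto
  finally have "M * (\<epsilon>\<^sup>2 * M) \<le> M * (1 + 2 * card H + \<epsilon>\<^sup>2 / 4 * M)"
    by (simp add: power2_eq_square algebra_simps)
  then have "\<epsilon>\<^sup>2 * M \<le> 1 + 2 * card H + \<epsilon>\<^sup>2 / 4 * M"
    using M0 by (simp only: mult_le_cancel_left_pos)
  then have "\<epsilon>\<^sup>2 / 8 * M \<le> card H" using M4 by simp
  then show ?thesis unfolding H_def T_def .
qed

text \<open>\<open>l\<close> counts the coefficients treated so far, from the top. In the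
  coefficient of x^j of the difference, c_(j+1) enters linearly in h, and all other terms involve
  coefficients already treated; \<open>dense_near_multiples\<close> then removes h. The descent ends
  at c_2, because c_1 occurs only in the constant term j = 0, on which nothing is assumed.\<close>

lemma near_diff_coeff_descent:
  fixes \<eta> :: real and C0 Q k l :: nat
  assumes \<eta>: "\<eta> > 0" and Q: "Q \<ge> 1" and C0: "C0 \<ge> 1" and "l \<le> k"
  shows "\<exists>C::nat. C \<ge> 1 \<and> (\<forall>c (M::nat) H. M \<ge> 1 \<longrightarrow> H \<subseteq> {..<M} \<longrightarrow> \<eta> * real M \<le> real (card H) \<longrightarrow>
     (\<forall>h\<in>H. \<forall>j\<in>{1..k}. near (real C0 / real M ^ j) (real Q * diff_coeff (Suc k) c h j)) \<longrightarrow>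
     (\<exists>q\<in>{1..C}. \<forall>i\<in>{k + 2 - l..k + 1}. near (real C / real M ^ i) (real q * c i)))"
  using \<open>l \<le> k\<close>
proof (induction l)
  case 0
  show ?case by (intro exI[of _ 1]) auto
next
  case (Suc l)
  then obtain C :: nat where C1: "C \<ge> 1" and C: "\<And>c (M::nat) H. M \<ge> 1 \<Longrightarrow> H \<subseteq> {..<M} \<Longrightarrow>
     \<eta> * real M \<le> real (card H) \<Longrightarrow>
     (\<forall>h\<in>H. \<forall>j\<in>{1..k}. near (real C0 / real M ^ j) (real Q * diff_coeff (Suc k) c h j)) \<Longrightarrow>
     \<exists>q\<in>{1..C}. \<forall>i\<in>{k + 2 - l..k + 1}. near (real C / real M ^ i) (real q * c i)"
    by (metis Suc_leD)
  from dense_near_multiples[OF \<eta>] obtain K :: nat where K1: "K \<ge> 1" and K: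
    "\<And>\<beta> s M H. H \<subseteq> {..<M} \<Longrightarrow> \<eta> * real M \<le> real (card H) \<Longrightarrow> 0 \<le> s \<Longrightarrow>
       (\<And>h. h \<in> H \<Longrightarrow> near s (\<beta> * real h)) \<Longrightarrow> real K * s \<le> 1 \<Longrightarrow> K \<le> M \<Longrightarrow>
       \<exists>q\<in>{1..K}. near (real K * s / real M) (real q * \<beta>)" by metis
  \<comment> \<open>Error in the coefficient of x^j after removal of the treated terms: the
    hypothesis scaled by q \<le> C, plus at most k + 1 such terms.\<close>
  define C3 where "C3 = C * C0 + (k + 1) * (Q * 2 ^ (k + 1) * C)"
  define i0 where "i0 = k + 1 - l"
  define j where "j = i0 - 1"
  have ij: "j \<ge> 1" "i0 = Suc j" "i0 \<le> k + 1" "j \<le> k" using Suc.prems by (auto simp: i0_def j_def)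
  have C3: "C3 \<ge> 1" using C1 C0 unfolding C3_def by (simp add: Suc_leI)
  \<comment> \<open>The first summand covers the new denominator and the scaled old errors. The
    power covers the new error and makes the claim trivial when M < K * C3.\<close>
  define C' where "C' = K * (C * Q * (k + 1)) * C + (K * C3) ^ (k + 1)"
  have KC3: "K * C3 \<ge> 1" using K1 C3 by simp
  have C'1: "C' \<ge> 1"
  proof -
    have "(K * C3) ^ (k + 1) \<ge> 1" using KC3 by (rule one_le_power)
    then show ?thesis unfolding C'_def by linarith
  qed
  show ?case
  proof (intro exI[of _ C'] conjI allI impI)
    show "C' \<ge> 1" by (rule C'1)
    fix c M H
    assume M: "1 \<le> (M::nat)" and H: "H \<subseteq> {..<M}" "\<eta> * real M \<le> real (card H)"
      and nr: "\<forall>h\<in>H. \<forall>j\<in>{1..k}. near (real C0 / real M ^ j) (real Q * diff_coeff (Suc k) c h j)"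
    show "\<exists>q\<in>{1..C'}. \<forall>i\<in>{k + 2 - Suc l..k + 1}. near (real C' / real M ^ i) (real q * c i)"
    proof (cases "M < K * C3")
      case True
      have "near (C' / real M ^ i) (1 * c i)" if "i \<in> {k + 2 - Suc l..k + 1}" for i
      proof (rule near_one)
        have "M ^ i \<le> M ^ (k + 1)" using that M by (intro power_increasing) auto
        also have "\<dots> \<le> (K * C3) ^ (k + 1)" using True by (intro power_mono) auto
        also have "\<dots> \<le> C'" unfolding C'_def by simp
        finally have "real (M ^ i) \<le> real C'" by (simp only: of_nat_le_iff)
        then show "1 \<le> real C' / real M ^ i" using M by simp
      qed
      then show ?thesis using C'1 by (intro bexI[of _ 1]) auto
    next
      case False
      obtain q where q: "q \<in> {1..C}"
        "\<And>i. i \<in> {k + 2 - l..k + 1} \<Longrightarrow> near (real C / real M ^ i) (real q * c i)"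
        using C[OF M H nr] by blast
      have top: "near (C3 / M ^ j) ((q * Q * i0 * c i0) * h)" if h: "h \<in> H" for h
      proof -
        define n where "n i = Q * (i choose j) * h ^ (i - j)" for i
        have hM: "h < M" using h H by auto
        have "near (Q * 2 ^ (k + 1) * C / M ^ j) (n i * (q * c i))" if i: "i \<in> {i0<..k + 1}" for i
        proof (rule near_mono)
          have "i \<in> {k + 2 - l..k + 1}" using i unfolding i0_def by auto
          from near_mult_nat[OF q(2)[OF this], of "n i"]
          show "near (n i * (C / M ^ i)) (n i * (q * c i))" by simp
          have "(i choose j) \<le> 2 ^ (k + 1)"
            using i by (intro order_trans[OF binomial_le_pow2] power_increasing) auto
          moreover have "h ^ (i - j) \<le> M ^ (i - j)" using hM by (intro power_mono) auto
          ultimately have "n i \<le> Q * 2 ^ (k + 1) * M ^ (i - j)"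
            unfolding n_def by (intro mult_le_mono) auto
          then have "real (n i) \<le> real (Q * 2 ^ (k + 1) * M ^ (i - j))" by (simp only: of_nat_le_iff)
          then have "n i * (C / M ^ i) \<le> real (Q * 2 ^ (k + 1) * M ^ (i - j)) * (C / M ^ i)"
            by (intro mult_right_mono) auto
          also have "\<dots> = Q * 2 ^ (k + 1) * C * (real M ^ (i - j) / M ^ i)" by simp
          also have "real M ^ (i - j) / M ^ i = 1 / M ^ j"
          proof -
            have "real M ^ i = M ^ (i - j) * M ^ j" using i ij by (simp add: power_add[symmetric])
            then show ?thesis using M by simp
          qed
          finally show "n i * (C / M ^ i) \<le> Q * 2 ^ (k + 1) * C / M ^ j" by simp
        qed
        then have "near (\<Sum>i\<in>{i0<..k + 1}. Q * 2 ^ (k + 1) * C / M ^ j) (\<Sum>i\<in>{i0<..k + 1}. n i * (q * c i))"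
          by (intro near_sum) auto
        then have s1: "near ((k + 1) * (Q * 2 ^ (k + 1) * C / M ^ j)) (\<Sum>i\<in>{i0<..k + 1}. n i * (q * c i))"
        proof (rule near_mono)
          have "real (card {i0<..k + 1}) \<le> real (k + 1)" by (simp only: of_nat_le_iff) simp
          then show "(\<Sum>i\<in>{i0<..k + 1}. real (Q * 2 ^ (k + 1) * C) / real (M ^ j)) \<le>
              real (k + 1) * (real (Q * 2 ^ (k + 1) * C) / real (M ^ j))"
            unfolding sum_constant by (intro mult_right_mono) auto
        qed
        have "near (q * (C0 / M ^ j)) (q * (Q * diff_coeff (Suc k) c h j))"
          using nr h ij by (intro near_mult_nat) auto
        then have s2: "near (C * C0 / M ^ j) (q * (Q * diff_coeff (Suc k) c h j))"
        proof (rule near_mono)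
          have "real q * (C0 / M ^ j) \<le> C * (C0 / M ^ j)" using q(1) by (intro mult_right_mono) auto
          then show "real q * (C0 / M ^ j) \<le> C * C0 / M ^ j" by simp
        qed
        have "{j<..Suc k} = insert i0 {i0<..k + 1}" using ij by auto
        then have "q * (Q * diff_coeff (Suc k) c h j) =
            q * Q * i0 * c i0 * h + (\<Sum>i\<in>{i0<..k + 1}. n i * (q * c i))"
          using ij unfolding diff_coeff_def n_def
          by (simp add: sum_distrib_left algebra_simps)
        then have "near (C * C0 / M ^ j + (k + 1) * (Q * 2 ^ (k + 1) * C / M ^ j)) (q * Q * i0 * c i0 * h)"
          using near_diff[OF s2 s1] by simp
        moreover have "C * C0 / M ^ j + (k + 1) * (Q * 2 ^ (k + 1) * C / M ^ j) = C3 / M ^ j"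
          unfolding C3_def by (simp add: add_divide_distrib algebra_simps)
        ultimately show ?thesis by (simp only: )
      qed
      have "M \<le> M ^ j" using M ij by (simp add: self_le_power)
      then have "K * C3 \<le> M ^ j" using False by linarith
      then have "real (K * C3) \<le> real (M ^ j)" by (simp only: of_nat_le_iff)
      then have small: "K * (C3 / M ^ j) \<le> 1" using M by simp
      have "K \<le> M"
      proof -
        have "K \<le> K * C3" using C3 by simp
        then show ?thesis using False by linarith
      qed
      then obtain q' where q': "q' \<in> {1..K}" "near (K * (C3 / M ^ j) / M) (q' * (q * Q * i0 * c i0))"
        using K[OF H, of "C3 / M ^ j" "q * Q * i0 * c i0"] top small by auto
      define r where "r = q' * q * Q * i0"
      have r0: "r \<ge> 1" using q q' Q ij unfolding r_def by (simp add: Suc_leI)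
      have rC: "r * C \<le> C'"
      proof -
        have "r \<le> K * C * Q * (k + 1)" unfolding r_def using q q' ij by (intro mult_le_mono) auto
        then have "r * C \<le> K * C * Q * (k + 1) * C" by (rule mult_le_mono1)
        also have "\<dots> = K * (C * Q * (k + 1)) * C" by (simp only: mult.assoc)
        finally show ?thesis unfolding C'_def by linarith
      qed
      have "r \<le> r * C" using C1 by simp
      also note rC
      finally have "r \<in> {1..C'}" using r0 by simp
      moreover have "near (C' / M ^ i) (r * c i)" if i: "i \<in> {k + 2 - Suc l..k + 1}" for i
      proof (cases "i = i0")
        case True
        have "K * C3 \<le> (K * C3) ^ (k + 1)" using KC3 by (intro self_le_power) auto
        also have "\<dots> \<le> C'" unfolding C'_def by simp
        finally have "real (K * C3) \<le> real C'" by (simp only: of_nat_le_iff)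
        then have le: "K * (C3 / M ^ j) / M \<le> C' / M ^ i0" unfolding ij(2) using M
          by (simp add: field_simps)
        have eqr: "q' * (q * Q * i0 * c i0) = r * c i" unfolding r_def True by simp
        from near_mono[OF q'(2) le] have "near (C' / M ^ i0) (r * c i)" unfolding eqr .
        then show ?thesis unfolding True by simp
      next
        case False
        then have "i \<in> {k + 2 - l..k + 1}" using i Suc.prems unfolding i0_def by auto
        from near_mult_nat[OF q(2)[OF this], of "q' * Q * i0"]
        have "near ((q' * Q * i0) * (C / M ^ i)) ((q' * Q * i0) * (q * c i))" by simp
        then have "near ((q' * Q * i0) * (C / M ^ i)) (r * c i)" unfolding r_def by (simp add: mult_ac)
        then show ?thesis
        proof (rule near_mono)
          have "q' * Q * i0 * C \<le> r * C" unfolding r_def using q(1) by simp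
          then have "real (q' * Q * i0 * C) \<le> real C'" using rC by (simp only: of_nat_le_iff)
          then have le: "real (q' * Q * i0 * C) / real (M ^ i) \<le> C' / M ^ i" by (rule divide_right_mono) simp
          have "(q' * Q * i0) * (C / M ^ i) = real (q' * Q * i0 * C) / real (M ^ i)"
            by (simp only: times_divide_eq_right of_nat_mult)
          then show "(q' * Q * i0) * (C / M ^ i) \<le> C' / M ^ i" using le by (simp only:)
        qed
      qed
      ultimately show ?thesis by (intro bexI[of _ r] ballI) simp_all
    qed
  qed
qed

text \<open>(a + q y)^i - a^i is a multiple of \<open>q\<close>, so only \<open>q * t\<close>
  matters, and the cofactor is O(y M^(i-1)).\<close>

lemma near_power_diff:
  fixes a q y M C i :: nat and t :: real
  assumes "a \<le> M" "q * y \<le> M" "M \<ge> 1" "i \<ge> 1" "near (C / M ^ i) (q * t)"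
  shows "near (C * i * 2 ^ i * y / M) (t * (real (a + q * y) ^ i - real a ^ i))"
proof -
  define m where "m = y * (\<Sum>p<i. (a + q * y) ^ p * a ^ (i - Suc p))"
  have "real (a + q * y) ^ i - real a ^ i = real q * real m"
    using power_diff_sumr2[of "real (a + q * y)" i "real a"] unfolding m_def by (simp add: mult_ac)
  then have eq: "t * (real (a + q * y) ^ i - real a ^ i) = m * (q * t)" by simp
  have "(\<Sum>p<i. (a + q * y) ^ p * a ^ (i - Suc p)) \<le> (\<Sum>p<i. (2 * M) ^ (i - 1))"
  proof (rule sum_mono)
    fix p assume p: "p \<in> {..<i}"
    have "(a + q * y) ^ p * a ^ (i - Suc p) \<le> (2 * M) ^ p * (2 * M) ^ (i - Suc p)"
      using assms by (intro mult_le_mono power_mono) auto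
    also have "\<dots> = (2 * M) ^ (p + (i - Suc p))" by (rule power_add[symmetric])
    also have "p + (i - Suc p) = i - 1" using p by auto
    finally show "(a + q * y) ^ p * a ^ (i - Suc p) \<le> (2 * M) ^ (i - 1)" .
  qed
  then have "m \<le> y * (i * (2 * M) ^ (i - 1))" unfolding m_def by simp
  then have "real m \<le> real (y * (i * (2 * M) ^ (i - 1)))" by (simp only: of_nat_le_iff)
  then have "real m * (C / M ^ i) \<le> real (y * (i * (2 * M) ^ (i - 1))) * (C / M ^ i)"
    by (intro mult_right_mono) auto
  also have "\<dots> = C * i * 2 ^ (i - 1) * y * (real M ^ (i - 1) / M ^ i)"
    by (simp add: power_mult_distrib)
  also have "real M ^ (i - 1) / M ^ i = 1 / M"
    using assms by (cases i) auto
  also have "C * i * 2 ^ (i - 1) * y * (1 / real M) \<le> C * i * 2 ^ i * y * (1 / M)"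
  proof -
    have "C * i * 2 ^ (i - 1) * y \<le> C * i * 2 ^ i * y" by (intro mult_le_mono power_increasing) auto
    then have "real (C * i * 2 ^ (i - 1) * y) \<le> real (C * i * 2 ^ i * y)" by (simp only: of_nat_le_iff)
    then show ?thesis by (simp add: divide_right_mono)
  qed
  finally have "real m * (C / M ^ i) \<le> C * i * 2 ^ i * y / M" by simp
  moreover have "near (m * (C / M ^ i)) (m * (q * t))" using assms(5) by (rule near_mult_nat)
  ultimately show ?thesis unfolding eq by (rule near_mono[rotated])
qed

text \<open>The geometric sum is at most 2 / |z - 1|, and |z - 1| dominates the distance of
  \<open>t\<close> to the integers.\<close>

lemma near_of_large_geometric_sum:
  assumes "\<epsilon> > 0" "M \<ge> 1" "\<epsilon> * real M \<le> norm (\<Sum>y<M. unit_exp (t * real y))"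
  shows "near (2 / (\<epsilon> * real M)) t"
proof -
  have eq: "unit_exp (t * real y) = unit_exp t ^ y" for y by (simp add: unit_exp_power mult.commute)
  define z where "z = unit_exp t"
  have "(\<Sum>y<M. unit_exp (t * real y)) * (z - 1) = z ^ M - 1"
    unfolding eq z_def[symmetric] by (simp add: power_diff_1_eq mult.commute)
  then have "norm (\<Sum>y<M. unit_exp (t * real y)) * norm (z - 1) = norm (z ^ M - 1)"
    by (metis norm_mult)
  also have "\<dots> \<le> norm (z ^ M) + norm (1 :: complex)" by (rule norm_triangle_ineq4)
  also have "\<dots> = 2" by (simp add: z_def norm_power)
  finally have "norm (\<Sum>y<M. unit_exp (t * real y)) * norm (z - 1) \<le> 2" .
  moreover have "\<epsilon> * M * norm (z - 1) \<le> norm (\<Sum>y<M. unit_exp (t * real y)) * norm (z - 1)"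
    using assms(3) by (intro mult_right_mono) auto
  ultimately have "norm (z - 1) \<le> 2 / (\<epsilon> * M)" using assms by (simp add: field_simps)
  then show ?thesis using near_norm_unit_exp_minus_one[of t] unfolding z_def by (rule near_mono[rotated])
qed

lemma norm_sum_shift_diff_le:
  fixes f :: "nat \<Rightarrow> complex"
  assumes "\<And>x. norm (f x) \<le> 1"
  shows "norm ((\<Sum>x<M. f (x + s)) - (\<Sum>x<M. f x)) \<le> 2 * real s"
proof (induction s)
  case (Suc s)
  have eq: "(\<Sum>x<M. f (x + Suc s)) + f s = (\<Sum>x<M. f (x + s)) + f (M + s)"
    using sum.lessThan_Suc_shift[of "\<lambda>x. f (x + s)" M] by (simp add: add.commute)
  have "(\<Sum>x<M. f (x + Suc s)) - (\<Sum>x<M. f x) =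
      ((\<Sum>x<M. f (x + s)) - (\<Sum>x<M. f x)) + (f (M + s) - f s)"
    using eq by (simp add: algebra_simps)
  then have "norm ((\<Sum>x<M. f (x + Suc s)) - (\<Sum>x<M. f x)) \<le>
      norm ((\<Sum>x<M. f (x + s)) - (\<Sum>x<M. f x)) + norm (f (M + s) - f s)"
    by (metis norm_triangle_ineq)
  also have "norm (f (M + s) - f s) \<le> norm (f (M + s)) + norm (f s)" by (rule norm_triangle_ineq4)
  also have "\<dots> \<le> 2" using assms[of "M + s"] assms[of s] by simp
  finally show ?case using Suc by simp
qed simp

text \<open>Averaging: summed over the starting points x, the progression sums are \<open>M'\<close>
  shifted copies of the full sum, and a shift by q y changes it by at most 2 q y \<le> \<epsilon> M
  / 2.\<close>

lemma exists_large_progression_sum: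
  fixes f :: "nat \<Rightarrow> complex"
  assumes f: "\<And>x. norm (f x) \<le> 1" and M: "M \<ge> 1" and large: "\<epsilon> * real M \<le> norm (\<Sum>x<M. f x)"
    and q: "real (q * M') \<le> \<epsilon> / 4 * real M"
  shows "\<exists>x<M. \<epsilon> / 2 * real M' \<le> norm (\<Sum>y<M'. f (x + q * y))"
proof (rule ccontr)
  assume neg: "\<not> ?thesis"
  then have *: "norm (\<Sum>y<M'. f (x + q * y)) < \<epsilon> / 2 * M'" if "x < M" for x using that by force
  have "norm (\<Sum>x<M. \<Sum>y<M'. f (x + q * y)) \<le> (\<Sum>x<M. norm (\<Sum>y<M'. f (x + q * y)))"
    by (rule norm_sum)
  also have "\<dots> < (\<Sum>x<M. \<epsilon> / 2 * M')"
    using M * by (intro sum_strict_mono) (auto simp: lessThan_empty_iff)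
  finally have up: "norm (\<Sum>x<M. \<Sum>y<M'. f (x + q * y)) < M * (\<epsilon> / 2 * M')" by simp
  have "norm ((\<Sum>y<M'. \<Sum>x<M. f (x + q * y)) - (\<Sum>y<M'. \<Sum>x<M. f x)) \<le>
     (\<Sum>y<M'. norm ((\<Sum>x<M. f (x + q * y)) - (\<Sum>x<M. f x)))"
    unfolding sum_subtractf[symmetric] by (rule norm_sum)
  also have "\<dots> \<le> (\<Sum>y<M'. \<epsilon> / 2 * M)"
  proof (rule sum_mono)
    fix y assume "y \<in> {..<M'}"
    then have "q * y \<le> q * M'" by simp
    then have "real (q * y) \<le> \<epsilon> / 4 * M" using q by (meson of_nat_le_iff order_trans)
    then show "norm ((\<Sum>x<M. f (x + q * y)) - (\<Sum>x<M. f x)) \<le> \<epsilon> / 2 * M"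
      using norm_sum_shift_diff_le[of f "q * y" M, OF f] by linarith
  qed
  finally have "norm ((\<Sum>y<M'. \<Sum>x<M. f (x + q * y)) - (\<Sum>y<M'. \<Sum>x<M. f x)) \<le> M' * (\<epsilon> / 2 * M)"
    by simp
  moreover have "norm (\<Sum>y<M'. \<Sum>x<M. f x) \<ge> M' * (\<epsilon> * M)"
    using large by (simp add: norm_mult mult_left_mono)
  moreover have "norm (\<Sum>y<M'. \<Sum>x<M. f x) \<le> norm (\<Sum>y<M'. \<Sum>x<M. f (x + q * y)) +
     norm ((\<Sum>y<M'. \<Sum>x<M. f (x + q * y)) - (\<Sum>y<M'. \<Sum>x<M. f x))"
    by (metis norm_triangle_sub norm_minus_commute)
  ultimately have "norm (\<Sum>y<M'. \<Sum>x<M. f (x + q * y)) \<ge> M * (\<epsilon> / 2 * M')"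
    by (simp add: algebra_simps)
  then show False using up by (subst (asm) sum.swap) simp
qed

text \<open>On a progression of step \<open>q\<close> and length \<eta> M the terms of degree at
  least 2 are almost constant modulo 1. So the phase is essentially linear there, and a large sum
  becomes a large geometric sum.\<close>

lemma near_linear_coeff:
  fixes \<epsilon> :: real and C k :: nat
  assumes \<epsilon>: "0 < \<epsilon>" "\<epsilon> \<le> 1" and C: "C \<ge> 1" and k: "k \<ge> 1"
  shows "\<exists>C'::nat. C' \<ge> 1 \<and> (\<forall>c (M::nat) q. M \<ge> 1 \<longrightarrow> q \<in> {1..C} \<longrightarrow>
     (\<forall>i\<in>{2..k}. near (real C / real M ^ i) (real q * c i)) \<longrightarrow>
     \<epsilon> * real M \<le> norm (\<Sum>x<M. unit_exp (phase k c x)) \<longrightarrow> near (real C' / real M) (real q * c 1))"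
proof -
  \<comment> \<open>The at most \<open>k\<close> higher terms drift by at most C k 2^k \<eta> each;
    this value makes the total \<epsilon> / 32.\<close>
  define \<eta> where "\<eta> = \<epsilon> / (32 * C * (k * (k * 2 ^ k)))"
  have D0: "real (32 * C * (k * (k * 2 ^ k))) > 0" using C k by simp
  have \<eta>0: "\<eta> > 0" unfolding \<eta>_def using \<epsilon> D0 by simp
  have \<eta>eq: "\<eta> * (32 * C * (k * (k * 2 ^ k))) = \<epsilon>"
  proof -
    have "real (32 * C * (k * (k * 2 ^ k))) \<noteq> 0" using D0 by linarith
    then show ?thesis unfolding \<eta>_def by (rule iffD1[OF nonzero_eq_divide_eq _ ]) (rule refl)
  qed
  define C' where "C' = nat \<lceil>16 / (\<epsilon> * \<eta>)\<rceil> + nat \<lceil>1 / \<eta>\<rceil> + 1"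
  have C': "16 / (\<epsilon> * \<eta>) \<le> C'" "1 / \<eta> \<le> C'"
    using real_nat_ceiling_ge[of "16 / (\<epsilon> * \<eta>)"] real_nat_ceiling_ge[of "1 / \<eta>"]
    unfolding C'_def of_nat_add of_nat_1 by linarith+
  show ?thesis
  proof (intro exI[of _ C'] conjI allI impI)
    show "C' \<ge> 1" unfolding C'_def by simp
    fix c :: "nat \<Rightarrow> real" and M q :: nat
    assume M: "M \<ge> 1" and q: "q \<in> {1..C}"
      and nr: "\<forall>i\<in>{2..k}. near (real C / real M ^ i) (real q * c i)"
      and large: "\<epsilon> * real M \<le> norm (\<Sum>x<M. unit_exp (phase k c x))"
    show "near (real C' / real M) (real q * c 1)"
    proof (cases "\<eta> * M < 1")
      case True
      then have "M < 1 / \<eta>" using \<eta>0 by (simp add: field_simps)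
      then have "1 \<le> C' / M" using C'(2) M by simp
      then show ?thesis by (rule near_one)
    next
      case False
      define M' where "M' = nat \<lfloor>\<eta> * M\<rfloor>"
      have M': "real M' \<le> \<eta> * M" "\<eta> * M / 2 \<le> real M'" "M' \<ge> 1"
      proof -
        define w where "w = \<lfloor>\<eta> * M\<rfloor>"
        have z: "1 \<le> w" using False unfolding w_def by (simp add: le_floor_iff)
        have "M' = nat w" unfolding M'_def w_def ..
        then have "real M' = of_int w" "M' \<ge> 1" using z by simp_all
        moreover have "of_int w \<ge> (1::real)" using z by simp
        moreover have "of_int w \<le> \<eta> * M" "\<eta> * M < of_int w + 1" unfolding w_def by linarith+
        ultimately show "real M' \<le> \<eta> * M" "\<eta> * M / 2 \<le> real M'" "M' \<ge> 1" by linarith+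
      qed
      have kk: "1 \<le> k * (k * 2 ^ k)" using k by simp
      have C\<eta>: "C * \<eta> \<le> \<epsilon> / 32"
      proof -
        have "C * \<eta> * 1 \<le> C * \<eta> * real (k * (k * 2 ^ k))"
        proof (rule mult_left_mono)
          show "1 \<le> real (k * (k * 2 ^ k))" using of_nat_mono[OF kk, where 'a = real] by simp
        qed (use \<eta>0 in simp)
        also have "\<dots> = \<epsilon> / 32" using \<eta>eq by (simp add: mult_ac)
        finally show ?thesis by simp
      qed
      have qM': "real (q * M') \<le> \<epsilon> / 32 * M"
      proof -
        have "real (q * M') \<le> C * (\<eta> * M)" using q M'(1) unfolding of_nat_mult by (intro mult_mono) auto
        also have "\<dots> \<le> \<epsilon> / 32 * M" using mult_right_mono[OF C\<eta>, of "real M"] by (simp add: mult_ac)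
        finally show ?thesis .
      qed
      define f where "f x = unit_exp (phase k c x)" for x
      have "\<epsilon> / 32 * M \<le> \<epsilon> / 4 * M" using \<epsilon> by (intro mult_right_mono) auto
      then have "real (q * M') \<le> \<epsilon> / 4 * M" using qM' by linarith
      then obtain a where a: "a < M" "\<epsilon> / 2 * M' \<le> norm (\<Sum>y<M'. f (a + q * y))"
        using exists_large_progression_sum[of f M \<epsilon> q M'] M large unfolding f_def by auto
      have approx: "norm (f (a + q * y) - f a * unit_exp (q * c 1 * y)) \<le> \<epsilon> / 4" if y: "y < M'" for y
      proof -
        have qy: "q * y \<le> M"
        proof -
          have "real (q * y) \<le> real (q * M')" using y by (simp only: of_nat_le_iff) simp
          also have "\<dots> \<le> 1 * real M"
            by (rule order_trans[OF qM']) (use \<epsilon> in \<open>intro mult_right_mono, auto\<close>)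
          finally show ?thesis by (simp only: of_nat_le_iff mult_1)
        qed
        define u where "u = (\<Sum>i\<in>{2..k}. c i * (real (a + q * y) ^ i - real a ^ i))"
        have "{..k} = insert 0 (insert 1 {2..k})" using k by auto
        then have "phase k c (a + q * y) - phase k c a = q * c 1 * y + u"
          unfolding phase_def u_def by (simp add: sum_subtractf right_diff_distrib algebra_simps)
        then have ph: "phase k c (a + q * y) = phase k c a + q * c 1 * y + u" by simp
        have "near (C * i * 2 ^ i * y / M) (c i * (real (a + q * y) ^ i - real a ^ i))" if "i \<in> {2..k}" for i
          using a(1) qy M that nr by (intro near_power_diff) auto
        then have "near (C * (k * 2 ^ k) * y / M) (c i * (real (a + q * y) ^ i - real a ^ i))" if i: "i \<in> {2..k}" for i
        proof (rule near_mono)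
          have "C * i * 2 ^ i * y \<le> C * (k * 2 ^ k) * y"
            using i by (auto simp: mult.assoc intro!: mult_le_mono power_increasing)
          then have "real (C * i * 2 ^ i * y) \<le> real (C * (k * 2 ^ k) * y)" by (simp only: of_nat_le_iff)
          then show "C * i * 2 ^ i * y / M \<le> C * (k * 2 ^ k) * y / M" by (intro divide_right_mono) auto
        qed fact
        then have "near (\<Sum>i\<in>{2..k}. C * (k * 2 ^ k) * y / M) u"
          unfolding u_def by (intro near_sum) auto
        then have "near (\<epsilon> / 32) u"
        proof (rule near_mono)
          have "(\<Sum>i\<in>{2..k}. C * (k * 2 ^ k) * y / M) = card {2..k} * (C * (k * 2 ^ k) * y / M)"
            by (rule sum_constant)
          also have "\<dots> \<le> k * (C * (k * 2 ^ k) * y / M)" by (intro mult_right_mono) auto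
          also have "\<dots> = C * (k * (k * 2 ^ k)) * (y / M)" by simp
          also have "\<dots> \<le> C * (k * (k * 2 ^ k)) * \<eta>"
          proof (rule mult_left_mono)
            have "real y \<le> \<eta> * M" using y M' by linarith
            then show "y / M \<le> \<eta>" using M by (simp add: field_simps)
          qed simp
          also have "\<dots> = \<epsilon> / 32" using \<eta>eq by (simp add: mult_ac)
          finally show "(\<Sum>i\<in>{2..k}. C * (k * 2 ^ k) * y / M) \<le> \<epsilon> / 32" .
        qed
        then have "norm (unit_exp u - 1) \<le> 2 * pi * (\<epsilon> / 32)" by (rule norm_unit_exp_minus_one_le)
        also have "\<dots> \<le> 2 * 4 * (\<epsilon> / 32)" using pi_less_4 \<epsilon> by (intro mult_right_mono) auto
        finally have "norm (unit_exp u - 1) \<le> \<epsilon> / 4" by simp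
        moreover have "f (a + q * y) - f a * unit_exp (q * c 1 * y) = f a * unit_exp (q * c 1 * y) * (unit_exp u - 1)"
          unfolding f_def ph unit_exp_add by (simp add: algebra_simps)
        ultimately show ?thesis by (simp add: norm_mult f_def)
      qed
      have "norm ((\<Sum>y<M'. f (a + q * y)) - (\<Sum>y<M'. f a * unit_exp (q * c 1 * y))) \<le> (\<Sum>y<M'. \<epsilon> / 4)"
        unfolding sum_subtractf[symmetric] using approx by (intro sum_norm_le) auto
      then have "norm ((\<Sum>y<M'. f (a + q * y)) - (\<Sum>y<M'. f a * unit_exp (q * c 1 * y))) \<le> \<epsilon> / 4 * M'"
        by (simp add: mult.commute)
      moreover have "norm (\<Sum>y<M'. f a * unit_exp (q * c 1 * y)) = norm (\<Sum>y<M'. unit_exp (q * c 1 * y))"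
        unfolding sum_distrib_left[symmetric] by (simp add: norm_mult f_def)
      moreover have "norm (\<Sum>y<M'. f (a + q * y)) \<le> norm (\<Sum>y<M'. f a * unit_exp (q * c 1 * y)) +
          norm ((\<Sum>y<M'. f (a + q * y)) - (\<Sum>y<M'. f a * unit_exp (q * c 1 * y)))"
        by (rule norm_triangle_sub)
      ultimately have "\<epsilon> / 4 * M' \<le> norm (\<Sum>y<M'. unit_exp (q * c 1 * y))"
        using a(2) by simp
      then have "near (2 / (\<epsilon> / 4 * M')) (q * c 1)"
        using \<epsilon> M' by (intro near_of_large_geometric_sum) auto
      then show ?thesis
      proof (rule near_mono)
        have "2 / (\<epsilon> / 4 * M') = 8 / \<epsilon> * (1 / M')" by simp
        also have "\<dots> \<le> 8 / \<epsilon> * (1 / (\<eta> * M / 2))"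
          using M'(2,3) \<eta>0 M \<epsilon> by (intro mult_left_mono divide_left_mono) auto
        also have "\<dots> = 16 / (\<epsilon> * \<eta>) / M" by simp
        also have "\<dots> \<le> C' / M" using C'(1) by (intro divide_right_mono) auto
        finally show "2 / (\<epsilon> / 4 * M') \<le> C' / M" .
      qed
    qed
  qed
qed

text \<open>Inverse form of Weyl's inequality. No arithmetic of the coefficients enters, so \<open>C\<close> is uniform
  over all polynomials of degree at most \<open>k\<close>.\<close>

theorem weyl_inverse:
  fixes \<epsilon> :: real
  assumes "\<epsilon> > 0"
  shows "\<exists>C::nat. C \<ge> 1 \<and> (\<forall>c (M::nat). M \<ge> 1 \<longrightarrow> \<epsilon> * real M \<le> norm (\<Sum>x<M. unit_exp (phase k c x)) \<longrightarrow>
     (\<exists>q\<in>{1..C}. \<forall>j\<in>{1..k}. near (real C / real M ^ j) (real q * c j)))"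
  using assms
proof (induction k arbitrary: \<epsilon>)
  case 0
  show ?case by (intro exI[of _ 1]) auto
next
  case (Suc k \<epsilon>0)
  define \<epsilon> where "\<epsilon> = min \<epsilon>0 1"
  have \<epsilon>: "0 < \<epsilon>" "\<epsilon> \<le> 1" "\<epsilon> \<le> \<epsilon>0" using Suc.prems unfolding \<epsilon>_def by auto
  define \<eta> where "\<eta> = \<epsilon>\<^sup>2 / 8"
  have \<eta>: "0 < \<eta>" "\<eta> \<le> 1"
    using \<epsilon> power_le_one[of \<epsilon> 2] unfolding \<eta>_def by auto
  obtain C1 :: nat where C1: "C1 \<ge> 1" "\<And>c (M::nat). M \<ge> 1 \<Longrightarrow>
     \<eta> * real M \<le> norm (\<Sum>x<M. unit_exp (phase k c x)) \<Longrightarrow>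
     \<exists>q\<in>{1..C1}. \<forall>j\<in>{1..k}. near (real C1 / real M ^ j) (real q * c j)"
    using Suc.IH[OF \<eta>(1)] by blast
  \<comment> \<open>The denominator given by induction depends on the shift h; a multiple of all
    candidates up to \<open>C1\<close> is common to all shifts.\<close>
  define Q :: nat where "Q = fact C1"
  \<comment> \<open>The correlation at a relevant h has M - h \<ge> \<eta> M terms, so errors
    measured in powers of M - h lose at most \<eta>^k.\<close>
  define C0 where "C0 = nat \<lceil>Q * C1 / \<eta> ^ k\<rceil> + 1"
  have C0: "Q * C1 / \<eta> ^ k \<le> C0"
    using real_nat_ceiling_ge[of "Q * C1 / \<eta> ^ k"] unfolding C0_def by simp
  have "Q \<ge> 1" "C0 \<ge> 1" unfolding Q_def C0_def by auto
  from near_diff_coeff_descent[OF \<eta>(1) this order_refl, of k]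
  obtain C2 :: nat where C2: "C2 \<ge> 1" "\<And>c (M::nat) H. M \<ge> 1 \<Longrightarrow> H \<subseteq> {..<M} \<Longrightarrow> \<eta> * real M \<le> real (card H) \<Longrightarrow>
     (\<forall>h\<in>H. \<forall>j\<in>{1..k}. near (real C0 / real M ^ j) (real Q * diff_coeff (Suc k) c h j)) \<Longrightarrow>
     \<exists>q\<in>{1..C2}. \<forall>i\<in>{2..Suc k}. near (real C2 / real M ^ i) (real q * c i)"
    by auto
  obtain C3 :: nat where C3: "C3 \<ge> 1" "\<And>c (M::nat) q. M \<ge> 1 \<Longrightarrow> q \<in> {1..C2} \<Longrightarrow>
     (\<forall>i\<in>{2..Suc k}. near (real C2 / real M ^ i) (real q * c i)) \<Longrightarrow>
     \<epsilon> * real M \<le> norm (\<Sum>x<M. unit_exp (phase (Suc k) c x)) \<Longrightarrow> near (real C3 / real M) (real q * c 1)"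
    using near_linear_coeff[OF \<epsilon>(1,2) C2(1), of "Suc k"] by auto
  \<comment> \<open>Below this length \<open>many_large_correlations\<close> does not apply, and
    \<open>C\<close> is large enough to make the conclusion trivial.\<close>
  define M0 where "M0 = nat \<lceil>4 / \<epsilon>\<^sup>2\<rceil>"
  have M0: "4 / \<epsilon>\<^sup>2 \<le> M0" unfolding M0_def by (rule real_nat_ceiling_ge)
  define C where "C = C2 + C3 + M0 ^ Suc k"
  show ?case
  proof (intro exI[of _ C] conjI allI impI)
    show "C \<ge> 1" using C2(1) unfolding C_def by simp
    fix c :: "nat \<Rightarrow> real" and M :: nat
    assume M: "M \<ge> 1" and "\<epsilon>0 * real M \<le> norm (\<Sum>x<M. unit_exp (phase (Suc k) c x))"
    then have large: "\<epsilon> * real M \<le> norm (\<Sum>x<M. unit_exp (phase (Suc k) c x))"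
      using mult_right_mono[OF \<epsilon>(3), of "real M"] by linarith
    show "\<exists>q\<in>{1..C}. \<forall>j\<in>{1..Suc k}. near (real C / real M ^ j) (real q * c j)"
    proof (cases "M < M0")
      case True
      have "near (C / real M ^ j) (1 * c j)" if "j \<in> {1..Suc k}" for j
      proof (rule near_one)
        have "M ^ j \<le> M ^ Suc k" using that M by (intro power_increasing) auto
        also have "\<dots> \<le> M0 ^ Suc k" using True by (intro power_mono) auto
        also have "\<dots> \<le> C" unfolding C_def by simp
        finally have "real (M ^ j) \<le> real C" by (simp only: of_nat_le_iff)
        then show "1 \<le> real C / real M ^ j" using M by simp
      qed
      then show ?thesis using \<open>C \<ge> 1\<close> by (intro bexI[of _ 1]) auto
    next
      case False
      define f where "f x = unit_exp (phase (Suc k) c x)" for x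
      have corr: "f (x + h) * cnj (f x) = unit_exp (phase k (diff_coeff (Suc k) c h) x)" for x h
        unfolding f_def phase_diff[symmetric] by (simp add: unit_exp_minus[symmetric] unit_exp_add[symmetric])
      define H where "H = {h\<in>{1..<M}. \<eta> * real M \<le> norm (\<Sum>x<M - h. f (x + h) * cnj (f x))}"
      have H: "\<eta> * real M \<le> card H"
        unfolding H_def \<eta>_def
      proof (rule many_large_correlations)
        show "4 / \<epsilon>\<^sup>2 \<le> real M" using False M0 by linarith
        show "\<epsilon> * real M \<le> norm (\<Sum>x<M. f x)" using large unfolding f_def .
      qed (use \<epsilon> in \<open>auto simp: f_def\<close>)
      have "near (C0 / real M ^ j) (Q * diff_coeff (Suc k) c h j)" if h: "h \<in> H" and j: "j \<in> {1..k}" for h j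
      proof -
        have hM: "1 \<le> h" "h < M" and big: "\<eta> * real M \<le> norm (\<Sum>x<M - h. f (x + h) * cnj (f x))"
          using h unfolding H_def by auto
        have "\<eta> * real (M - h) \<le> \<eta> * real M" using \<eta> by (intro mult_left_mono) auto
        then have "\<eta> * real (M - h) \<le> norm (\<Sum>x<M - h. unit_exp (phase k (diff_coeff (Suc k) c h) x))"
          using big unfolding corr by linarith
        then obtain q where q: "q \<in> {1..C1}"
          "near (real C1 / real (M - h) ^ j) (real q * diff_coeff (Suc k) c h j)"
          using C1(2)[of "M - h"] hM j by fastforce
        \<comment> \<open>A sum of M - h numbers of modulus 1 could not reach \<eta> M
          otherwise.\<close>
        have Mh: "\<eta> * M \<le> real (M - h)"
        proof -
          have "norm (\<Sum>x<M - h. f (x + h) * cnj (f x)) \<le> (\<Sum>x<M - h. norm (f (x + h) * cnj (f x)))"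
            by (rule norm_sum)
          also have "\<dots> = real (M - h)" by (simp add: norm_mult f_def)
          finally show ?thesis using big by linarith
        qed
        have "q dvd Q" using q(1) unfolding Q_def by (intro dvd_fact) auto
        then obtain r where r: "Q = q * r" by blast
        have rQ: "r \<le> Q" using r q(1) by simp
        have "near (r * (real C1 / real (M - h) ^ j)) (r * (real q * diff_coeff (Suc k) c h j))"
          by (rule near_mult_nat[OF q(2)])
        then have "near (r * (real C1 / real (M - h) ^ j)) (Q * diff_coeff (Suc k) c h j)"
          unfolding r by (simp add: mult_ac)
        then show ?thesis
        proof (rule near_mono)
          have "\<eta> ^ k * real M ^ j \<le> \<eta> ^ j * real M ^ j"
            using j \<eta> by (intro mult_right_mono power_decreasing) auto
          also have "\<dots> = (\<eta> * M) ^ j" by (simp add: power_mult_distrib)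
          also have "\<dots> \<le> real (M - h) ^ j" using Mh \<eta> by (intro power_mono) auto
          finally have "C1 / real (M - h) ^ j \<le> C1 / (\<eta> ^ k * real M ^ j)"
            using \<eta> M hM by (intro divide_left_mono) auto
          then have "r * (C1 / real (M - h) ^ j) \<le> Q * (C1 / (\<eta> ^ k * real M ^ j))"
            using rQ \<eta> by (intro mult_mono) auto
          also have "\<dots> = (Q * C1 / \<eta> ^ k) / real M ^ j" by simp
          also have "\<dots> \<le> C0 / real M ^ j" using C0 by (intro divide_right_mono) auto
          finally show "r * (real C1 / real (M - h) ^ j) \<le> C0 / real M ^ j" .
        qed
      qed
      then have "\<exists>q\<in>{1..C2}. \<forall>i\<in>{2..Suc k}. near (real C2 / real M ^ i) (real q * c i)"
        using M H by (intro C2(2)[of M H]) (auto simp: H_def)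
      then obtain q where q: "q \<in> {1..C2}" "\<forall>i\<in>{2..Suc k}. near (real C2 / real M ^ i) (real q * c i)"
        by blast
      have lin: "near (real C3 / real M) (real q * c 1)" by (rule C3(2)[OF M q large])
      have "near (C / real M ^ j) (q * c j)" if j: "j \<in> {1..Suc k}" for j
      proof (cases "j = 1")
        case True
        have "real C3 / M \<le> C / M" unfolding C_def by (intro divide_right_mono) auto
        then show ?thesis using lin True by (auto intro: near_mono)
      next
        case False
        have "real C2 / real M ^ j \<le> C / real M ^ j" unfolding C_def by (intro divide_right_mono) auto
        moreover have "near (real C2 / real M ^ j) (real q * c j)" using q(2) j False by auto
        ultimately show ?thesis by (auto intro: near_mono)
      qed
      moreover have "q \<in> {1..C}" using q(1) unfolding C_def by auto
      ultimately show ?thesis by blast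
    qed
  qed
qed

section \<open>Counting differences by characters\<close>

lemma unit_exp_eq_1_iff: "unit_exp t = 1 \<longleftrightarrow> t \<in> \<int>"
proof
  assume "unit_exp t = 1"
  then show "t \<in> \<int>" using near_norm_unit_exp_minus_one[of t] unfolding near_def by auto
qed (auto elim!: Ints_cases)

lemma sum_unit_exp_multiples:
  fixes m :: int
  assumes P: "P > 0"
  shows "(\<Sum>j<P. unit_exp (real j * (of_int m / real P))) = (if int P dvd m then of_nat P else 0)"
proof (cases "int P dvd m")
  case True
  then obtain n where "m = int P * n" ..
  then have "real j * (of_int m / real P) = of_int (int j * n)" for j using P by simp
  then show ?thesis using True by (simp del: of_int_mult)
next
  case False
  define z where "z = unit_exp (of_int m / real P)"
  have "of_int m / real P \<notin> \<int>"
  proof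
    assume "of_int m / real P \<in> \<int>"
    then obtain n where "of_int m / real P = of_int n" by (auto elim!: Ints_cases)
    then have "real_of_int m = real_of_int (int P * n)" using P by (simp add: field_simps)
    then have "m = int P * n" by (simp only: of_int_eq_iff)
    then show False using False by simp
  qed
  then have "z \<noteq> 1" unfolding z_def unit_exp_eq_1_iff .
  moreover have "z ^ P = 1" unfolding z_def unit_exp_power using P by simp
  ultimately have "(\<Sum>j<P. z ^ j) = 0" by (simp add: geometric_sum)
  then show ?thesis using False unfolding z_def unit_exp_power by simp
qed

text \<open>Differences are counted modulo \<open>P\<close> so that the Fourier identity is a finite
  sum over the characters of Z/P.\<close>

definition cyclic_count :: "nat \<Rightarrow> int set \<Rightarrow> int \<Rightarrow> nat" where
  "cyclic_count P A v = card {(a, a') \<in> A \<times> A. int P dvd v - (a - a')}"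

lemma sum_unit_exp_weighted:
  assumes P: "P > 0" and A: "finite A"
  shows "(\<Sum>j<P. of_real ((norm (\<Sum>a\<in>A. unit_exp (- (real j * (of_int a / real P)))))\<^sup>2) *
       unit_exp (real j * (of_int v / real P))) = of_nat (P * cyclic_count P A v)"
proof -
  have "(\<Sum>j<P. of_real ((norm (\<Sum>a\<in>A. unit_exp (- (real j * (of_int a / real P)))))\<^sup>2) *
       unit_exp (real j * (of_int v / real P))) =
     (\<Sum>j<P. \<Sum>(a, a')\<in>A \<times> A. unit_exp (real j * (of_int (v - (a - a')) / real P)))"
  proof (rule sum.cong[OF refl])
    fix j
    have "of_real ((norm (\<Sum>a\<in>A. unit_exp (- (real j * (of_int a / real P)))))\<^sup>2) =
        (\<Sum>a\<in>A. unit_exp (- (real j * (of_int a / real P)))) * (\<Sum>a'\<in>A. unit_exp (real j * (of_int a' / real P)))"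
      unfolding complex_norm_square by (simp add: unit_exp_minus)
    also have "\<dots> = (\<Sum>(a, a')\<in>A \<times> A. unit_exp (- (real j * (of_int a / real P))) * unit_exp (real j * (of_int a' / real P)))"
      by (simp add: sum_product sum.cartesian_product)
    finally have "of_real ((norm (\<Sum>a\<in>A. unit_exp (- (real j * (of_int a / real P)))))\<^sup>2) *
        unit_exp (real j * (of_int v / real P)) = (\<Sum>x\<in>A \<times> A. (unit_exp (- (real j * (of_int (fst x) / real P))) *
        unit_exp (real j * (of_int (snd x) / real P))) * unit_exp (real j * (of_int v / real P)))"
      by (simp only: sum_distrib_right case_prod_unfold)
    also have "\<dots> = (\<Sum>(a, a')\<in>A \<times> A. unit_exp (real j * (of_int (v - (a - a')) / real P)))"
      unfolding unit_exp_add[symmetric] case_prod_unfold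
      by (intro sum.cong refl arg_cong[where f = unit_exp])
        (simp add: algebra_simps diff_divide_distrib add_divide_distrib)
    finally show "of_real ((norm (\<Sum>a\<in>A. unit_exp (- (real j * (of_int a / real P)))))\<^sup>2) *
       unit_exp (real j * (of_int v / real P)) =
       (\<Sum>(a, a')\<in>A \<times> A. unit_exp (real j * (of_int (v - (a - a')) / real P)))" .
  qed
  also have "\<dots> = (\<Sum>(a, a')\<in>A \<times> A. \<Sum>j<P. unit_exp (real j * (of_int (v - (a - a')) / real P)))"
    unfolding case_prod_unfold by (rule sum.swap)
  also have "\<dots> = (\<Sum>(a, a')\<in>A \<times> A. if int P dvd v - (a - a') then of_nat P else 0)"
    unfolding sum_unit_exp_multiples[OF P] ..
  also have "\<dots> = of_nat (P * cyclic_count P A v)"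
  proof -
    have "{(a, a') \<in> A \<times> A. int P dvd v - (a - a')} = (A \<times> A) \<inter> {x. int P dvd v - (fst x - snd x)}"
      by auto
    then show ?thesis unfolding cyclic_count_def using A
      by (simp add: case_prod_unfold sum.If_cases)
  qed
  finally show ?thesis .
qed

text \<open>The Fourier weights \<open>S j\<close> and the sums T_j + \<kappa> are nonnegative, so
  frequency 0 alone gives a lower bound. By Parseval, the added \<kappa> costs \<kappa> times the
  count at 0.\<close>

lemma weighted_count_ge:
  fixes w :: "'i \<Rightarrow> real" and v :: "'i \<Rightarrow> int"
  assumes P: "P > 0" and A: "finite A" and I: "finite I" and w: "sum w I = 1" and \<kappa>: "\<kappa> \<ge> 0"
    and low: "\<And>j. j < P \<Longrightarrow> - \<kappa> \<le> (\<Sum>i\<in>I. w i * Re (unit_exp (real j * (of_int (v i) / real P))))"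
  shows "(real (card A))\<^sup>2 / real P - \<kappa> * real (cyclic_count P A 0) \<le>
     (\<Sum>i\<in>I. w i * real (cyclic_count P A (v i)))"
proof -
  define S where "S j = (norm (\<Sum>a\<in>A. unit_exp (- (real j * (of_int a / real P)))))\<^sup>2" for j
  define T where "T j = (\<Sum>i\<in>I. w i * Re (unit_exp (real j * (of_int (v i) / real P))))" for j
  have count: "(\<Sum>j<P. S j * Re (unit_exp (real j * (of_int u / real P)))) = P * cyclic_count P A u" for u
    using arg_cong[OF sum_unit_exp_weighted[OF P A, of u], of Re] unfolding S_def by simp
  have S0: "(\<Sum>j<P. S j) = P * cyclic_count P A 0" using count[of 0] by simp
  have "(\<Sum>j<P. S j * T j) = (\<Sum>j<P. \<Sum>i\<in>I. w i * (S j * Re (unit_exp (real j * (of_int (v i) / real P)))))"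
    unfolding T_def by (simp add: sum_distrib_left mult_ac)
  also have "\<dots> = (\<Sum>i\<in>I. \<Sum>j<P. w i * (S j * Re (unit_exp (real j * (of_int (v i) / real P)))))"
    by (rule sum.swap)
  also have "\<dots> = P * (\<Sum>i\<in>I. w i * cyclic_count P A (v i))"
    unfolding sum_distrib_left[symmetric] count by (simp add: sum_distrib_left mult_ac)
  finally have ST: "(\<Sum>j<P. S j * T j) = P * (\<Sum>i\<in>I. w i * cyclic_count P A (v i))" .
  have "S 0 * (T 0 + \<kappa>) \<le> (\<Sum>j<P. S j * (T j + \<kappa>))"
  proof (rule member_le_sum)
    fix j assume "j \<in> {..<P} - {0}"
    then have "T j + \<kappa> \<ge> 0" using low[of j] unfolding T_def by auto
    then show "0 \<le> S j * (T j + \<kappa>)" unfolding S_def by simp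
  qed (use P in auto)
  also have "\<dots> = P * (\<Sum>i\<in>I. w i * cyclic_count P A (v i)) + \<kappa> * (P * cyclic_count P A 0)"
    unfolding distrib_left sum.distrib ST sum_distrib_right[symmetric] S0 by simp
  finally have "S 0 * (T 0 + \<kappa>) \<le> P * (\<Sum>i\<in>I. w i * cyclic_count P A (v i)) + \<kappa> * (P * cyclic_count P A 0)" .
  moreover have "S 0 = (real (card A))\<^sup>2" "T 0 = 1" unfolding S_def T_def using w by simp_all
  moreover have "(real (card A))\<^sup>2 * 1 \<le> (real (card A))\<^sup>2 * (1 + \<kappa>)" using \<kappa> by (intro mult_left_mono) auto
  ultimately have "(real (card A))\<^sup>2 \<le> P * ((\<Sum>i\<in>I. w i * cyclic_count P A (v i)) + \<kappa> * cyclic_count P A 0)"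
    by (simp add: algebra_simps)
  then show ?thesis using P by (simp add: field_simps)
qed

text \<open>v - (a - a') has absolute value below 2 N, so there is no wraparound. This explains the
  modulus 2 N.\<close>

lemma cyclic_count_eq:
  fixes N :: nat
  assumes "A \<subseteq> {1..int N}" "0 \<le> v" "v \<le> int N" "N > 0"
  shows "cyclic_count (2 * N) A v = card {(a, a') \<in> A \<times> A. a - a' = v}"
proof -
  have "int (2 * N) dvd v - (a - a') \<longleftrightarrow> a - a' = v" if "a \<in> A" "a' \<in> A" for a a'
  proof
    assume dvd: "int (2 * N) dvd v - (a - a')"
    have "a \<in> {1..int N}" "a' \<in> {1..int N}" using that assms(1) by auto
    then have "\<bar>v - (a - a')\<bar> < int (2 * N)" using assms(2-) by auto
    then show "a - a' = v" using dvd_imp_le_int[OF _ dvd] by fastforce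
  qed auto
  then show ?thesis unfolding cyclic_count_def by (intro arg_cong[where f = card]) auto
qed

lemma card_differences_le:
  fixes A :: "int set"
  assumes "finite A"
  shows "card {(a, a') \<in> A \<times> A. a - a' = v} \<le> card A"
proof -
  have "inj_on fst {(a, a') \<in> A \<times> A. a - a' = v}" by (auto simp: inj_on_def)
  then have "card {(a, a') \<in> A \<times> A. a - a' = v} = card (fst ` {(a, a') \<in> A \<times> A. a - a' = v})"
    by (simp add: card_image)
  also have "\<dots> \<le> card A" using assms by (intro card_mono) auto
  finally show ?thesis .
qed

text \<open>Since \<open>c k\<close> divides \<open>c j * b k\<close> for all \<open>j\<close>, it divides \<open>G * b k\<close>; this replaces bounds on
  complete exponential sums modulo \<open>q\<close>.\<close>

lemma near_of_near_coeffs: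
  fixes c :: "nat \<Rightarrow> int" and G C M q k :: nat and \<theta> S :: real
  assumes k: "k \<ge> 1" and ck: "c k > 0" and M: "M \<ge> 1"
    and content: "\<And>t::nat. t > 0 \<Longrightarrow> \<forall>j\<in>{1..k}. int t dvd c j \<Longrightarrow> t dvd G"
    and nr: "\<forall>j\<in>{1..k}. near (C / real M ^ j) (q * (\<theta> * of_int (c j)))"
    and S: "\<And>j. j \<in> {1..k} \<Longrightarrow> \<bar>real_of_int (c j)\<bar> \<le> S" "2 * S * C < M"
  shows "near (G * C / (of_int (c k) * real M ^ k)) (q * G * \<theta>)"
proof -
  have "\<forall>j\<in>{1..k}. \<exists>b::int. \<bar>q * (\<theta> * of_int (c j)) - b\<bar> \<le> C / real M ^ j" using nr unfolding near_def .
  then obtain b :: "nat \<Rightarrow> int" where b: "\<And>j. j \<in> {1..k} \<Longrightarrow> \<bar>q * (\<theta> * of_int (c j)) - b j\<bar> \<le> C / real M ^ j"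
    by metis
  have S0: "S \<ge> 0" using S(1)[of k] k by auto
  have CM: "C / real M ^ j \<le> C / M" if "j \<in> {1..k}" for j
  proof (rule divide_left_mono)
    show "real M \<le> real M ^ j" using M that by (intro self_le_power) auto
  qed (use M in auto)
  \<comment> \<open>Both products are integers, and they differ by less than 1 because q \<theta>
    c_j is close to b_j and the coefficients are small against \<open>M\<close>.\<close>
  have cross: "c j * b k = c k * b j" if j: "j \<in> {1..k}" for j
  proof -
    have kk: "k \<in> {1..k}" using k by simp
    have "of_int (c k * b j - c j * b k) =
       of_int (c j) * (q * (\<theta> * of_int (c k)) - b k) - of_int (c k) * (q * (\<theta> * of_int (c j)) - b j)"
      by (simp add: algebra_simps)
    then have "\<bar>of_int (c k * b j - c j * b k)\<bar> \<le>
       \<bar>of_int (c j) * (q * (\<theta> * of_int (c k)) - b k)\<bar> + \<bar>of_int (c k) * (q * (\<theta> * of_int (c j)) - b j)\<bar>"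
      by (metis abs_triangle_ineq4)
    also have "\<dots> \<le> S * (C / M) + S * (C / M)"
      unfolding abs_mult
    proof (intro add_mono mult_mono)
      show "\<bar>q * (\<theta> * of_int (c k)) - b k\<bar> \<le> C / M" using b[OF kk] CM[OF kk] by linarith
      show "\<bar>q * (\<theta> * of_int (c j)) - b j\<bar> \<le> C / M" using b[OF j] CM[OF j] by linarith
    qed (use S(1) j kk S0 in auto)
    also have "\<dots> < 1" using S(2) M by (simp add: field_simps)
    finally have "\<bar>c k * b j - c j * b k\<bar> < 1" by linarith
    then show ?thesis by linarith
  qed
  \<comment> \<open>c_k / g is the denominator of b_k / c_k in lowest terms. The cross relation
    forces it to divide every c_j, hence \<open>G\<close>.\<close>
  define g where "g = gcd (c k) (b k)"
  have g0: "g > 0" unfolding g_def using ck by simp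
  obtain t where t: "c k = g * t" unfolding g_def by (meson gcd_dvd1 dvdE)
  obtain b' where b': "b k = g * b'" unfolding g_def by (meson gcd_dvd2 dvdE)
  have t0: "t > 0" using t ck g0 by (simp add: zero_less_mult_iff)
  have "coprime t b'"
    using div_gcd_coprime[of "c k" "b k"] ck t b' g0 t0 unfolding g_def[symmetric] by simp
  have "t dvd c j" if j: "j \<in> {1..k}" for j
  proof -
    have "g * (c j * b') = g * (t * b j)" using cross[OF j] unfolding t b' by (simp add: mult_ac)
    then have "c j * b' = t * b j" using g0 by simp
    then have "t dvd c j * b'" by simp
    then show ?thesis using \<open>coprime t b'\<close> by (simp add: coprime_dvd_mult_left_iff)
  qed
  then have "nat t dvd G" using t0 by (intro content) auto
  then have "t dvd int G" using t0 by (simp add: nat_dvd_iff)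
  then have "c k dvd G * b k" unfolding t b' by (simp add: mult_dvd_mono mult.commute mult.left_commute)
  then obtain n where n: "G * b k = c k * n" ..
  \<comment> \<open>Division by \<open>c k\<close> improves the approximation by that factor, on
    which the later comparison of scales relies.\<close>
  have "of_int (c k) * (q * G * \<theta> - n) = G * (q * (\<theta> * of_int (c k)) - b k)"
  proof -
    have "real G * of_int (b k) = of_int (c k) * of_int n" using n by (metis of_int_mult of_int_of_nat_eq)
    then show ?thesis by (simp add: algebra_simps)
  qed
  then have "of_int (c k) * \<bar>q * G * \<theta> - n\<bar> = G * \<bar>q * (\<theta> * of_int (c k)) - b k\<bar>"
    using ck by (metis abs_mult abs_of_nat abs_of_pos of_int_0_less_iff)
  also have "\<dots> \<le> G * (C / real M ^ k)" using b[of k] k by (intro mult_left_mono) auto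
  finally have "\<bar>q * G * \<theta> - n\<bar> \<le> G * C / (of_int (c k) * real M ^ k)"
    using ck M by (simp add: field_simps)
  then show ?thesis unfolding near_def by blast
qed

section \<open>Size of values and coefficients of integer polynomials\<close>

lemma abs_coeff_pcompose_linear_le:
  fixes h :: "int poly"
  assumes "\<bar>r\<bar> \<le> d"
  shows "\<bar>Polynomial.coeff (pcompose h [:r, d:]) j\<bar> \<le> poly (map_poly abs h) (2 * d)"
proof (induction h arbitrary: j)
  case (pCons a h)
  have d0: "d \<ge> 0" using assms by linarith
  have IH0: "0 \<le> poly (map_poly abs h) (2 * d)" using pCons.IH[of 0] by linarith
  \<comment> \<open>One Horner step: multiplication by r + d X enlarges a coefficient bound by a
    factor of at most 2 d.\<close>
  have split: "\<bar>Polynomial.coeff ([:r, d:] * Q) j\<bar> \<le> 2 * d * K"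
    if Q: "\<And>j. \<bar>Polynomial.coeff Q j\<bar> \<le> K" for Q and K :: int
  proof -
    have K: "K \<ge> 0" using Q[of 0] by linarith
    have "Polynomial.coeff ([:r, d:] * Q) j = r * Polynomial.coeff Q j + (case j of 0 \<Rightarrow> 0 | Suc i \<Rightarrow> d * Polynomial.coeff Q i)"
      by (simp add: coeff_pCons split: nat.splits)
    also have "\<bar>\<dots>\<bar> \<le> \<bar>r * Polynomial.coeff Q j\<bar> + \<bar>case j of 0 \<Rightarrow> 0 | Suc i \<Rightarrow> d * Polynomial.coeff Q i\<bar>"
      by (rule abs_triangle_ineq)
    also have "\<bar>r * Polynomial.coeff Q j\<bar> \<le> d * K"
      unfolding abs_mult using assms Q d0 by (intro mult_mono) auto
    also have "\<bar>case j of 0 \<Rightarrow> 0 | Suc i \<Rightarrow> d * Polynomial.coeff Q i\<bar> \<le> d * K"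
      using d0 K Q by (auto simp: abs_mult intro!: mult_left_mono split: nat.splits)
    finally show ?thesis by (simp add: algebra_simps)
  qed
  have "\<bar>Polynomial.coeff (pcompose (pCons a h) [:r, d:]) j\<bar> \<le>
      \<bar>Polynomial.coeff [:a:] j\<bar> + \<bar>Polynomial.coeff ([:r, d:] * pcompose h [:r, d:]) j\<bar>"
    unfolding pcompose_pCons coeff_add by (rule abs_triangle_ineq)
  also have "\<bar>Polynomial.coeff [:a:] j\<bar> \<le> \<bar>a\<bar>" by (simp add: coeff_pCons split: nat.splits)
  also have "\<bar>Polynomial.coeff ([:r, d:] * pcompose h [:r, d:]) j\<bar> \<le> 2 * d * poly (map_poly abs h) (2 * d)"
    by (intro split pCons.IH)
  finally show ?case by (simp add: map_poly_pCons)
qed simp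

lemma abs_poly_le:
  fixes h :: "int poly"
  assumes "\<bar>x\<bar> \<le> y" "y \<ge> 1"
  shows "\<bar>poly h x\<bar> \<le> poly (map_poly abs h) 1 * y ^ Polynomial.degree h"
proof -
  have "\<bar>poly h x\<bar> \<le> (\<Sum>i\<le>Polynomial.degree h. \<bar>Polynomial.coeff h i * x ^ i\<bar>)"
    unfolding poly_altdef by (rule sum_abs)
  also have "\<dots> \<le> (\<Sum>i\<le>Polynomial.degree h. \<bar>Polynomial.coeff h i\<bar> * y ^ Polynomial.degree h)"
  proof (rule sum_mono)
    fix i assume i: "i \<in> {..Polynomial.degree h}"
    have "\<bar>x\<bar> ^ i \<le> y ^ i" using assms by (intro power_mono) auto
    also have "\<dots> \<le> y ^ Polynomial.degree h" using assms i by (intro power_increasing) auto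
    finally show "\<bar>Polynomial.coeff h i * x ^ i\<bar> \<le> \<bar>Polynomial.coeff h i\<bar> * y ^ Polynomial.degree h"
      unfolding abs_mult power_abs by (intro mult_left_mono) auto
  qed
  also have "\<dots> = (\<Sum>i\<le>Polynomial.degree h. \<bar>Polynomial.coeff h i\<bar>) * y ^ Polynomial.degree h"
    by (simp add: sum_distrib_right)
  also have "(\<Sum>i\<le>Polynomial.degree h. \<bar>Polynomial.coeff h i\<bar>) = poly (map_poly abs h) 1"
    by (simp add: poly_altdef coeff_map_poly degree_map_poly)
  finally show ?thesis .
qed

lemma poly_abs_le:
  fixes h :: "int poly"
  assumes "y \<ge> 1"
  shows "poly (map_poly abs h) y \<le> poly (map_poly abs h) 1 * y ^ Polynomial.degree h"
proof -
  have "poly (map_poly abs (map_poly abs h)) 1 = poly (map_poly abs h) 1"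
    by (simp add: map_poly_map_poly o_def)
  then show ?thesis using abs_poly_le[of y y "map_poly abs h"] assms by (simp add: degree_map_poly)
qed

text \<open>The leading term is at least y^(m+1) and outweighs the others once y is at least twice
  the sum of the absolute values of the coefficients.\<close>

lemma poly_ge_half_power:
  fixes p :: "int poly"
  assumes deg: "Polynomial.degree p = Suc m" and lead: "Polynomial.lead_coeff p \<ge> 1"
    and y: "y \<ge> 1" "2 * poly (map_poly abs p) 1 \<le> y"
  shows "y ^ Suc m \<le> 2 * poly p y"
proof -
  define K where "K = poly (map_poly abs p) 1"
  have K: "(\<Sum>i\<le>m. \<bar>Polynomial.coeff p i\<bar>) \<le> K"
    unfolding K_def by (simp add: poly_altdef coeff_map_poly degree_map_poly deg)
  have "- (\<Sum>i\<le>m. Polynomial.coeff p i * y ^ i) \<le> (\<Sum>i\<le>m. \<bar>Polynomial.coeff p i\<bar> * y ^ m)"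
    unfolding sum_negf[symmetric]
  proof (rule sum_mono)
    fix i assume "i \<in> {..m}"
    then have "y ^ i \<le> y ^ m" using y by (intro power_increasing) auto
    then have "\<bar>Polynomial.coeff p i\<bar> * y ^ i \<le> \<bar>Polynomial.coeff p i\<bar> * y ^ m" by (intro mult_left_mono) auto
    moreover have "- (Polynomial.coeff p i * y ^ i) \<le> \<bar>Polynomial.coeff p i\<bar> * y ^ i"
      using y by (simp add: abs_mult[symmetric] flip: mult_minus_left)
    ultimately show "- (Polynomial.coeff p i * y ^ i) \<le> \<bar>Polynomial.coeff p i\<bar> * y ^ m" by linarith
  qed
  also have "\<dots> \<le> K * y ^ m"
    unfolding sum_distrib_right[symmetric] using K y by (intro mult_right_mono) auto
  finally have low: "- (\<Sum>i\<le>m. Polynomial.coeff p i * y ^ i) \<le> K * y ^ m" .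
  have "poly p y = Polynomial.lead_coeff p * y ^ Suc m + (\<Sum>i\<le>m. Polynomial.coeff p i * y ^ i)"
    unfolding poly_altdef deg by simp
  moreover have "1 * y ^ Suc m \<le> Polynomial.lead_coeff p * y ^ Suc m"
    using lead y by (intro mult_right_mono) auto
  moreover have "2 * K * y ^ m \<le> y * y ^ m"
    using y unfolding K_def by (intro mult_right_mono) auto
  ultimately show ?thesis using low by simp
qed

section \<open>Scales\<close>

text \<open>\<open>Z\<close> is the argument size at which the bound \<open>H * Z ^ k / l W\<close>
  for h_W equals N, which keeps the values at every scale in [1, N]. \<open>large\<close> makes the
  intervals longer than the coefficients of h_d by the factor that
  \<open>near_of_near_coeffs\<close> demands. The last condition on \<open>\<rho>\<close> lets one
  step between scales beat the error in \<open>near_at_later_scale\<close>. The Weyl bound is taken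
  at \<epsilon> / 4 because it concerns initial segments rather than the intervals [M, 2 M).\<close>

locale scales =
  fixes h :: "int poly" and k G C N W J B :: nat and \<epsilon> \<rho> Z :: real and H :: int
    and l :: "nat \<Rightarrow> nat" and r :: "nat \<Rightarrow> int"
  assumes deg: "Polynomial.degree h = k" and k: "k \<ge> 1"
    and lead: "Polynomial.lead_coeff h \<ge> 1"
    and pos: "\<And>y. y \<ge> 0 \<Longrightarrow> poly h y > 0"
    and arith: "arith_data h G l r" and G: "G > 0"
    and weyl: "\<And>c M. M \<ge> 1 \<Longrightarrow> \<epsilon> / 4 * real M \<le> norm (\<Sum>x<M. unit_exp (phase k c x)) \<Longrightarrow>
      \<exists>q\<in>{1..C}. \<forall>j\<in>{1..k}. near (real C / real M ^ j) (real q * c j)"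
    and C: "C \<ge> 1" and \<epsilon>: "0 < \<epsilon>" "\<epsilon> \<le> 1" and W: "W > 0" and N: "N > 0"
    and H: "H = poly (map_poly abs h) 1"
    and B: "B = G * fact C"
    and \<rho>: "0 < \<rho>" "\<rho> \<le> 1" "8 * \<rho> * real G * real C * 4 ^ k * real_of_int H \<le> \<epsilon>"
    and Z: "Z > 0" "Z ^ k = real N * real (l W) / real_of_int H"
    and large: "\<And>i. i < J \<Longrightarrow> 8 * 2 ^ k * real_of_int H * real C * real (W * B ^ i) ^ (k + 1) < \<rho> ^ i * Z"
begin

definition d :: "nat \<Rightarrow> nat" where "d i = W * B ^ i"

text \<open>As r_d \<le> 0, this length keeps r_d + d x at most \<rho>^i Z for all x < 2 M.\<close>

definition M :: "nat \<Rightarrow> nat" where "M i = nat \<lfloor>\<rho> ^ i * Z / (2 * real (d i))\<rfloor>"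

definition g :: "nat \<Rightarrow> int poly" where
  "g i = (SOME g. pcompose h [:r (d i), int (d i):] = Polynomial.smult (int (l (d i))) g \<and>
     (\<forall>t>0. (\<forall>j\<ge>1. int t dvd Polynomial.coeff g j) \<longrightarrow> t dvd G))"

text \<open>By \<open>l_W_v\<close> this is h(arg i x) / l W, a value of h_W. The factor
  \<open>l B ^ i\<close> is displayed because it is what absorbs denominators.\<close>

definition v :: "nat \<Rightarrow> nat \<Rightarrow> int" where "v i x = int (l B ^ i) * poly (g i) (int x)"

definition arg :: "nat \<Rightarrow> nat \<Rightarrow> int" where "arg i x = r (d i) + int (d i) * int x"

lemma B_pos: "B > 0"
  using G by (simp add: B)

lemma d_pos: "d i > 0"
  using W B_pos by (simp add: d_def)

lemma l_pos: "a > 0 \<Longrightarrow> l a > 0" and dvd_l: "a > 0 \<Longrightarrow> a dvd l a"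
  and r_bounds: "a > 0 \<Longrightarrow> - int a < r a" "a > 0 \<Longrightarrow> r a \<le> 0"
  and l_mult: "a > 0 \<Longrightarrow> b > 0 \<Longrightarrow> l (a * b) = l a * l b"
  and r_mult: "a > 0 \<Longrightarrow> b > 0 \<Longrightarrow> int a dvd r (a * b) - r a"
  using arith unfolding arith_data_def by auto

lemma l_d: "l (d i) = l W * l B ^ i"
proof (induction i)
  case (Suc i)
  have "d (Suc i) = d i * B" by (simp add: d_def)
  then show ?case using Suc l_mult[OF d_pos B_pos] by simp
qed (simp add: d_def)

lemma H_ge_1: "H \<ge> 1"
  using abs_poly_le[of 0 1 h] pos[of 0] by (simp add: H)

lemma g_eq: "pcompose h [:r (d i), int (d i):] = Polynomial.smult (int (l (d i))) (g i)"
  and g_content: "t > 0 \<Longrightarrow> \<forall>j\<ge>1. int t dvd Polynomial.coeff (g i) j \<Longrightarrow> t dvd G"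
proof -
  have "\<exists>g. pcompose h [:r (d i), int (d i):] = Polynomial.smult (int (l (d i))) g \<and>
     (\<forall>t>0. (\<forall>j\<ge>1. int t dvd Polynomial.coeff g j) \<longrightarrow> t dvd G)"
    using arith d_pos[of i] unfolding arith_data_def by blast
  then have *: "pcompose h [:r (d i), int (d i):] = Polynomial.smult (int (l (d i))) (g i) \<and>
     (\<forall>t>0. (\<forall>j\<ge>1. int t dvd Polynomial.coeff (g i) j) \<longrightarrow> t dvd G)"
    unfolding g_def by (rule someI_ex)
  then show "pcompose h [:r (d i), int (d i):] = Polynomial.smult (int (l (d i))) (g i)"
    "t > 0 \<Longrightarrow> \<forall>j\<ge>1. int t dvd Polynomial.coeff (g i) j \<Longrightarrow> t dvd G" by blast+
qed

lemma l_W_v: "int (l W) * v i x = poly h (arg i x)"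
proof -
  have "poly h (arg i x) = poly (pcompose h [:r (d i), int (d i):]) (int x)"
    by (simp add: poly_pcompose arg_def mult.commute)
  then show ?thesis unfolding g_eq by (simp add: v_def l_d)
qed

lemma degree_g: "Polynomial.degree (g i) = k"
proof -
  have "Polynomial.degree (pcompose h [:r (d i), int (d i):]) = k"
    using deg d_pos[of i] by (simp add: degree_pcompose)
  then show ?thesis unfolding g_eq using l_pos[OF d_pos[of i]] by simp
qed

lemma lead_coeff_g: "int (l (d i)) * Polynomial.coeff (g i) k = Polynomial.lead_coeff h * int (d i) ^ k"
proof -
  have "Polynomial.lead_coeff (pcompose h [:r (d i), int (d i):]) =
      Polynomial.lead_coeff h * Polynomial.lead_coeff [:r (d i), int (d i):] ^ Polynomial.degree h"
    using d_pos[of i] by (intro lead_coeff_comp) simp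
  moreover have "Polynomial.lead_coeff (Polynomial.smult (int (l (d i))) (g i)) = int (l (d i)) * Polynomial.coeff (g i) k"
    by (simp add: lead_coeff_smult degree_g)
  ultimately show ?thesis using d_pos[of i] deg unfolding g_eq by simp
qed

lemma coeff_g_k_pos: "Polynomial.coeff (g i) k > 0"
proof -
  have "int (l (d i)) * Polynomial.coeff (g i) k > 0"
    unfolding lead_coeff_g using lead d_pos[of i] by simp
  then show ?thesis by (simp add: zero_less_mult_iff)
qed

lemma abs_coeff_g_le: "\<bar>real_of_int (Polynomial.coeff (g i) j)\<bar> \<le> real_of_int H * (2 * real (d i)) ^ k"
proof -
  have "\<bar>Polynomial.coeff (g i) j\<bar> \<le> \<bar>int (l (d i)) * Polynomial.coeff (g i) j\<bar>"
    using l_pos[OF d_pos[of i]] by (simp add: abs_mult mult_le_cancel_right1)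
  also have "int (l (d i)) * Polynomial.coeff (g i) j = Polynomial.coeff (pcompose h [:r (d i), int (d i):]) j"
    unfolding g_eq by simp
  also have "\<bar>Polynomial.coeff (pcompose h [:r (d i), int (d i):]) j\<bar> \<le> poly (map_poly abs h) (2 * int (d i))"
    using r_bounds[OF d_pos[of i]] by (intro abs_coeff_pcompose_linear_le) auto
  also have "\<dots> \<le> H * (2 * int (d i)) ^ k"
    unfolding H deg[symmetric] using d_pos[of i] by (intro poly_abs_le) simp
  finally have "real_of_int \<bar>Polynomial.coeff (g i) j\<bar> \<le> real_of_int (H * (2 * int (d i)) ^ k)"
    by (simp only: of_int_le_iff)
  then show ?thesis by simp
qed

lemma phase_v: "\<alpha> * real_of_int (v i x) =
  phase k (\<lambda>j. \<alpha> * real (l B ^ i) * real_of_int (Polynomial.coeff (g i) j)) x"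
  unfolding phase_def v_def poly_altdef degree_g by (simp add: sum_distrib_left mult_ac)

text \<open>By \<open>large\<close>, the length before rounding exceeds four times
  \<open>H * (2 * d i) ^ k * C\<close>, a number at least 1, so rounding down loses at most
  half.\<close>

lemma M_bounds:
  assumes i: "i < J"
  shows "\<rho> ^ i * Z / (4 * real (d i)) \<le> real (M i)" "2 * real (d i) * real (M i) \<le> \<rho> ^ i * Z"
    "2 * (real_of_int H * (2 * real (d i)) ^ k) * real C < real (M i)" "M i \<ge> 2"
proof -
  define Y where "Y = \<rho> ^ i * Z / (2 * real (d i))"
  define Q where "Q = real_of_int H * (2 * real (d i)) ^ k * real C"
  have dp: "real (d i) \<ge> 1" using d_pos[of i] by linarith
  have "Q \<ge> 1 * 1 * 1" unfolding Q_def
    using dp H_ge_1 C by (intro mult_mono one_le_power) auto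
  then have Q1: "Q \<ge> 1" by simp
  have "8 * Q * real (d i) < \<rho> ^ i * Z"
    using large[OF i] unfolding Q_def d_def[symmetric] by (simp add: power_mult_distrib mult_ac)
  then have QY: "4 * Q < Y" unfolding Y_def using dp by (simp add: field_simps)
  define w where "w = \<lfloor>Y\<rfloor>"
  have w: "real_of_int w \<le> Y" "Y < real_of_int w + 1" unfolding w_def by linarith+
  have "w > 0" using w QY Q1 by linarith
  then have M: "real (M i) = real_of_int w" unfolding M_def Y_def[symmetric] w_def[symmetric] by simp
  have "real (M i) \<ge> Y / 2" "real (M i) \<le> Y" using w QY Q1 unfolding M by linarith+
  moreover have "\<rho> ^ i * Z / (4 * real (d i)) = Y / 2" unfolding Y_def by simp
  moreover have "\<rho> ^ i * Z = 2 * real (d i) * Y" unfolding Y_def using dp by simp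
  ultimately show "\<rho> ^ i * Z / (4 * real (d i)) \<le> real (M i)" "2 * real (d i) * real (M i) \<le> \<rho> ^ i * Z"
    using dp by (simp_all add: mult_left_mono)
  show "2 * (real_of_int H * (2 * real (d i)) ^ k) * real C < real (M i)"
    using \<open>real (M i) \<ge> Y / 2\<close> QY unfolding Q_def by linarith
  show "M i \<ge> 2" using \<open>real (M i) \<ge> Y / 2\<close> QY Q1 by linarith
qed

text \<open>r_d costs less than one step d, and x \<ge> M \<ge> 2 still leaves d M / 2, whence the
  factor 1/8.\<close>

lemma arg_bounds:
  assumes i: "i < J" and x: "x \<in> {M i..<2 * M i}"
  shows "1 \<le> arg i x" "real_of_int (arg i x) \<le> \<rho> ^ i * Z" "\<rho> ^ i * Z / 8 \<le> real_of_int (arg i x)"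
proof -
  have d1: "int (d i) \<ge> 1" using d_pos[of i] by simp
  have x1: "int x \<ge> 2" using x M_bounds(4)[OF i] by auto
  have "arg i x > - int (d i) + int (d i) * int x" unfolding arg_def using r_bounds(1)[OF d_pos[of i]] by simp
  then have low: "arg i x > int (d i) * (int x - 1)" by (simp add: algebra_simps)
  moreover have "int (d i) * (int x - 1) \<ge> 0" using d1 x1 by simp
  ultimately show "1 \<le> arg i x" by linarith
  have "arg i x \<le> int (d i) * int x" unfolding arg_def using r_bounds(2)[OF d_pos[of i]] by simp
  then have "real_of_int (arg i x) \<le> real_of_int (int (d i) * int x)" by (simp only: of_int_le_iff)
  also have "\<dots> \<le> real (d i) * (2 * real (M i))"
    using x by (auto intro!: mult_left_mono)
  also have "\<dots> \<le> \<rho> ^ i * Z" using M_bounds(2)[OF i] by simp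
  finally show "real_of_int (arg i x) \<le> \<rho> ^ i * Z" .
  have "\<rho> ^ i * Z / 4 \<le> real (d i) * real (M i)"
  proof -
    have "\<rho> ^ i * Z / (4 * real (d i)) * real (d i) = \<rho> ^ i * Z / 4" using d_pos[of i] by simp
    then show ?thesis using mult_right_mono[OF M_bounds(1)[OF i], of "real (d i)"]
      by (simp only: mult.commute[of "real (d i)" "real (M i)"])
  qed
  then have "\<rho> ^ i * Z / 8 \<le> real (d i) * (real (M i) / 2)"
    unfolding times_divide_eq_right by linarith
  also have "\<dots> \<le> real (d i) * (real x - 1)"
    using x M_bounds(4)[OF i] by (intro mult_left_mono) auto
  also have "\<dots> = real_of_int (int (d i) * (int x - 1))" by simp
  also have "\<dots> \<le> real_of_int (arg i x)" using low by (simp only: of_int_le_iff)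
  finally show "\<rho> ^ i * Z / 8 \<le> real_of_int (arg i x)" .
qed

lemma v_bounds:
  assumes i: "i < J" and x: "x \<in> {M i..<2 * M i}"
  shows "0 < v i x" "real_of_int (v i x) \<le> (\<rho> ^ i) ^ k * real N"
proof -
  have lW: "real (l W) > 0" using l_pos[OF W] by simp
  have "int (l W) * v i x > 0" unfolding l_W_v using arg_bounds(1)[OF i x] by (intro pos) simp
  then show "0 < v i x" by (simp add: zero_less_mult_iff)
  have "int (l W) * v i x \<le> H * arg i x ^ k"
    unfolding l_W_v H deg[symmetric] using arg_bounds(1)[OF i x]
    by (intro order_trans[OF abs_ge_self abs_poly_le]) auto
  then have "real_of_int (int (l W) * v i x) \<le> real_of_int (H * arg i x ^ k)" by (simp only: of_int_le_iff)
  then have "real (l W) * real_of_int (v i x) \<le> real_of_int H * real_of_int (arg i x) ^ k" by simp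
  also have "\<dots> \<le> real_of_int H * (\<rho> ^ i * Z) ^ k"
    using arg_bounds[OF i x] H_ge_1 by (intro mult_left_mono power_mono) auto
  also have "\<dots> = real (l W) * ((\<rho> ^ i) ^ k * real N)"
    unfolding power_mult_distrib Z(2) using H_ge_1 by simp
  finally show "real_of_int (v i x) \<le> (\<rho> ^ i) ^ k * real N"
    using lW by (simp only: mult_le_cancel_left_pos)
qed

lemma v_le_N:
  assumes "i < J" "x \<in> {M i..<2 * M i}"
  shows "v i x \<le> int N"
proof -
  have "real_of_int (v i x) \<le> (\<rho> ^ i) ^ k * real N" by (rule v_bounds(2)[OF assms])
  also have "\<dots> \<le> 1 * real N" using \<rho> by (intro mult_right_mono power_le_one) auto
  finally show ?thesis by linarith
qed

text \<open>A frequency is obstructive at one scale only: if the exponential sum at scale \<open>i\<close> is large, then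
  \<open>q * G\<close> clears the denominator of the frequency, and all finer scales see an almost constant phase.\<close>

lemma near_at_later_scale:
  assumes ii: "i < i'" "i' < J" and x: "x \<in> {M i'..<2 * M i'}"
    and big: "\<epsilon> * real (M i) \<le> norm (\<Sum>y\<in>{M i..<2 * M i}. unit_exp (\<alpha> * real_of_int (v i y)))"
  shows "near (\<epsilon> / 8) (\<alpha> * real_of_int (v i' x))"
proof -
  have i: "i < J" using ii by simp
  define \<theta> where "\<theta> = \<alpha> * real (l B ^ i)"
  define c where "c j = Polynomial.coeff (g i) j" for j
  define f where "f y = unit_exp (phase k (\<lambda>j. \<theta> * real_of_int (c j)) y)" for y
  have M2: "M i \<ge> 2" by (rule M_bounds(4)[OF i])
  have fv: "unit_exp (\<alpha> * real_of_int (v i y)) = f y" for y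
    unfolding f_def \<theta>_def c_def phase_v ..
  have split: "(\<Sum>y<2 * M i. f y) = (\<Sum>y<M i. f y) + (\<Sum>y\<in>{M i..<2 * M i}. f y)"
    unfolding lessThan_atLeast0 by (subst sum.atLeastLessThan_concat) auto
  \<comment> \<open>The sum over [M, 2 M) is a difference of two initial segments, so one of them,
    of length M or 2 M, is large enough for the Weyl bound.\<close>
  have "\<exists>L. L \<ge> M i \<and> \<epsilon> / 4 * real L \<le> norm (\<Sum>y<L. f y)"
  proof (cases "\<epsilon> / 4 * real (M i) \<le> norm (\<Sum>y<M i. f y)")
    case False
    have "norm (\<Sum>y\<in>{M i..<2 * M i}. f y) \<le> norm (\<Sum>y<2 * M i. f y) + norm (\<Sum>y<M i. f y)"
      using split norm_triangle_ineq4[of "\<Sum>y<2 * M i. f y" "\<Sum>y<M i. f y"] by simp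
    moreover have "0 \<le> \<epsilon> * real (M i)" using \<epsilon> by simp
    ultimately have "\<epsilon> / 4 * real (2 * M i) \<le> norm (\<Sum>y<2 * M i. f y)"
      using big False unfolding fv by simp
    then show ?thesis by (intro exI[of _ "2 * M i"]) simp
  qed blast
  then obtain L where L: "L \<ge> M i" "\<epsilon> / 4 * real L \<le> norm (\<Sum>y<L. f y)" by blast
  obtain q where q: "q \<in> {1..C}" "\<And>j. j \<in> {1..k} \<Longrightarrow> near (real C / real L ^ j) (real q * (\<theta> * real_of_int (c j)))"
    using weyl[of L "\<lambda>j. \<theta> * real_of_int (c j)"] L M2 unfolding f_def by auto
  have "near (real (G * C) / (real_of_int (c k) * real (M i) ^ k)) (real (q * G) * \<theta>)"
  proof (rule near_of_near_coeffs[where S = "real_of_int H * (2 * real (d i)) ^ k"])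
    show "c k > 0" unfolding c_def by (rule coeff_g_k_pos)
    fix t :: nat assume t: "t > 0" "\<forall>j\<in>{1..k}. int t dvd c j"
    have "int t dvd Polynomial.coeff (g i) j" if "j \<ge> 1" for j
      using t(2) that unfolding c_def by (cases "j \<le> k") (auto simp: coeff_eq_0 degree_g)
    then show "t dvd G" using g_content[OF t(1)] by blast
  next
    show "\<forall>j\<in>{1..k}. near (real C / real (M i) ^ j) (real q * (\<theta> * real_of_int (c j)))"
    proof
      fix j assume j: "j \<in> {1..k}"
      have "real C / real L ^ j \<le> real C / real (M i) ^ j"
        using L(1) M2 by (intro divide_left_mono power_mono) auto
      then show "near (real C / real (M i) ^ j) (real q * (\<theta> * real_of_int (c j)))"
        using q(2)[OF j] by (rule near_mono[rotated])
    qed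
  next
    show "2 * (real_of_int H * (2 * real (d i)) ^ k) * real C < real (M i)" by (rule M_bounds(3)[OF i])
  qed (use k M2 abs_coeff_g_le in \<open>auto simp: c_def\<close>)
  moreover define \<eta> where "\<eta> = real (G * C) / (real_of_int (c k) * real (M i) ^ k)"
  ultimately have n1: "near \<eta> (real (q * G) * \<theta>)" by simp
  \<comment> \<open>The factorial in \<open>B\<close> pays off: whatever q is, q G divides
    \<open>B\<close>, hence \<open>l B\<close>, hence the additional factor l(B)^(i' - i) in the
    values at scale i'.\<close>
  have "q dvd fact C" using q(1) by (intro dvd_fact) auto
  then have "q * G dvd B" unfolding B by (simp add: mult.commute mult_dvd_mono)
  also have "B dvd l B" by (rule dvd_l[OF B_pos])
  also have "l B dvd l B ^ (i' - i)" using ii by (intro dvd_power) auto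
  finally obtain t where t: "l B ^ (i' - i) = q * G * t" ..
  have lBi: "l B ^ i' = l B ^ i * (q * G * t)" unfolding t[symmetric] using ii by (simp add: power_add[symmetric])
  have lB0: "real (l B ^ i) > 0" using l_pos[OF B_pos] by simp
  define y where "y = int t * poly (g i') (int x)"
  have vy: "v i' x = int (l B ^ i) * int (q * G) * y"
    unfolding v_def y_def lBi by (simp add: mult_ac)
  have "q * G \<ge> 1" using q(1) G by (simp add: Suc_leI)
  then have qG: "int (q * G) \<ge> 1" by linarith
  have "int (l B ^ i) * int (q * G) > 0" using qG l_pos[OF B_pos] by simp
  then have y0: "y > 0" using v_bounds(1)[OF ii(2) x] unfolding vy by (simp only: zero_less_mult_pos)
  have "real (l B ^ i) * real_of_int y \<le> real_of_int (v i' x)"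
  proof -
    have "int (l B ^ i) * 1 * y \<le> int (l B ^ i) * int (q * G) * y"
      using qG y0 by (intro mult_right_mono mult_left_mono) auto
    then have "real_of_int (int (l B ^ i) * 1 * y) \<le> real_of_int (v i' x)" unfolding vy by (simp only: of_int_le_iff)
    then show ?thesis by simp
  qed
  also have "\<dots> \<le> (\<rho> ^ i') ^ k * real N" by (rule v_bounds(2)[OF ii(2) x])
  finally have yb: "real (l B ^ i) * real_of_int y \<le> (\<rho> ^ i') ^ k * real N" .
  have "near (real_of_int \<bar>y\<bar> * \<eta>) (real_of_int y * (real (q * G) * \<theta>))"
    by (rule near_mult[OF n1])
  moreover have "real_of_int y * (real (q * G) * \<theta>) = \<alpha> * real_of_int (v i' x)"
    unfolding vy \<theta>_def by simp
  ultimately have n2: "near (real_of_int y * \<eta>) (\<alpha> * real_of_int (v i' x))" using y0 by simp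
  have "real_of_int y * \<eta> \<le> \<epsilon> / 8"
  proof -
    define D where "D = real (d i) * real (M i)"
    have D: "\<rho> ^ i * Z / 4 \<le> D"
      using M_bounds(1)[OF i] d_pos[of i] unfolding D_def by (simp add: pos_divide_le_eq mult_ac)
    have \<rho>Z: "\<rho> ^ i * Z > 0" using \<rho> Z by simp
    have lW: "real (l W) > 0" using l_pos[OF W] by simp
    have Mk: "real (M i) ^ k > 0" using M2 by simp
    have ck0: "real_of_int (c k) > 0" unfolding c_def using coeff_g_k_pos[of i] by simp
    \<comment> \<open>The leading coefficient of h_d is that of \<open>h\<close> times d^k /
      \<lambda>(d), so \<lambda>(d) drops out of the final comparison.\<close>
    have ck: "real (l W) * real (l B ^ i) * real_of_int (c k) \<ge> real (d i) ^ k"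
    proof -
      have "1 * int (d i) ^ k \<le> Polynomial.lead_coeff h * int (d i) ^ k"
        using lead by (intro mult_right_mono) auto
      also have "\<dots> = int (l W * l B ^ i) * c k" unfolding lead_coeff_g[symmetric] l_d c_def ..
      finally have "real_of_int (int (d i) ^ k) \<le> real_of_int (int (l W * l B ^ i) * c k)"
        by (simp only: of_int_le_iff mult_1)
      then show ?thesis by simp
    qed
    have "(\<rho> ^ i * Z / 4) ^ k \<le> D ^ k" using D \<rho>Z by (intro power_mono) auto
    also have "\<dots> = real (d i) ^ k * real (M i) ^ k" unfolding D_def by (rule power_mult_distrib)
    also have "\<dots> \<le> real (l W) * real (l B ^ i) * real_of_int (c k) * real (M i) ^ k"
      using ck Mk by (intro mult_right_mono) auto
    finally have den: "(\<rho> ^ i * Z / 4) ^ k \<le> real (l W) * real (l B ^ i) * (real_of_int (c k) * real (M i) ^ k)"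
      by (simp add: mult_ac)
    \<comment> \<open>A later scale gains at least one factor \<rho>, because k (i' - i) \<ge> 1;
      the choice of \<rho> turns it into \<epsilon> / 8.\<close>
    have "(\<rho> ^ i') ^ k \<le> (\<rho> ^ i) ^ k * \<rho>"
    proof -
      have "(\<rho> ^ i') ^ k = (\<rho> ^ i) ^ k * (\<rho> ^ (i' - i)) ^ k"
        using ii by (simp add: power_mult_distrib[symmetric] power_add[symmetric])
      also have "(\<rho> ^ (i' - i)) ^ k \<le> \<rho> ^ 1"
        unfolding power_mult[symmetric] using ii k \<rho> by (intro power_decreasing) (auto simp: Suc_leI)
      finally show ?thesis using \<rho> by (simp add: mult_left_mono)
    qed
    then have "real (l B ^ i) * real_of_int y \<le> (\<rho> ^ i) ^ k * \<rho> * real N"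
      using yb by (meson mult_right_mono of_nat_0_le_iff order_trans)
    then have "real (l W) * (real (l B ^ i) * real_of_int y) * real (G * C) \<le>
        real (l W) * ((\<rho> ^ i) ^ k * \<rho> * real N) * real (G * C)"
      using lW by (intro mult_right_mono mult_left_mono) auto
    also have "\<dots> = \<rho> * real (G * C) * (\<rho> ^ i) ^ k * (real N * real (l W))" by simp
    also have "real N * real (l W) = real_of_int H * Z ^ k" using Z(2) H_ge_1 by simp
    also have "\<rho> * real (G * C) * (\<rho> ^ i) ^ k * (real_of_int H * Z ^ k) =
       \<rho> * real G * real C * 4 ^ k * real_of_int H * (\<rho> ^ i * Z / 4) ^ k"
      by (simp add: power_mult_distrib power_divide)
    also have "\<dots> \<le> \<epsilon> / 8 * (\<rho> ^ i * Z / 4) ^ k"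
      using \<rho>(3) \<rho>Z by (intro mult_right_mono) auto
    also have "\<dots> \<le> \<epsilon> / 8 * (real (l W) * real (l B ^ i) * (real_of_int (c k) * real (M i) ^ k))"
      using den \<epsilon> by (intro mult_left_mono) auto
    finally have "(real (l W) * real (l B ^ i)) * (real_of_int y * real (G * C)) \<le>
       (real (l W) * real (l B ^ i)) * (\<epsilon> / 8 * (real_of_int (c k) * real (M i) ^ k))"
      by (simp only: mult_ac)
    then have "real_of_int y * real (G * C) \<le> \<epsilon> / 8 * (real_of_int (c k) * real (M i) ^ k)"
      using lW lB0 by (simp only: mult_le_cancel_left_pos mult_pos_pos)
    then show ?thesis unfolding \<eta>_def times_divide_eq_right
      using ck0 Mk by (subst pos_divide_le_eq) auto
  qed
  then show ?thesis using n2 by (rule near_mono[rotated])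
qed

text \<open>Take the least scale with a large sum. Earlier scales are small by minimality, later
  ones have only terms within distance 1 of 1, hence with nonnegative real part, and the scale
  itself costs at most 1.\<close>

lemma sum_scales_Re_ge:
  "- (\<epsilon> * real J + 1) \<le>
     (\<Sum>i<J. (1 / real (M i)) * (\<Sum>x\<in>{M i..<2 * M i}. Re (unit_exp (\<alpha> * real_of_int (v i x)))))"
proof -
  define S where "S i = (\<Sum>x\<in>{M i..<2 * M i}. unit_exp (\<alpha> * real_of_int (v i x)))" for i
  define T where "T i = (1 / real (M i)) * (\<Sum>x\<in>{M i..<2 * M i}. Re (unit_exp (\<alpha> * real_of_int (v i x))))" for i
  have T: "T i = Re (S i) / real (M i)" for i unfolding T_def S_def by simp
  have M0: "real (M i) > 0" if "i < J" for i using M_bounds(4)[OF that] by simp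
  have lower: "T i \<ge> - t" if "i < J" "Re (S i) \<ge> - t * real (M i)" for i t
    unfolding T using that M0[OF that(1)] by (simp add: pos_le_divide_eq)
  have small: "T i \<ge> - \<epsilon>" if i: "i < J" "norm (S i) < \<epsilon> * real (M i)" for i
  proof (rule lower[OF i(1)])
    have "- Re (S i) \<le> norm (S i)" using abs_Re_le_cmod[of "S i"] by linarith
    then show "Re (S i) \<ge> - \<epsilon> * real (M i)" using i(2) by linarith
  qed
  have trivial: "T i \<ge> - 1" if i: "i < J" for i
  proof (rule lower[OF i])
    have "norm (S i) \<le> (\<Sum>x\<in>{M i..<2 * M i}. norm (unit_exp (\<alpha> * real_of_int (v i x))))"
      unfolding S_def by (rule norm_sum)
    then have "norm (S i) \<le> real (M i)" by simp
    then show "Re (S i) \<ge> - 1 * real (M i)" using abs_Re_le_cmod[of "S i"] by linarith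
  qed
  have "\<exists>i0. \<forall>i<J. i \<noteq> i0 \<longrightarrow> T i \<ge> - \<epsilon>"
  proof (cases "\<exists>i<J. \<epsilon> * real (M i) \<le> norm (S i)")
    case False
    then show ?thesis using small by (intro exI[of _ 0]) force
  next
    case True
    define i0 where "i0 = (LEAST i. i < J \<and> \<epsilon> * real (M i) \<le> norm (S i))"
    have i0: "i0 < J" "\<epsilon> * real (M i0) \<le> norm (S i0)"
      using LeastI_ex[OF True] unfolding i0_def by auto
    have "T i \<ge> - \<epsilon>" if i: "i < J" "i \<noteq> i0" for i
    proof (cases "i < i0")
      case True
      then have "\<not> (i < J \<and> \<epsilon> * real (M i) \<le> norm (S i))" unfolding i0_def by (rule not_less_Least)
      then show ?thesis using i small by auto
    next
      case False
      then have ii: "i0 < i" using i by simp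
      have "0 \<le> Re (unit_exp (\<alpha> * real_of_int (v i x)))" if x: "x \<in> {M i..<2 * M i}" for x
      proof -
        have "near (\<epsilon> / 8) (\<alpha> * real_of_int (v i x))"
          using near_at_later_scale[OF ii i(1) x] i0(2) unfolding S_def by blast
        then have "norm (unit_exp (\<alpha> * real_of_int (v i x)) - 1) \<le> 2 * pi * (\<epsilon> / 8)"
          by (rule norm_unit_exp_minus_one_le)
        also have "\<dots> \<le> 2 * 4 * (\<epsilon> / 8)" using pi_less_4 \<epsilon> by (intro mult_right_mono) auto
        also have "\<dots> \<le> 1" using \<epsilon> by simp
        finally show ?thesis using abs_Re_le_cmod[of "unit_exp (\<alpha> * real_of_int (v i x)) - 1"] by simp
      qed
      then have "0 \<le> T i" unfolding T_def by (intro mult_nonneg_nonneg sum_nonneg) auto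
      then show ?thesis using \<epsilon> by linarith
    qed
    then show ?thesis by blast
  qed
  then obtain i0 where i0: "\<And>i. i < J \<Longrightarrow> i \<noteq> i0 \<Longrightarrow> T i \<ge> - \<epsilon>" by blast
  have "(\<Sum>i<J. - \<epsilon> - (if i = i0 then 1 else 0)) \<le> (\<Sum>i<J. T i)"
  proof (rule sum_mono)
    fix i assume i: "i \<in> {..<J}"
    show "- \<epsilon> - (if i = i0 then 1 else 0) \<le> T i"
      using i0[of i] trivial[of i] i \<epsilon> by (cases "i = i0") auto
  qed
  moreover have "(\<Sum>i<J. - \<epsilon> - (if i = i0 then 1 else 0)) = - \<epsilon> * real J - (if i0 < J then 1 else 0)"
    by (simp add: sum_subtractf)
  ultimately show ?thesis unfolding T_def by (simp split: if_splits)
qed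

text \<open>Averaging over all scales with weights 1 / (J M_i). The count at v = 0 is at most |A|,
  which gives the subtracted term.\<close>

lemma ex_scale_many_differences:
  assumes A: "A \<subseteq> {1..int N}" and J: "J \<ge> 1"
  shows "\<exists>i<J. real (M i) * ((real (card A))\<^sup>2 / (2 * real N) - (\<epsilon> + 1 / real J) * real (card A)) \<le>
     (\<Sum>x\<in>{M i..<2 * M i}. real (card {(a, a') \<in> A \<times> A. a - a' = v i x}))"
proof (rule ccontr)
  assume neg: "\<not> ?thesis"
  define E where "E = (real (card A))\<^sup>2 / (2 * real N) - (\<epsilon> + 1 / real J) * real (card A)"
  define I where "I = (SIGMA i:{..<J}. {M i..<2 * M i})"
  define w where "w p = 1 / (real J * real (M (fst p)))" for p :: "nat \<times> nat"
  define c where "c i x = real (card {(a, a') \<in> A \<times> A. a - a' = v i x})" for i x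
  have M0: "real (M i) > 0" if "i < J" for i using M_bounds(4)[OF that] by simp
  have finA: "finite A" using A finite_subset by blast
  have sumI: "(\<Sum>p\<in>I. w p * F p) = (1 / real J) * (\<Sum>i<J. (1 / real (M i)) * (\<Sum>x\<in>{M i..<2 * M i}. F (i, x)))"
    for F :: "nat \<times> nat \<Rightarrow> real"
  proof -
    have "(\<Sum>p\<in>I. w p * F p) = (\<Sum>i<J. \<Sum>x\<in>{M i..<2 * M i}. w (i, x) * F (i, x))"
      unfolding I_def by (subst sum.Sigma) (auto simp: case_prod_unfold)
    then show ?thesis unfolding w_def by (simp add: sum_distrib_left)
  qed
  have "(real (card A))\<^sup>2 / real (2 * N) - (\<epsilon> + 1 / real J) * real (cyclic_count (2 * N) A 0) \<le>
     (\<Sum>p\<in>I. w p * real (cyclic_count (2 * N) A (v (fst p) (snd p))))"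
  proof (rule weighted_count_ge)
    show "sum w I = 1"
    proof -
      have "sum w I = (1 / real J) * (\<Sum>i<J. (1 / real (M i)) * (\<Sum>x\<in>{M i..<2 * M i}. 1))"
        using sumI[of "\<lambda>_. 1"] by simp
      also have "(\<Sum>i<J. (1 / real (M i)) * (\<Sum>x\<in>{M i..<2 * M i}. 1)) = (\<Sum>i<J. 1)"
      proof (rule sum.cong[OF refl])
        fix i assume "i \<in> {..<J}"
        then show "(1 / real (M i)) * (\<Sum>x\<in>{M i..<2 * M i}. 1) = 1" using M0[of i] by simp
      qed
      finally show ?thesis using J by simp
    qed
    fix j assume "j < 2 * N"
    define \<alpha> where "\<alpha> = real j / real (2 * N)"
    have eq: "real j * (real_of_int u / real (2 * N)) = \<alpha> * real_of_int u" for u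
      unfolding \<alpha>_def by simp
    have "- (\<epsilon> + 1 / real J) = (1 / real J) * - (\<epsilon> * real J + 1)" using J by (simp add: field_simps)
    also have "\<dots> \<le> (1 / real J) * (\<Sum>i<J. (1 / real (M i)) * (\<Sum>x\<in>{M i..<2 * M i}. Re (unit_exp (\<alpha> * real_of_int (v i x)))))"
      by (intro mult_left_mono sum_scales_Re_ge) auto
    finally show "- (\<epsilon> + 1 / real J) \<le> (\<Sum>p\<in>I. w p * Re (unit_exp (real j * (real_of_int (v (fst p) (snd p)) / real (2 * N)))))"
      unfolding sumI eq fst_conv snd_conv .
  qed (use N finA \<epsilon> in \<open>auto simp: I_def\<close>)
  also have "\<dots> = (1 / real J) * (\<Sum>i<J. (1 / real (M i)) * (\<Sum>x\<in>{M i..<2 * M i}. c i x))"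
    unfolding sumI fst_conv snd_conv c_def
    using cyclic_count_eq[OF A _ _ N] v_bounds(1) v_le_N
    by (intro arg_cong2[where f = times] sum.cong refl) (auto simp: less_imp_le)
  also have "\<dots> < (1 / real J) * (\<Sum>i<J. E)"
  proof (rule mult_strict_left_mono[OF sum_strict_mono])
    fix i assume "i \<in> {..<J}"
    then have "(\<Sum>x\<in>{M i..<2 * M i}. c i x) < real (M i) * E" "real (M i) > 0"
      using neg M0[of i] unfolding c_def E_def by (auto simp: not_le)
    then show "(1 / real (M i)) * (\<Sum>x\<in>{M i..<2 * M i}. c i x) < E" by (simp add: field_simps)
  qed (use J in \<open>auto simp: lessThan_empty_iff\<close>)
  also have "\<dots> = E" using J by simp
  finally have "(real (card A))\<^sup>2 / real (2 * N) - (\<epsilon> + 1 / real J) * real (cyclic_count (2 * N) A 0) < E" .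
  moreover have "cyclic_count (2 * N) A 0 \<le> card A"
    using cyclic_count_eq[OF A, of 0] N card_differences_le[OF finA, of 0] by simp
  then have "(\<epsilon> + 1 / real J) * real (cyclic_count (2 * N) A 0) \<le> (\<epsilon> + 1 / real J) * real (card A)"
    using \<epsilon> by (intro mult_left_mono) auto
  ultimately show False unfolding E_def by simp
qed

end

section \<open>Back to the variable of h_W\<close>

context scales
begin

definition point :: "nat \<Rightarrow> nat \<Rightarrow> nat" where "point i x = nat ((arg i x - r W) div int W)"

text \<open>The division is exact because r_d and r_W agree modulo \<open>W\<close> and
  \<open>W\<close> divides d. The point is at least 1 since arg \<ge> 1 > r_W, which keeps the term
  n = 0 of the series out of the count.\<close>

lemma point:
  assumes i: "i < J" and x: "x \<in> {M i..<2 * M i}"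
  shows "r W + int W * int (point i x) = arg i x" "point i x \<ge> 1"
proof -
  have W0: "int W > 0" using W by simp
  have "int W dvd r (d i) - r W"
    unfolding d_def using W B_pos by (intro r_mult) auto
  moreover have "int W dvd int (d i) * int x" unfolding d_def by simp
  ultimately have "int W dvd (r (d i) - r W) + int (d i) * int x" by (rule dvd_add)
  moreover have "(r (d i) - r W) + int (d i) * int x = arg i x - r W" unfolding arg_def by simp
  ultimately obtain n where n: "arg i x - r W = int W * n" by auto
  have "arg i x - r W > 0" using arg_bounds(1)[OF i x] r_bounds(2)[OF W] by linarith
  then have "n > 0" using W0 unfolding n by (simp add: zero_less_mult_iff)
  have "point i x = nat n" unfolding point_def n using W0 by simp
  then show "r W + int W * int (point i x) = arg i x" "point i x \<ge> 1" using n \<open>n > 0\<close> by auto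
qed

lemma inj_on_point:
  assumes i: "i < J"
  shows "inj_on (point i) {M i..<2 * M i}"
proof (rule inj_onI)
  fix x y assume xy: "x \<in> {M i..<2 * M i}" "y \<in> {M i..<2 * M i}" "point i x = point i y"
  then have "arg i x = arg i y" using point(1)[OF i] by metis
  then show "x = y" unfolding arg_def using d_pos[of i] by simp
qed

text \<open>The bound has \<rho>^J in place of \<rho>^i because the averaging does not tell which
  scale it selects.\<close>

lemma pderiv_arg_ge:
  assumes i: "i < J" and x: "x \<in> {M i..<2 * M i}" and k2: "k \<ge> 2"
    and Y: "1 \<le> \<rho> ^ J * Z / 8" "2 * real_of_int (poly (map_poly abs (pderiv h)) 1) \<le> \<rho> ^ J * Z / 8"
  shows "(\<rho> ^ J * Z / 8) ^ (k - 1) / 2 \<le> real_of_int (poly (pderiv h) (arg i x))"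
proof -
  define Y where "Y = \<rho> ^ J * Z / 8"
  have "\<rho> ^ J \<le> \<rho> ^ i" using i \<rho> by (intro power_decreasing) auto
  then have "Y \<le> \<rho> ^ i * Z / 8" unfolding Y_def using Z by (intro divide_right_mono mult_right_mono) auto
  then have Ya: "Y \<le> real_of_int (arg i x)" using arg_bounds(3)[OF i x] by linarith
  have "arg i x ^ Suc (k - 2) \<le> 2 * poly (pderiv h) (arg i x)"
  proof (rule poly_ge_half_power)
    show dg: "Polynomial.degree (pderiv h) = Suc (k - 2)" using deg k2 by (simp add: degree_pderiv)
    have "Polynomial.lead_coeff (pderiv h) = int k * Polynomial.lead_coeff h"
    proof -
      have "Suc (Suc (k - 2)) = k" using k2 by simp
      then show ?thesis unfolding dg coeff_pderiv deg by simp
    qed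
    also have "\<dots> \<ge> 1 * 1" using k lead by (intro mult_mono) auto
    finally show "1 \<le> Polynomial.lead_coeff (pderiv h)" by simp
    show "1 \<le> arg i x" by (rule arg_bounds(1)[OF i x])
    have "real_of_int (2 * poly (map_poly abs (pderiv h)) 1) \<le> real_of_int (arg i x)"
      using assms(5) Ya unfolding Y_def by simp
    then show "2 * poly (map_poly abs (pderiv h)) 1 \<le> arg i x" by (simp only: of_int_le_iff)
  qed
  then have "real_of_int (arg i x ^ Suc (k - 2)) \<le> real_of_int (2 * poly (pderiv h) (arg i x))"
    by (simp only: of_int_le_iff)
  moreover have "Suc (k - 2) = k - 1" using k2 by simp
  ultimately have "real_of_int (arg i x) ^ (k - 1) / 2 \<le> real_of_int (poly (pderiv h) (arg i x))" by simp
  moreover have "Y ^ (k - 1) \<le> real_of_int (arg i x) ^ (k - 1)"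
    using Ya assms(4) unfolding Y_def by (intro power_mono) auto
  ultimately show ?thesis unfolding Y_def by linarith
qed

text \<open>Up to constants, the weight W Z^(k-1) / \<lambda>(W) times the length Z / W is Z^k /
  \<lambda>(W), which is N / H by the choice of \<open>Z\<close>. Here the dependence on
  \<open>W\<close> disappears.\<close>

lemma weight_times_length_ge:
  assumes i: "i < J" and E: "E \<ge> 0"
  shows "E * real N * (\<rho> ^ J / 8) ^ k / (real_of_int H * real B ^ J) \<le>
    real W * ((\<rho> ^ J * Z / 8) ^ (k - 1) / 2) / real (l W) * (real (M i) * E)"
proof -
  define Y where "Y = \<rho> ^ J * Z / 8"
  have Y0: "Y > 0" unfolding Y_def using \<rho> Z by simp
  have lW: "real (l W) > 0" using l_pos[OF W] by simp
  have W0: "real W > 0" using W by simp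
  have B0: "real B ^ J > 0" using B_pos by simp
  have H0: "real_of_int H > 0" using H_ge_1 by simp
  have "Y ^ k = (\<rho> ^ J / 8) ^ k * Z ^ k" unfolding Y_def by (simp add: power_mult_distrib power_divide)
  then have Yk: "Y ^ k = (\<rho> ^ J / 8) ^ k * (real N * real (l W) / real_of_int H)" unfolding Z(2) .
  have "2 * Y / (real W * real B ^ J) \<le> real (M i)"
  proof -
    have "\<rho> ^ J * Z \<le> \<rho> ^ i * Z" using i \<rho> Z by (intro mult_right_mono power_decreasing) auto
    moreover have "B ^ i \<le> B ^ J" using i B_pos by (intro power_increasing) auto
    then have "d i \<le> W * B ^ J" unfolding d_def by simp
    then have "real (d i) \<le> real (W * B ^ J)" by (simp only: of_nat_le_iff)
    ultimately have "\<rho> ^ J * Z / (4 * real (W * B ^ J)) \<le> \<rho> ^ i * Z / (4 * real (d i))"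
      using \<rho> Z d_pos[of i] by (intro frac_le) auto
    also have "\<dots> \<le> real (M i)" by (rule M_bounds(1)[OF i])
    finally show ?thesis unfolding Y_def by (simp add: mult_ac)
  qed
  then have "real W * (Y ^ (k - 1) / 2) / real (l W) * (2 * Y / (real W * real B ^ J) * E) \<le>
      real W * (Y ^ (k - 1) / 2) / real (l W) * (real (M i) * E)"
    using Y0 lW W0 E by (intro mult_left_mono mult_right_mono) auto
  also have "real W * (Y ^ (k - 1) / 2) / real (l W) * (2 * Y / (real W * real B ^ J) * E) =
      Y ^ k / (real (l W) * real B ^ J) * E"
  proof -
    have "Y ^ k = Y ^ (k - 1) * Y" using k by (simp add: power_eq_if mult.commute)
    then show ?thesis using W0 lW B0 by (simp add: field_simps)
  qed
  also have "\<dots> = E * real N * (\<rho> ^ J / 8) ^ k / (real_of_int H * real B ^ J)"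
    unfolding Yk using lW B0 H0 by (simp add: field_simps)
  finally show ?thesis unfolding Y_def .
qed

end

section \<open>The polynomials h_W over the reals and the series R\<close>

lemma poly_map_poly_of_int: "poly (map_poly real_of_int p) (real_of_int y) = real_of_int (poly p y)"
  by (induction p) (simp_all add: map_poly_pCons)

lemma pderiv_map_poly_of_int: "pderiv (map_poly real_of_int p) = map_poly real_of_int (pderiv p)"
  by (intro poly_eqI) (simp add: coeff_pderiv coeff_map_poly)

lemma poly_aux_poly:
  "poly (aux_poly h z W) (real n) = real_of_int (poly h (root_rep z W + int W * int n)) / real (lam h z W)"
  using poly_map_poly_of_int[of "pcompose h [:root_rep z W, int W:]" "int n"]
  by (simp add: aux_poly_def poly_pcompose mult.commute)

lemma poly_pderiv_aux_poly:
  "poly (pderiv (aux_poly h z W)) (real n) =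
     real W * real_of_int (poly (pderiv h) (root_rep z W + int W * int n)) / real (lam h z W)"
  using poly_map_poly_of_int[of "pderiv (pcompose h [:root_rep z W, int W:])" "int n"]
  by (simp add: aux_poly_def pderiv_smult pderiv_map_poly_of_int pderiv_pcompose pderiv_pCons poly_pcompose mult.commute)

lemma degree_aux_poly:
  assumes "W > 0"
  shows "Polynomial.degree (aux_poly h z W) = Polynomial.degree h"
  using assms lam_pos[of h z W] by (simp add: aux_poly_def degree_map_poly degree_pcompose)

lemma finite_rep_count_nonzero:
  assumes "Polynomial.degree g > 0" "finite A"
  shows "finite {n. rep_count g n A \<noteq> 0}"
proof -
  have "finite {n. poly g (real n) = c}" for c
  proof -
    have "g - [:c:] \<noteq> 0" using assms(1) by auto
    then have "finite {x. poly (g - [:c:]) x = 0}" by (rule poly_roots_finite)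
    then have "finite (real -` {x. poly (g - [:c:]) x = 0})" by (rule finite_vimageI) (simp add: inj_on_def)
    then show ?thesis by (simp add: vimage_def)
  qed
  then have "finite (\<Union>(a, a')\<in>A \<times> A. {n. poly g (real n) = real_of_int (a - a')})"
    using assms(2) by auto
  moreover have "{n. rep_count g n A \<noteq> 0} \<subseteq> (\<Union>(a, a')\<in>A \<times> A. {n. poly g (real n) = real_of_int (a - a')})"
  proof
    fix n assume "n \<in> {n. rep_count g n A \<noteq> 0}"
    then show "n \<in> (\<Union>(a, a')\<in>A \<times> A. {n. poly g (real n) = real_of_int (a - a')})"
      by (auto simp: rep_count_def card_eq_0_iff) metis
  qed
  ultimately show ?thesis by (rule finite_subset[rotated])
qed

lemma rep_count_le:
  assumes "finite A"
  shows "rep_count g n A \<le> card A"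
proof -
  have "inj_on fst {(a, a') \<in> A \<times> A. real_of_int (a - a') = poly g (real n)}"
    by (auto simp: inj_on_def)
  then have "rep_count g n A = card (fst ` {(a, a') \<in> A \<times> A. real_of_int (a - a') = poly g (real n)})"
    unfolding rep_count_def by (simp add: card_image)
  also have "\<dots> \<le> card A" using assms by (intro card_mono) auto
  finally show ?thesis .
qed

text \<open>The term n = 0 is split off because, for h_W, the derivative of \<open>h\<close> is
  taken there at r_W \<le> 0, where its sign is not controlled.\<close>

lemma R_sum_ge:
  assumes g: "Polynomial.degree g > 0" and A: "finite A" and S: "finite S" "0 \<notin> S"
    and nonneg: "\<And>n. n \<ge> 1 \<Longrightarrow> poly (pderiv g) (real n) \<ge> 0"
    and c: "\<And>n. n \<in> S \<Longrightarrow> c \<le> poly (pderiv g) (real n)"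
  shows "c * (\<Sum>n\<in>S. real (rep_count g n A)) + poly (pderiv g) 0 * real (rep_count g 0 A) \<le> R_sum A g"
proof -
  define f where "f n = poly (pderiv g) (real n) * real (rep_count g n A)" for n
  define F where "F = insert 0 (S \<union> {n. rep_count g n A \<noteq> 0})"
  have F: "finite F" unfolding F_def using S finite_rep_count_nonzero[OF g A] by simp
  have "R_sum A g = (\<Sum>n\<in>F. f n)"
    unfolding R_sum_def f_def by (rule suminf_finite[OF F]) (auto simp: F_def)
  also have "\<dots> = f 0 + (\<Sum>n\<in>F - {0}. f n)" using F by (intro sum.remove) (auto simp: F_def)
  also have "(\<Sum>n\<in>F - {0}. f n) \<ge> (\<Sum>n\<in>S. f n)"
    using F S nonneg unfolding f_def
    by (intro sum_mono2) (auto simp: F_def intro!: mult_nonneg_nonneg)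
  moreover have "(\<Sum>n\<in>S. f n) \<ge> (\<Sum>n\<in>S. c * real (rep_count g n A))"
    unfolding f_def using c by (intro sum_mono mult_right_mono) auto
  ultimately show ?thesis by (simp add: f_def sum_distrib_left)
qed

lemma lead_coeff_pos_of_pos:
  fixes p :: "real poly"
  assumes "\<And>x. x \<ge> 0 \<Longrightarrow> poly p x > 0"
  shows "Polynomial.lead_coeff p > 0"
proof (rule ccontr)
  assume "\<not> ?thesis"
  moreover have "p \<noteq> 0" using assms[of 0] by auto
  ultimately have "0 < Polynomial.lead_coeff (- p)" by (simp add: less_le lead_coeff_minus)
  then obtain n where n: "\<And>x. x \<ge> n \<Longrightarrow> poly (- p) x \<ge> Polynomial.lead_coeff (- p)"
    using poly_pinfty_gt_lc by blast
  have "poly (- p) (max n 0) > 0" using n[of "max n 0"] \<open>0 < Polynomial.lead_coeff (- p)\<close> by linarith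
  then show False using assms[of "max n 0"] by simp
qed

section \<open>Choice of the constants\<close>

theorem theorem8:
  fixes k :: nat
  assumes "k \<ge> 2"
  shows "\<exists>\<kappa>\<^sub>1::real. \<kappa>\<^sub>1 > 0 \<and>
    (\<forall>(h::int poly) (\<delta>::real).
       intersective h \<and> Polynomial.degree h = k \<and>
       (\<forall>x\<ge>0. poly (map_poly real_of_int h) x > 0) \<and>
       mono_on {0..} (poly (map_poly real_of_int h)) \<and>
       (\<forall>x\<ge>0. poly (map_poly real_of_int (pderiv h)) x > 0) \<and>
       mono_on {0..} (poly (map_poly real_of_int (pderiv h))) \<and>
       0 < \<delta> \<and> \<delta> \<le> 1 \<longrightarrow>
       (\<exists>C::real. C > 0 \<and>
         (\<exists>N\<^sub>0::nat. \<forall>z. root_system h z \<longrightarrow>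
           (\<forall>N\<ge>N\<^sub>0. \<forall>A::int set. \<forall>W::nat.
              A \<subseteq> {1..int N} \<and> real (card A) = \<delta> * real N \<and>
              W > 0 \<and> real W < real N powr \<kappa>\<^sub>1 \<longrightarrow>
              R_sum A (aux_poly h z W) \<ge> C * (real (card A))\<^sup>2))))"
proof -
  \<comment> \<open>k (k + 1) is what \<open>K1 * W ^ (k + 1) < Z\<close> requires after raising to
    the k-th power; the 2 gives \<open>w\<^sup>2 < N\<close>, so that constants are absorbed for
    large N.\<close>
  define m where "m = 2 * (k * (k + 1))"
  have m0: "m > 0" using assms unfolding m_def by simp
  define \<kappa> where "\<kappa> = 1 / real m"
  show ?thesis
  proof (rule exI[of _ \<kappa>], intro conjI allI impI, goal_cases)
    case 1
    show ?case unfolding \<kappa>_def using m0 by simp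
  next
    case (2 h \<delta>)
    then have deg: "Polynomial.degree h = k" and hpos: "\<And>x. x \<ge> 0 \<Longrightarrow> poly (map_poly real_of_int h) x > 0"
      and h'pos: "\<And>x. x \<ge> 0 \<Longrightarrow> poly (map_poly real_of_int (pderiv h)) x > 0"
      and \<delta>: "0 < \<delta>" "\<delta> \<le> 1" by blast+
    have pos: "poly h y > 0" if "y \<ge> 0" for y
      using hpos[of "real_of_int y"] that by (simp add: poly_map_poly_of_int)
    have pos': "poly (pderiv h) y > 0" if "y \<ge> 0" for y
      using h'pos[of "real_of_int y"] that by (simp add: poly_map_poly_of_int)
    have lead: "Polynomial.lead_coeff h \<ge> 1"
      using lead_coeff_pos_of_pos[OF hpos] by (simp add: coeff_map_poly degree_map_poly)
    have h0: "h \<noteq> 0" using pos[of 0] by auto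
    define H where "H = poly (map_poly abs h) 1"
    define K where "K = real_of_int (poly (map_poly abs (pderiv h)) 1)"
    have H1: "H \<ge> 1" using abs_poly_le[of 0 1 h] pos[of 0] by (simp add: H_def)
    have K0: "K \<ge> 0" using abs_poly_le[of 0 1 "pderiv h"] unfolding K_def by simp
    \<comment> \<open>With \<epsilon> and 1 / J at most \<delta> / 8, the loss (\<epsilon> + 1 / J)
      |A| is at most half of the main term |A|^2 / (2 N) = \<delta> |A| / 2.\<close>
    define \<epsilon> where "\<epsilon> = \<delta> / 8"
    define J where "J = nat \<lceil>8 / \<delta>\<rceil>"
    have \<epsilon>: "0 < \<epsilon>" "\<epsilon> \<le> 1" using \<delta> unfolding \<epsilon>_def by auto
    have J8: "8 / \<delta> \<le> real J" unfolding J_def by (rule real_nat_ceiling_ge)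
    have "8 / \<delta> > 0" using \<delta> by simp
    then have J: "J \<ge> 1" using J8 by linarith
    obtain C :: nat where C: "C \<ge> 1" and weyl: "\<And>c M. M \<ge> 1 \<Longrightarrow> \<epsilon> / 4 * real M \<le> norm (\<Sum>x<M. unit_exp (phase k c x)) \<Longrightarrow>
        \<exists>q\<in>{1..C}. \<forall>j\<in>{1..k}. near (real C / real M ^ j) (real q * c j)"
      using weyl_inverse[of "\<epsilon> / 4" k] \<epsilon> by auto
    obtain G where G: "G > 0" and arith: "\<And>z. root_system h z \<Longrightarrow> arith_data h G (lam h z) (root_rep z)"
      using ex_arith_data[OF h0] by metis
    define B where "B = G * fact C"
    define \<rho> where "\<rho> = \<epsilon> / (8 * real G * real C * 4 ^ k * real_of_int H)"
    have den: "1 \<le> 8 * real G * real C * 4 ^ k * real_of_int H"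
    proof -
      have "(1::real) * 1 * 1 * 1 * 1 \<le> 8 * real G * real C * 4 ^ k * real_of_int H"
        using G C H1 by (intro mult_mono one_le_power) auto
      then show ?thesis by simp
    qed
    have \<rho>: "0 < \<rho>" "\<rho> \<le> 1" "8 * \<rho> * real G * real C * 4 ^ k * real_of_int H \<le> \<epsilon>"
    proof -
      show "0 < \<rho>" unfolding \<rho>_def using \<epsilon>(1) den by (intro divide_pos_pos) linarith+
      have "\<rho> \<le> 1 / 1" unfolding \<rho>_def using \<epsilon> den by (intro frac_le) auto
      then show "\<rho> \<le> 1" by simp
      have "8 * real G * real C * 4 ^ k * real_of_int H \<noteq> 0" using den by linarith
      then have "\<rho> * (8 * real G * real C * 4 ^ k * real_of_int H) = \<epsilon>" unfolding \<rho>_def by (rule nonzero_eq_divide_eq[THEN iffD1, OF _ refl])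
      then show "8 * \<rho> * real G * real C * 4 ^ k * real_of_int H \<le> \<epsilon>" by (simp add: mult_ac)
    qed
    \<comment> \<open>Half of the constant that \<open>weight_times_length_ge\<close> yields for E =
      \<delta>^2 N / 4; the other half absorbs the term n = 0.\<close>
    define D where "D = (\<rho> ^ J / 8) ^ k / (8 * (real_of_int H * real B ^ J))"
    have B0: "B > 0" unfolding B_def using G by simp
    have D0: "D > 0" unfolding D_def using \<rho>(1) H1 B0 by simp
    \<comment> \<open>Collects what \<rho>^J Z has to exceed, with the power of \<open>W\<close>
      taken out: the locale condition \<open>large\<close> and the lower bounds demanded by
      \<open>pderiv_arg_ge\<close>.\<close>
    define K1 where "K1 = (8 * 2 ^ k * real_of_int H * real C * real B ^ (J * (k + 1)) + 8 * (1 + 2 * K)) / \<rho> ^ J"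
    have K1: "8 * 2 ^ k * real_of_int H * real C * real B ^ (J * (k + 1)) + 8 * (1 + 2 * K) = \<rho> ^ J * K1"
      unfolding K1_def using \<rho>(1) by simp
    define T where "T = real_of_int H * K1 ^ k"
    \<comment> \<open>Squares occur because \<open>w\<^sup>2 < N\<close> is what will be available.
      \<open>N0\<close> is fixed before \<open>z\<close> and \<open>W\<close>.\<close>
    define N0 where "N0 = nat \<lceil>T\<^sup>2\<rceil> + nat \<lceil>(K / (D * \<delta>))\<^sup>2\<rceil> + 1"
    show ?case
    proof (rule exI[of _ D], rule conjI[OF D0], rule exI[of _ N0], intro allI impI, goal_cases)
      case (1 z N A W)
      then have rs: "root_system h z" and N: "N \<ge> N0" and A: "A \<subseteq> {1..int N}"
        and cardA: "real (card A) = \<delta> * real N" and W: "W > 0" and WN: "real W < real N powr \<kappa>"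
        by blast+
      have N1: "T\<^sup>2 \<le> real N" "(K / (D * \<delta>))\<^sup>2 \<le> real N" "N > 0"
        using N real_nat_ceiling_ge[of "T\<^sup>2"] real_nat_ceiling_ge[of "(K / (D * \<delta>))\<^sup>2"] unfolding N0_def
        by linarith+
      define l r where "l = lam h z" and "r = root_rep z"
      have lW: "real (l W) \<ge> 1" using lam_pos[of h z W] unfolding l_def by (simp add: Suc_leI)
      define w where "w = real W ^ (k * (k + 1))"
      have w2: "w\<^sup>2 < real N"
      proof -
        have "real W ^ m = real W powr real m" using W by (simp add: powr_realpow)
        also have "\<dots> < (real N powr \<kappa>) powr real m" using WN m0 by (intro powr_less_mono2) auto
        also have "\<dots> = real N" unfolding powr_powr \<kappa>_def using m0 N1(3) by simp
        finally show ?thesis unfolding w_def m_def by (simp add: power_mult[symmetric] mult.commute)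
      qed
      define Z where "Z = root k (real N * real (l W) / real_of_int H)"
      have Zpos: "real N * real (l W) / real_of_int H > 0" using N1(3) lW H1 by simp
      have Z: "Z > 0" "Z ^ k = real N * real (l W) / real_of_int H"
        unfolding Z_def using Zpos assms by (auto simp: real_root_gt_zero)
      have K1_0: "K1 \<ge> 0"
        unfolding K1_def using K0 H1 \<rho>(1) by (intro divide_nonneg_nonneg add_nonneg_nonneg mult_nonneg_nonneg) auto
      have Zbig: "K1 * real W ^ (k + 1) < Z"
      proof (rule ccontr)
        assume "\<not> ?thesis"
        then have "Z ^ k \<le> (K1 * real W ^ (k + 1)) ^ k" using Z(1) by (intro power_mono) auto
        then have "real N * real (l W) / real_of_int H \<le> K1 ^ k * w"
          unfolding Z(2) w_def by (simp add: power_mult_distrib power_mult[symmetric] mult.commute del: power_Suc)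
        then have "real N * real (l W) \<le> T * w" unfolding T_def using H1 by (simp add: field_simps)
        moreover have "real N * 1 \<le> real N * real (l W)" using lW by (intro mult_left_mono) auto
        ultimately have "real N \<le> T * w" by linarith
        then have "(real N)\<^sup>2 \<le> (T * w)\<^sup>2" by (intro power_mono) auto
        also have "\<dots> = T\<^sup>2 * w\<^sup>2" by (rule power_mult_distrib)
        also have "\<dots> \<le> real N * w\<^sup>2" using N1(1) by (intro mult_right_mono) auto
        also have "\<dots> < real N * real N" using w2 N1(3) by (intro mult_strict_left_mono) auto
        finally show False by (simp add: power2_eq_square)
      qed
      have W1: "1 \<le> real W ^ (k + 1)" using W by (intro one_le_power) simp
      have \<rho>Z: "8 * (1 + 2 * K) < \<rho> ^ J * Z"
        and large: "8 * 2 ^ k * real_of_int H * real C * real B ^ (J * (k + 1)) * real W ^ (k + 1) < \<rho> ^ J * Z"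
      proof -
        have lt: "\<rho> ^ J * K1 * real W ^ (k + 1) < \<rho> ^ J * Z"
          using Zbig \<rho>(1) by (simp add: mult.assoc)
        define P where "P = 8 * 2 ^ k * real_of_int H * real C * real B ^ (J * (k + 1))"
        have P0: "P \<ge> 0" unfolding P_def using H1 by simp
        have PK: "(P + 8 * (1 + 2 * K)) * real W ^ (k + 1) < \<rho> ^ J * Z" using lt unfolding K1[symmetric] P_def .
        have "8 * (1 + 2 * K) * 1 \<le> (P + 8 * (1 + 2 * K)) * real W ^ (k + 1)"
          using P0 K0 W1 by (intro mult_mono) auto
        then show "8 * (1 + 2 * K) < \<rho> ^ J * Z" using PK by linarith
        have "P * real W ^ (k + 1) \<le> (P + 8 * (1 + 2 * K)) * real W ^ (k + 1)"
          using K0 W1 by (intro mult_right_mono) auto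
        then show "8 * 2 ^ k * real_of_int H * real C * real B ^ (J * (k + 1)) * real W ^ (k + 1) < \<rho> ^ J * Z"
          using PK unfolding P_def by linarith
      qed
      interpret scales h k G C N W J B \<epsilon> \<rho> Z H l r
      proof
        fix i assume i: "i < J"
        have "real (W * B ^ i) ^ (k + 1) \<le> real (W * B ^ J) ^ (k + 1)"
          using i B0 by (intro power_mono) (auto intro!: mult_left_mono power_increasing)
        also have "\<dots> = real B ^ (J * (k + 1)) * real W ^ (k + 1)"
          by (simp only: of_nat_mult of_nat_power power_mult_distrib power_mult mult.commute)
        finally have "8 * 2 ^ k * real_of_int H * real C * real (W * B ^ i) ^ (k + 1) \<le>
            8 * 2 ^ k * real_of_int H * real C * (real B ^ (J * (k + 1)) * real W ^ (k + 1))"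
          using H1 by (intro mult_left_mono) auto
        also have "\<dots> < \<rho> ^ J * Z" using large by (simp only: mult.assoc)
        also have "\<dots> \<le> \<rho> ^ i * Z" using i \<rho> Z by (intro mult_right_mono power_decreasing) auto
        finally show "8 * 2 ^ k * real_of_int H * real C * real (W * B ^ i) ^ (k + 1) < \<rho> ^ i * Z" .
      qed (use assms deg lead pos arith[OF rs] G weyl C \<epsilon> W N1(3) \<rho> Z in \<open>auto simp: H_def B_def l_def r_def\<close>)
      have finA: "finite A" using A finite_subset by blast
      define g where "g = aux_poly h z W"
      obtain i where i: "i < J" and many: "real (M i) * ((real (card A))\<^sup>2 / (2 * real N) - (\<epsilon> + 1 / real J) * real (card A)) \<le>
         (\<Sum>x\<in>{M i..<2 * M i}. real (card {(a, a') \<in> A \<times> A. a - a' = v i x}))"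
        using ex_scale_many_differences[OF A J] by blast
      define E where "E = \<delta>\<^sup>2 * real N / 4"
      have "E \<le> (real (card A))\<^sup>2 / (2 * real N) - (\<epsilon> + 1 / real J) * real (card A)"
      proof -
        have "1 / real J \<le> \<delta> / 8" using J8 J \<delta> by (simp add: field_simps)
        then have "(\<epsilon> + 1 / real J) * real (card A) \<le> (\<delta> / 4) * real (card A)"
          unfolding \<epsilon>_def by (intro mult_right_mono) auto
        also have "\<dots> = \<delta>\<^sup>2 * real N / 4" unfolding cardA by (simp add: power2_eq_square)
        finally have "(\<epsilon> + 1 / real J) * real (card A) \<le> \<delta>\<^sup>2 * real N / 4" .
        moreover have "(real (card A))\<^sup>2 / (2 * real N) = \<delta>\<^sup>2 * real N / 2"
          unfolding cardA using N1(3) by (simp add: power2_eq_square)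
        ultimately show ?thesis unfolding E_def by simp
      qed
      then have "real (M i) * E \<le> real (M i) * ((real (card A))\<^sup>2 / (2 * real N) - (\<epsilon> + 1 / real J) * real (card A))"
        by (intro mult_left_mono) auto
      then have sumE: "real (M i) * E \<le> (\<Sum>x\<in>{M i..<2 * M i}. real (card {(a, a') \<in> A \<times> A. a - a' = v i x}))"
        using many by linarith
      define S where "S = point i ` {M i..<2 * M i}"
      have "(\<Sum>n\<in>S. real (rep_count g n A)) = (\<Sum>x\<in>{M i..<2 * M i}. real (rep_count g (point i x) A))"
        unfolding S_def by (simp add: sum.reindex[OF inj_on_point[OF i]])
      also have "\<dots> = (\<Sum>x\<in>{M i..<2 * M i}. real (card {(a, a') \<in> A \<times> A. a - a' = v i x}))"
      proof (rule sum.cong[OF refl])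
        fix x assume x: "x \<in> {M i..<2 * M i}"
        have "poly g (real (point i x)) = real_of_int (poly h (arg i x)) / real (l W)"
          unfolding g_def poly_aux_poly l_def r_def[symmetric] using point(1)[OF i x] by simp
        also have "\<dots> = real_of_int (v i x)" unfolding l_W_v[symmetric] using lW by simp
        finally have "poly g (real (point i x)) = real_of_int (v i x)" .
        then show "real (rep_count g (point i x) A) = real (card {(a, a') \<in> A \<times> A. a - a' = v i x})"
          unfolding rep_count_def by (simp only: of_int_eq_iff)
      qed
      finally have sumS: "real (M i) * E \<le> (\<Sum>n\<in>S. real (rep_count g n A))" using sumE by simp
      define c where "c = real W * ((\<rho> ^ J * Z / 8) ^ (k - 1) / 2) / real (l W)"
      have "c * (\<Sum>n\<in>S. real (rep_count g n A)) + poly (pderiv g) 0 * real (rep_count g 0 A) \<le> R_sum A g"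
      proof (rule R_sum_ge)
        show "Polynomial.degree g > 0" unfolding g_def using degree_aux_poly[OF W] deg assms by simp
        show "0 \<notin> S" unfolding S_def using point(2)[OF i] by fastforce
        fix n :: nat
        {
          assume n: "n \<ge> 1"
          have "int W * 1 \<le> int W * int n" using n by (intro mult_left_mono) auto
          then have "poly (pderiv h) (r W + int W * int n) > 0"
            using r_bounds(1)[OF W] by (intro pos') linarith
          then show "0 \<le> poly (pderiv g) (real n)"
            unfolding g_def poly_pderiv_aux_poly r_def by simp
        }
        assume "n \<in> S"
        then obtain x where x: "x \<in> {M i..<2 * M i}" "n = point i x" unfolding S_def by blast
        have "(\<rho> ^ J * Z / 8) ^ (k - 1) / 2 \<le> real_of_int (poly (pderiv h) (arg i x))"
        proof (rule pderiv_arg_ge[OF i x(1) assms])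
          have Q: "1 \<le> Q / 8" "2 * K \<le> Q / 8" if "8 * (1 + 2 * K) < Q" for Q
            using that K0 by simp_all
          show "1 \<le> \<rho> ^ J * Z / 8" by (rule Q(1)[OF \<rho>Z])
          show "2 * real_of_int (poly (map_poly abs (pderiv h)) 1) \<le> \<rho> ^ J * Z / 8"
            using Q(2)[OF \<rho>Z] unfolding K_def .
        qed
        then show "c \<le> poly (pderiv g) (real n)"
          unfolding g_def poly_pderiv_aux_poly c_def l_def[symmetric] r_def[symmetric] x(2) point(1)[OF i x(1)]
          using lW by (intro divide_right_mono mult_left_mono) auto
      qed (use finA in \<open>auto simp: S_def\<close>)
      moreover have "2 * D * (\<delta> * real N)\<^sup>2 \<le> c * (\<Sum>n\<in>S. real (rep_count g n A))"
      proof -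
        have "2 * D * (\<delta> * real N)\<^sup>2 = E * real N * (\<rho> ^ J / 8) ^ k / (real_of_int H * real B ^ J)"
          unfolding D_def E_def by (simp add: power2_eq_square)
        also have "\<dots> \<le> c * (real (M i) * E)"
          unfolding c_def by (rule weight_times_length_ge[OF i]) (simp add: E_def)
        also have "\<dots> \<le> c * (\<Sum>n\<in>S. real (rep_count g n A))"
          using sumS Z(1) \<rho>(1) unfolding c_def by (intro mult_left_mono) auto
        finally show ?thesis .
      qed
      \<comment> \<open>Since r_W > -W, the value h'(r_W) is O(W^(k-1)), and the term n = 0 is O(W^k
        |A|), at most D |A|^2 by the choice of \<open>N0\<close>.\<close>
      moreover have "- (D * (\<delta> * real N)\<^sup>2) \<le> poly (pderiv g) 0 * real (rep_count g 0 A)"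
      proof -
        have "\<bar>poly (pderiv h) (r W)\<bar> \<le> poly (map_poly abs (pderiv h)) 1 * int W ^ Polynomial.degree (pderiv h)"
          using r_bounds[OF W] W by (intro abs_poly_le) auto
        then have "real_of_int \<bar>poly (pderiv h) (r W)\<bar> \<le> real_of_int (poly (map_poly abs (pderiv h)) 1 * int W ^ (k - 1))"
          using deg by (simp only: of_int_le_iff degree_pderiv)
        then have hb: "\<bar>real_of_int (poly (pderiv h) (r W))\<bar> \<le> K * real W ^ (k - 1)" unfolding K_def by simp
        have "poly (pderiv g) 0 = real W * real_of_int (poly (pderiv h) (r W)) / real (l W)"
          using poly_pderiv_aux_poly[of h z W 0] unfolding g_def l_def r_def by simp
        then have "\<bar>poly (pderiv g) 0\<bar> = real W * \<bar>real_of_int (poly (pderiv h) (r W))\<bar> / real (l W)"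
          by (simp add: abs_mult)
        also have "\<dots> \<le> real W * (K * real W ^ (k - 1)) / 1"
          using hb lW K0 by (intro frac_le mult_left_mono) auto
        also have "\<dots> = K * real W ^ k" using assms by (simp add: power_eq_if)
        also have "\<dots> \<le> K * w"
        proof -
          have "real W ^ k \<le> w" unfolding w_def using W by (intro power_increasing) auto
          then show ?thesis using K0 by (rule mult_left_mono)
        qed
        also have "K * w \<le> D * \<delta> * real N"
        proof (rule power2_le_imp_le)
          have "K\<^sup>2 \<le> (D * \<delta>)\<^sup>2 * real N"
            using N1(2) D0 \<delta> by (simp add: power_divide field_simps)
          then have "K\<^sup>2 * w\<^sup>2 \<le> ((D * \<delta>)\<^sup>2 * real N) * real N" using w2 by (intro mult_mono) auto
          then show "(K * w)\<^sup>2 \<le> (D * \<delta> * real N)\<^sup>2" by (simp add: power_mult_distrib power2_eq_square mult_ac)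
        qed (use D0 \<delta> in auto)
        finally have "\<bar>poly (pderiv g) 0\<bar> \<le> D * \<delta> * real N" .
        moreover have "real (rep_count g 0 A) \<le> \<delta> * real N"
          using rep_count_le[OF finA, of g 0] unfolding cardA[symmetric] by simp
        ultimately have "\<bar>poly (pderiv g) 0 * real (rep_count g 0 A)\<bar> \<le> (D * \<delta> * real N) * (\<delta> * real N)"
          unfolding abs_mult by (intro mult_mono) auto
        moreover have "(D * \<delta> * real N) * (\<delta> * real N) = D * (\<delta> * real N)\<^sup>2" by (simp add: power2_eq_square)
        ultimately show ?thesis by linarith
      qed
      ultimately have "D * (\<delta> * real N)\<^sup>2 \<le> R_sum A g" by linarith
      then show ?case unfolding g_def cardA .
    qed
  qed
qed

end
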